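(* Let the integers $a(n)$, $n\ge 1$, be defined by $\sum_{n=1}^\infty a(n)q^n=\phi(q)$. Then $$\sum_{n=0}^\infty a(10n+9)q^n=5\left(46\,\frac{E_5E_{10}^2}{E_2^{2}}+460\,q\,\frac{E_{10}^5}{E_1^3E_2}+1125\,q^2\,\frac{E_{10}^8}{E_1^6E_5}+1875\,q\,\frac{E_2^8E_5^{9}}{E_1^{16}}+15625\,q^2\,\frac{E_2^8E_5^{15}}{E_1^{22}}\right).$$
   Context: Notation, for $|q|<1$: $(a;q)_0:=1$, $(a;q)_n:=\prod_{k=0}^{n-1}(1-aq^k)$ for $n\ge 1$, and $(a;q)_\infty:=\lim_{n\to\infty}(a;q)_n$. For a positive integer $j$, $E_j:=(q^j;q^j)_\infty$. The function $\phi$ is $$\phi(q):=\sum_{n=0}^\infty \frac{(-q;q)_{2n}\,q^{n+1}}{(q;q^2)_{n+1}^2},$$ and $a(n)$ is the coefficient of $q^n$ in its power series expansion. *)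

theory Defs
  imports Complex_Main
begin

definition qpoch :: "complex \<Rightarrow> complex \<Rightarrow> nat \<Rightarrow> complex" where
  "qpoch a q n = (\<Prod>k<n. 1 - a * q ^ k)"

text \<open>Only meaningful for \<open>norm q < 1\<close>, where the limit exists for every \<open>a\<close>;
  the same restriction applies to the two functions below.\<close>

definition qpoch_inf :: "complex \<Rightarrow> complex \<Rightarrow> complex" where
  "qpoch_inf a q = lim (\<lambda>n. qpoch a q n)"

definition euler_E :: "nat \<Rightarrow> complex \<Rightarrow> complex" where
  "euler_E j q = qpoch_inf (q ^ j) (q ^ j)"

definition mock_phi :: "complex \<Rightarrow> complex" where
  "mock_phi q = (\<Sum>n. qpoch (- q) q (2 * n) * q ^ (n + 1) / (qpoch q (q ^ 2) (n + 1)) ^ 2)"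

end

theory Submission
  imports Defs "HOL-Analysis.Analysis" "HOL-Library.Nat_Bijection"
begin

text \<open>
  Put \<open>\<psi>(q) = E_2^2 / E_1\<close> and \<open>\<theta>(q) = E_1^2 / E_2\<close>, both of which are theta series. Bailey's lemma
  gives \<open>\<theta>(q) \<phi>(q) = \<Sum>_r (-1)^r q^((r+1)^2) / (1 - q^(4r+2))\<close>. The change of variables
  \<open>(m, n) = (u + v + 1, u - v)\<close> in the double series for \<open>\<theta>(-q) \<theta>(q) (\<phi>(q) - \<phi>(-q))\<close> leads to inner sums that are
  partial fraction expansions of reciprocal theta functions, whence
  \<open>\<Sum> a(2n+1) q^n = \<psi>(q)^3 / \<theta>(q)^2\<close>.

  For \<open>t^5 = q\<close>, both \<open>\<psi>(t)\<close> and \<open>\<theta>(t)\<close> split into three components according to the exponents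
  modulo 5. Up to powers of \<open>t\<close>, the ratios of these components are rational functions of
  \<open>k = q j_1 j_2 / (j_3 j_4)\<close> and one fifth root, where \<open>j_i\<close> is the theta function vanishing at
  \<open>q^i\<close> in base \<open>q^10\<close>; this follows from two instances of the Weierstrass three-term relation.
  So the part of \<open>\<psi>(t)^3 / \<theta>(t)^2\<close> with exponents 4 modulo 5 is, up to an eta quotient, a rational
  function of \<open>k\<close>. It turns out to be a function of \<open>h = 1 / k - k\<close>, and \<open>h\<close>, \<open>h + 1\<close>, \<open>1 - 4 / h\<close> are
  eta quotients.
\<close>

text \<open>All identities are proved for complex arguments in the punctured unit disc, because
  negative powers occur throughout; the origin is added at the end by continuity. Folding the series
  for \<theta>(q) \<phi>(q) over both signs of the index makes its denominators 1 - q^(4m-2), which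
  are even in q. Then q -> -q only changes a sign, and the difference \<phi>(q) - \<phi>(-q) becomes
  accessible. A shift reduces the inner sums of the double series to a single one, whose value is a
  limit of the Bailey pair already at hand. Dissecting the quotient \<psi>(t)^3 / \<theta>(t)^2
  requires a denominator of weight zero. The product of the conjugates of 1 + f + g supplies it, and
  this norm is the cube of 1 - 4 / h. Since it enters squared, sixth powers of 1 - 4 / h appear, and
  with them the power 22 of E_1 in the last summand. The coefficients 46, 460, 1125, 1875, 15625
  come from rewriting one polynomial in h. Square roots of q serve the theta exponents and fifth
  roots the dissection, so the computation takes place at a tenth root of q.\<close>

section \<open>Finite and infinite q-products and their dissections\<close>

lemma qpoch_0 [simp]: "qpoch a q 0 = 1"
  by (simp add: qpoch_def)

lemma qpoch_Suc: "qpoch a q (Suc n) = qpoch a q n * (1 - a * q ^ n)"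
  by (simp add: qpoch_def)

lemma convergent_prod_qpoch:
  fixes a q :: complex
  assumes "norm q < 1"
  shows   "convergent_prod (\<lambda>k. 1 - a * q ^ k)"
proof -
  have "summable (\<lambda>k. norm ((1 - a * q ^ k) - 1))"
    using assms by (simp add: norm_mult norm_power summable_mult summable_geometric)
  thus ?thesis
    by (intro abs_convergent_prod_imp_convergent_prod summable_imp_abs_convergent_prod)
qed

lemma qpoch_inf_eq_prodinf:
  assumes "norm q < 1"
  shows   "qpoch_inf a q = prodinf (\<lambda>k. 1 - a * q ^ k)"
    and   "(\<lambda>n. qpoch a q n) \<longlonglongrightarrow> qpoch_inf a q"
proof -
  have "(\<lambda>n. \<Prod>k\<le>n. 1 - a * q ^ k) \<longlonglongrightarrow> prodinf (\<lambda>k. 1 - a * q ^ k)"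
    by (rule convergent_prod_LIMSEQ) (rule convergent_prod_qpoch[OF assms])
  hence "(\<lambda>n. qpoch a q (Suc n)) \<longlonglongrightarrow> prodinf (\<lambda>k. 1 - a * q ^ k)"
    by (simp add: qpoch_def lessThan_Suc_atMost)
  hence *: "(\<lambda>n. qpoch a q n) \<longlonglongrightarrow> prodinf (\<lambda>k. 1 - a * q ^ k)"
    by (rule LIMSEQ_imp_Suc)
  show eq: "qpoch_inf a q = prodinf (\<lambda>k. 1 - a * q ^ k)"
    unfolding qpoch_inf_def by (rule limI[OF *])
  show "(\<lambda>n. qpoch a q n) \<longlonglongrightarrow> qpoch_inf a q"
    using * eq by simp
qed

lemmas qpoch_LIMSEQ = qpoch_inf_eq_prodinf(2)

lemma qpoch_inf_nonzero:
  assumes "norm q < 1" "\<And>k. a * q ^ k \<noteq> 1"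
  shows   "qpoch_inf a q \<noteq> 0"
proof -
  have "prodinf (\<lambda>k. 1 - a * q ^ k) \<noteq> 0"
    by (rule prodinf_nonzero[OF convergent_prod_qpoch[OF assms(1)]])
       (use assms(2) in \<open>metis eq_iff_diff_eq_0\<close>)
  thus ?thesis by (simp add: qpoch_inf_eq_prodinf assms)
qed

lemma mult_power_neq_1:
  fixes a q :: complex
  assumes "norm a < 1" "norm q < 1"
  shows   "a * q ^ k \<noteq> 1"
proof
  assume "a * q ^ k = 1"
  hence "norm a * norm q ^ k = 1"
    by (metis norm_mult norm_one norm_power)
  moreover have "norm a * norm q ^ k \<le> norm a * 1"
    by (intro mult_left_mono power_le_one) (use assms in auto)
  ultimately show False using assms by simp
qed

lemma qpoch_inf_nonzero':
  assumes "norm a < 1" "norm q < 1"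
  shows   "qpoch_inf a q \<noteq> 0"
  using assms by (intro qpoch_inf_nonzero mult_power_neq_1)

lemma qpoch_nonzero:
  assumes "norm a < 1" "norm q < 1"
  shows   "qpoch a q n \<noteq> 0"
  using mult_power_neq_1[OF assms] by (auto simp: qpoch_def) 

text \<open>The factors are sorted by their exponent modulo m. The limit n -> \<infinity> gives the
  dissection of infinite products used for all changes of base.\<close>

lemma qpoch_mult: "qpoch a q (m * n) = (\<Prod>i<m. qpoch (a * q ^ i) (q ^ m) n)"
proof (induction n)
  case (Suc n)
  have "qpoch a q (m * Suc n) = qpoch a q (m * n) * (\<Prod>i<m. 1 - a * q ^ (m * n + i))"
  proof -
    have "{..<m * Suc n} = {..<m * n} \<union> (\<lambda>i. m * n + i) ` {..<m}"
      using image_add_atLeastLessThan[of "m * n" 0 m] by (auto simp: lessThan_atLeast0)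
    moreover have "{..<m * n} \<inter> (\<lambda>i. m * n + i) ` {..<m} = {}" by auto
    ultimately show ?thesis
      unfolding qpoch_def by (simp add: prod.union_disjoint prod.reindex)
  qed
  thus ?case using Suc
    by (simp add: qpoch_Suc prod.distrib power_add power_mult mult_ac)
qed auto

lemma norm_power_less_1:
  fixes q :: complex
  assumes "norm q < 1" "m > 0"
  shows   "norm (q ^ m) < 1"
  using assms by (simp add: norm_power power_less_one_iff)

lemma one_minus_power_nonzero: "norm (q :: complex) < 1 \<Longrightarrow> m > 0 \<Longrightarrow> 1 - q ^ m \<noteq> 0"
  using norm_power_less_1[of q m] by auto

lemma one_plus_power_nonzero: "norm (q :: complex) < 1 \<Longrightarrow> m > 0 \<Longrightarrow> 1 + q ^ m \<noteq> 0"
  using norm_power_less_1[of q m]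
  by (metis add.inverse_inverse add_eq_0_iff norm_minus_cancel norm_one less_irrefl)

lemma square_in_disc:
  assumes "norm (q :: complex) < 1" "q \<noteq> 0"
  shows "norm (q ^ 2) < 1" "q ^ 2 \<noteq> 0"
  using assms by (auto intro!: norm_power_less_1)

lemma qpoch_inf_split:
  assumes q: "norm q < 1" and m: "m > 0"
  shows   "qpoch_inf a q = (\<Prod>i<m. qpoch_inf (a * q ^ i) (q ^ m))"
proof -
  have "(\<lambda>n. \<Prod>i<m. qpoch (a * q ^ i) (q ^ m) n) \<longlonglongrightarrow> (\<Prod>i<m. qpoch_inf (a * q ^ i) (q ^ m))"
    by (intro tendsto_prod qpoch_LIMSEQ norm_power_less_1 assms)
  moreover have "filterlim (\<lambda>n. m * n) at_top sequentially"
    using m by (intro mult_nat_left_at_top)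
  hence "(\<lambda>n. qpoch a q (m * n)) \<longlonglongrightarrow> qpoch_inf a q"
    by (rule filterlim_compose[OF qpoch_LIMSEQ[OF q]])
  ultimately show ?thesis
    unfolding qpoch_mult by (metis LIMSEQ_unique)
qed

text \<open>Factor by factor, (1 - a q^k) (1 + a q^k) = 1 - a^2 q^(2k). This trades products with
  plus signs for quotients of products with minus signs.\<close>

lemma qpoch_inf_minus:
  assumes q: "norm q < 1"
  shows   "qpoch_inf a q * qpoch_inf (- a) q = qpoch_inf (a ^ 2) (q ^ 2)"
proof -
  have "(\<lambda>n. qpoch a q n * qpoch (- a) q n) \<longlonglongrightarrow> qpoch_inf a q * qpoch_inf (- a) q"
    by (intro tendsto_mult qpoch_LIMSEQ q)
  moreover have "qpoch a q n * qpoch (- a) q n = qpoch (a ^ 2) (q ^ 2) n" for n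
    unfolding qpoch_def prod.distrib[symmetric]
    by (intro prod.cong) (auto simp: algebra_simps power2_eq_square power_mult_distrib)
  ultimately have "(\<lambda>n. qpoch (a ^ 2) (q ^ 2) n) \<longlonglongrightarrow> qpoch_inf a q * qpoch_inf (- a) q"
    by simp
  moreover have "norm (q ^ 2) < 1" using q by (intro norm_power_less_1) auto
  ultimately show ?thesis
    using qpoch_LIMSEQ LIMSEQ_unique by blast
qed

lemma qpoch_inf_split2:
  assumes q: "norm q < 1"
  shows   "qpoch_inf a q = qpoch_inf a (q ^ 2) * qpoch_inf (a * q) (q ^ 2)"
  using qpoch_inf_split[OF q, of 2 a] by (simp add: numeral_2_eq_2)

lemma qpoch_inf_split5:
  assumes q: "norm q < 1"
  shows   "qpoch_inf a q = qpoch_inf a (q ^ 5) * qpoch_inf (a * q) (q ^ 5) * qpoch_inf (a * q ^ 2) (q ^ 5)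
             * qpoch_inf (a * q ^ 3) (q ^ 5) * qpoch_inf (a * q ^ 4) (q ^ 5)"
  using qpoch_inf_split[OF q, of 5 a]
  by (simp add: eval_nat_numeral)

text \<open>
  Extending by zero to negative indices makes the recurrence below hold for all integers, so that
  no boundary terms have to be treated separately.
\<close>

definition inv_qpoch :: "complex \<Rightarrow> int \<Rightarrow> complex" where
  "inv_qpoch q n = (if n < 0 then 0 else inverse (qpoch q q (nat n)))"

lemma inv_qpoch_neg [simp]: "n < 0 \<Longrightarrow> inv_qpoch q n = 0"
  by (simp add: inv_qpoch_def)

lemma inv_qpoch_0 [simp]: "inv_qpoch q 0 = 1"
  by (simp add: inv_qpoch_def)

lemma inv_qpoch_rec:
  assumes "norm q < 1"
  shows   "inv_qpoch q (n - 1) = (1 - q powi n) * inv_qpoch q n"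
proof -
  \<comment> \<open>At n = 0 the left side is zero by convention and the right side because 1 - q^0
    = 0; the extension by zero is consistent exactly for this reason.\<close>
  consider "n < 0" | "n = 0" | m where "n = int (Suc m)"
    by (metis int_cases neg_int_cases not_less zless_iff_Suc_zadd add_0 of_nat_0 linorder_neqE_linordered_idom)
  thus ?thesis
  proof cases
    case (3 m)
    have nz: "qpoch q q (Suc m) \<noteq> 0" "qpoch q q m \<noteq> 0"
      by (rule qpoch_nonzero[OF assms assms])+
    have eq: "qpoch q q (Suc m) = qpoch q q m * (1 - q powi n)"
      using 3 by (simp add: qpoch_Suc power_int_def nat_add_distrib)
    moreover have "inv_qpoch q (n - 1) = inverse (qpoch q q m)" "inv_qpoch q n = inverse (qpoch q q (Suc m))"
      using 3 by (auto simp: inv_qpoch_def nat_add_distrib)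
    moreover have "1 - q powi n \<noteq> 0" using nz eq by auto
    ultimately show ?thesis unfolding eq using nz by (simp only:) (simp add: divide_simps)
  qed auto
qed

lemma inv_qpoch_LIMSEQ:
  assumes "norm q < 1"
  shows   "(\<lambda>n. inv_qpoch q (int n + k)) \<longlonglongrightarrow> inverse (qpoch_inf q q)"
proof -
  have *: "(\<lambda>n. inverse (qpoch q q n)) \<longlonglongrightarrow> inverse (qpoch_inf q q)"
    by (intro tendsto_inverse qpoch_LIMSEQ qpoch_inf_nonzero' assms)
  have "filterlim (\<lambda>n. nat (int n + k)) at_top sequentially"
  proof (subst filterlim_at_top, intro allI)
    fix Z
    show "\<forall>\<^sub>F n in sequentially. Z \<le> nat (int n + k)"
      using eventually_ge_at_top[of "Z + nat \<bar>k\<bar>"] by eventually_elim linarith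
  qed
  from filterlim_compose[OF * this]
  have "(\<lambda>n. inverse (qpoch q q (nat (int n + k)))) \<longlonglongrightarrow> inverse (qpoch_inf q q)" .
  moreover have "\<forall>\<^sub>F n in sequentially. inverse (qpoch q q (nat (int n + k))) = inv_qpoch q (int n + k)"
    using eventually_ge_at_top[of "nat \<bar>k\<bar>"] by eventually_elim (auto simp: inv_qpoch_def)
  ultimately show ?thesis by (rule Lim_transform_eventually)
qed

text \<open>The sequence converges, and negative indices contribute only zeros. A bound that is
  uniform over all integers provides the majorants for the later interchanges of limit and
  sum.\<close>

lemma inv_qpoch_bounded:
  assumes "norm q < 1"
  obtains M where "M > 0" "\<And>n. norm (inv_qpoch q n) \<le> M"
proof -
  have "Bseq (\<lambda>n. inv_qpoch q (int n + 0))"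
    by (intro convergent_imp_Bseq convergentI[OF inv_qpoch_LIMSEQ] assms)
  then obtain M where M: "M > 0" "\<And>n. norm (inv_qpoch q (int n)) \<le> M"
    by (auto simp: Bseq_def)
  have "norm (inv_qpoch q n) \<le> M" for n
    using M(1) M(2)[of "nat n"] by (cases "n < 0") auto
  with M(1) show ?thesis by (intro that)
qed

lemma qpoch_bounded:
  assumes "norm q < 1"
  obtains M where "M > 0" "\<And>n. norm (qpoch a q n) \<le> M"
proof -
  have "Bseq (\<lambda>n. qpoch a q n)"
    by (intro convergent_imp_Bseq convergentI[OF qpoch_LIMSEQ] assms)
  thus ?thesis using that by (auto simp: Bseq_def)
qed

section \<open>Dominated convergence and the folding of bilateral series\<close>

lemma tannery_nat:
  fixes f :: "nat \<Rightarrow> nat \<Rightarrow> complex"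
  assumes lim: "\<And>x. (\<lambda>n. f n x) \<longlonglongrightarrow> g x"
    and bd: "\<And>n x. norm (f n x) \<le> M x" and M: "summable M"
  shows "(\<lambda>n. \<Sum>x. f n x) \<longlonglongrightarrow> (\<Sum>x. g x)"
proof -
  have "eventually (\<lambda>(k,n). norm (f n k) \<le> M k) (at_top \<times>\<^sub>F sequentially)"
    using bd by (intro always_eventually) auto
  from tannerys_theorem[of "\<lambda>k n. f n k" g sequentially M, OF lim this M]
  show ?thesis by simp
qed

lemma summable_on_nat_iff:
  fixes f :: "nat \<Rightarrow> complex"
  shows "f summable_on UNIV \<longleftrightarrow> summable (\<lambda>n. norm (f n))"
  unfolding summable_on_iff_abs_summable_on_complex
  by (rule summable_on_UNIV_nonneg_real_iff) auto

lemma infsum_nat_eq_suminf: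
  fixes f :: "nat \<Rightarrow> complex"
  assumes "f summable_on UNIV"
  shows   "(\<Sum>\<^sub>\<infinity>n. f n) = (\<Sum>n. f n)"
  using has_sum_imp_sums[OF has_sum_infsum[OF assms]] by (simp add: sums_iff)

lemma infsum_int_decode:
  fixes f :: "int \<Rightarrow> complex"
  shows "(\<Sum>\<^sub>\<infinity>n. f (int_decode n)) = (\<Sum>\<^sub>\<infinity>n. f n)"
  by (rule infsum_reindex_bij_betw[OF bij_int_decode])

text \<open>Enumerating the integers by \<open>int_decode\<close> reduces this to series over the
  natural numbers. The limit \<open>g\<close> inherits the bound \<open>M\<close>, so its bilateral
  sum is also that of the enumerated series.\<close>

lemma tannery_int:
  fixes f :: "nat \<Rightarrow> int \<Rightarrow> complex"
  assumes lim: "\<And>x. (\<lambda>n. f n x) \<longlonglongrightarrow> g x"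
    and bd: "\<And>n x. norm (f n x) \<le> M x" and M: "M summable_on UNIV"
  shows "(\<lambda>n. \<Sum>\<^sub>\<infinity>x. f n x) \<longlonglongrightarrow> (\<Sum>\<^sub>\<infinity>x. g x)"
proof -
  have "(\<lambda>n. M (int_decode n)) summable_on UNIV"
    using M by (subst summable_on_reindex_bij_betw[OF bij_int_decode])
  hence M': "summable (\<lambda>n. M (int_decode n))"
    by (rule summable_on_imp_summable)
  have bd': "norm (g x) \<le> M x" for x
    by (rule Lim_bounded[OF tendsto_norm[OF lim]]) (use bd in auto)
  have s: "(\<Sum>x. h (int_decode x)) = (\<Sum>\<^sub>\<infinity>x. h x)" if "\<And>x. norm (h x) \<le> M x" for h :: "int \<Rightarrow> complex"
  proof -
    have "summable (\<lambda>n. norm (h (int_decode n)))"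
      by (rule summable_comparison_test'[OF M', of 0]) (use that in auto)
    thus ?thesis
      by (subst infsum_int_decode[symmetric], subst infsum_nat_eq_suminf)
         (auto simp: summable_on_nat_iff)
  qed
  have "(\<lambda>n. \<Sum>x. f n (int_decode x)) \<longlonglongrightarrow> (\<Sum>x. g (int_decode x))"
    by (rule tannery_nat[OF lim bd M'])
  moreover have "(\<lambda>n. \<Sum>x. f n (int_decode x)) = (\<lambda>n. \<Sum>\<^sub>\<infinity>x. f n x)"
    by (intro ext s bd)
  ultimately show ?thesis using s[OF bd'] by simp
qed

text \<open>
  The base \<open>r\<close> plays the role of a square root of \<open>q\<close>, which avoids half-integral exponents: for
  \<open>q = r^2\<close>, the series \<open>\<Sum> q^(n(n+1)/2)\<close> is \<open>theta 1 1 1 r\<close>.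
\<close>

definition theta :: "complex \<Rightarrow> int \<Rightarrow> int \<Rightarrow> complex \<Rightarrow> complex" where
  "theta s a b r = (\<Sum>\<^sub>\<infinity>n::int. s powi n * r powi (a * n ^ 2 + b * n))"

lemma power_powi: "(x ^ m) powi n = (x :: complex) powi (int m * n)"
  by (simp add: power_int_mult power_int_of_nat)

text \<open>The involution n -> -1 - n preserves n (n + 1). Pairing along it merges two terms of a
  bilateral Appell series into a single rational expression.\<close>

lemma sum_decode_summable:
  fixes f :: "int \<Rightarrow> complex"
  assumes "summable (\<lambda>n. norm (f (int n)))" "summable (\<lambda>n. norm (f (- 1 - int n)))"
  shows   "f summable_on UNIV"
    and   "(\<Sum>\<^sub>\<infinity>n. f n) = (\<Sum>\<^sub>\<infinity>n::nat. f (int n) + f (- 1 - int n))"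
proof -
  have U: "(UNIV :: int set) = range int \<union> range (\<lambda>n. - 1 - int n)"
  proof -
    have "x \<in> range int \<union> range (\<lambda>n. - 1 - int n)" for x :: int
      by (cases "x \<ge> 0") (auto simp: image_iff intro: exI[of _ "nat x"] exI[of _ "nat (- 1 - x)"])
    thus ?thesis by blast
  qed
  have D: "range int \<inter> range (\<lambda>n. - 1 - int n) = {}" by auto
  have i: "inj int" "inj (\<lambda>n. - 1 - int n)" by (auto simp: inj_def)
  have s1: "(\<lambda>n. f (int n)) summable_on UNIV" "(\<lambda>n. f (- 1 - int n)) summable_on UNIV"
    using assms by (auto simp: summable_on_nat_iff)
  have s: "f summable_on range int" "f summable_on range (\<lambda>n. - 1 - int n)"
    using s1 summable_on_reindex[OF i(1), of f] summable_on_reindex[OF i(2), of f]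
    by (auto simp: o_def)
  show "f summable_on UNIV"
    unfolding U by (intro summable_on_Un_disjoint s D)
  have "(\<Sum>\<^sub>\<infinity>n. f n) = infsum f (range int) + infsum f (range (\<lambda>n. - 1 - int n))"
    unfolding U by (intro infsum_Un_disjoint s D)
  also have "\<dots> = (\<Sum>\<^sub>\<infinity>n. f (int n)) + (\<Sum>\<^sub>\<infinity>n. f (- 1 - int n))"
    by (simp add: infsum_reindex[OF i(1)] infsum_reindex[OF i(2)] o_def)
  also have "\<dots> = (\<Sum>\<^sub>\<infinity>n::nat. f (int n) + f (- 1 - int n))"
    by (rule infsum_add[symmetric]) (use s1 in auto)
  finally show "(\<Sum>\<^sub>\<infinity>n. f n) = (\<Sum>\<^sub>\<infinity>n::nat. f (int n) + f (- 1 - int n))" .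
qed

text \<open>The term is (x^n y)^n, and its base tends to zero, so that it is eventually dominated by
  a geometric series.\<close>

lemma gauss_summable_nat:
  fixes x y :: real
  assumes "0 \<le> x" "x < 1" "y \<ge> 0"
  shows   "summable (\<lambda>n. x ^ (n ^ 2) * y ^ n)"
proof -
  have "(\<lambda>n. x ^ n * y) \<longlonglongrightarrow> 0 * y"
    using assms by (intro tendsto_mult tendsto_const LIMSEQ_realpow_zero) auto
  hence "eventually (\<lambda>n. x ^ n * y < 1/2) sequentially"
    by (rule order_tendstoD) auto
  hence "eventually (\<lambda>n. norm (x ^ (n ^ 2) * y ^ n) \<le> (1/2) ^ n) sequentially"
  proof eventually_elim
    case (elim n)
    have "x ^ (n ^ 2) * y ^ n = (x ^ n * y) ^ n"
      by (simp add: power_mult_distrib power_mult[symmetric] power2_eq_square)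
    moreover have "(x ^ n * y) ^ n \<le> (1/2) ^ n"
      using elim assms by (intro power_mono) auto
    ultimately show ?case using assms by simp
  qed
  thus ?thesis
    by (rule summable_comparison_test_ev) (simp add: summable_geometric)
qed

lemma gauss_summable_int:
  fixes r y :: complex
  assumes "norm r < 1" "r \<noteq> 0" "y \<noteq> 0"
  shows   "(\<lambda>n::int. r powi (n ^ 2) * y powi n) summable_on UNIV"
proof (rule sum_decode_summable)
  have "norm (r powi (int n ^ 2) * y powi int n) = norm r ^ (n ^ 2) * norm y ^ n" for n
    by (simp add: norm_mult norm_power_int norm_power) (metis of_nat_power power_int_of_nat norm_power)
  thus "summable (\<lambda>n. norm (r powi (int n ^ 2) * y powi int n))"
    using gauss_summable_nat[of "norm r" "norm y"] assms by simp
  have *: "norm (r powi ((- 1 - int n) ^ 2) * y powi (- 1 - int n)) =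
          norm r / norm y * (norm r ^ (n ^ 2) * (norm r ^ 2 / norm y) ^ n)" for n
  proof -
    have e: "(- 1 - int n) ^ 2 = int (n ^ 2 + 2 * n + 1)" by (simp add: power2_eq_square algebra_simps)
    have "norm (r powi ((- 1 - int n) ^ 2)) = norm r ^ (n ^ 2) * (norm r ^ 2) ^ n * norm r"
      unfolding e power_int_of_nat by (simp add: norm_mult norm_power power_add power_mult)
    moreover have "y powi (- 1 - int n) = inverse (y * y ^ n)"
      using power_int_minus[of y "int (Suc n)"] by (simp add: power_int_of_nat del: of_nat_Suc) (simp add: algebra_simps)
    ultimately have "norm (r powi ((- 1 - int n) ^ 2) * y powi (- 1 - int n)) =
        norm r ^ (n ^ 2) * (norm r ^ 2) ^ n * norm r * inverse (norm y * norm y ^ n)"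
      by (simp only: norm_mult norm_inverse norm_power)
    thus ?thesis using assms
      by (simp add: field_simps)
  qed
  show "summable (\<lambda>n. norm (r powi ((- 1 - int n) ^ 2) * y powi (- 1 - int n)))"
    unfolding * using gauss_summable_nat[of "norm r" "norm r ^ 2 / norm y"] assms
    by (intro summable_mult) simp
qed

lemma abs_gauss_summable_int:
  fixes r y :: complex
  assumes "norm r < 1" "r \<noteq> 0" "y \<noteq> 0"
  shows   "(\<lambda>n::int. norm (r powi (n ^ 2) * y powi n)) summable_on UNIV"
  using gauss_summable_int[OF assms] by (simp add: summable_on_iff_abs_summable_on_complex)

lemma theta_summable:
  fixes r s :: complex
  assumes "norm r < 1" "r \<noteq> 0" "a > 0" "s \<noteq> 0"
  shows   "(\<lambda>n::int. s powi n * r powi (a * n ^ 2 + b * n)) summable_on UNIV"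
proof -
  have "norm (r powi a) < 1"
    using norm_power_less_1[of r "nat a"] assms by (simp add: power_int_def)
  hence "(\<lambda>n::int. (r powi a) powi (n ^ 2) * (s * r powi b) powi n) summable_on UNIV"
    using assms by (intro gauss_summable_int) auto
  also have "(\<lambda>n::int. (r powi a) powi (n ^ 2) * (s * r powi b) powi n) =
             (\<lambda>n::int. s powi n * r powi (a * n ^ 2 + b * n))"
    using assms by (simp add: fun_eq_iff power_int_add power_int_mult[symmetric] power_int_mult_distrib mult_ac)
  finally show ?thesis .
qed

section \<open>The Jacobi triple product\<close>

lemma infsum_lincomb3:
  fixes f g h :: "'a \<Rightarrow> complex"
  assumes "f summable_on A" "g summable_on A" "h summable_on A"
  shows "x * infsum f A + y * infsum g A + z * infsum h A = (\<Sum>\<^sub>\<infinity>i\<in>A. x * f i + y * g i + z * h i)"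
proof -
  have "(\<Sum>\<^sub>\<infinity>i\<in>A. x * f i + y * g i + z * h i) =
      (\<Sum>\<^sub>\<infinity>i\<in>A. x * f i) + (\<Sum>\<^sub>\<infinity>i\<in>A. y * g i) + (\<Sum>\<^sub>\<infinity>i\<in>A. z * h i)"
    using assms by (intro trans[OF infsum_add] arg_cong2[where f = "(+)"] infsum_add refl)
      (auto intro!: summable_on_add summable_on_cmult_right)
  thus ?thesis by (simp only: infsum_cmult_right')
qed

text \<open>Cauchy's finite form of the triple product: the bracket is the q-binomial coefficient of
  2N over N + j in base r^2, which vanishes for |j| > N. The induction on N compares the
  coefficients of each power of y after multiplication by the two new factors.\<close>

lemma finite_triple_product:
  fixes r y :: complex
  assumes r: "norm r < 1" "r \<noteq> 0" and y: "y \<noteq> 0"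
  shows "qpoch (r * y) (r ^ 2) N * qpoch (r / y) (r ^ 2) N =
    (\<Sum>\<^sub>\<infinity>j::int. (-1) powi j * r powi (j ^ 2) * y powi j *
       (qpoch (r ^ 2) (r ^ 2) (2 * N) * inv_qpoch (r ^ 2) (int N - j) * inv_qpoch (r ^ 2) (int N + j)))"
proof -
  define q where "q = r ^ 2"
  have q: "norm q < 1" "q \<noteq> 0" using r by (auto simp: q_def norm_power power_less_one_iff)
  define b where "b = (\<lambda>N j. qpoch q q (2 * N) * inv_qpoch q (int N - j) * inv_qpoch q (int N + j))"
  define c where "c = (\<lambda>j::int. (-1) powi j * r powi (j ^ 2) * y powi j)"
  have fin: "(\<lambda>j. c (j + d) * b N (j + e)) summable_on UNIV" for d e N
  proof (rule finite_nonzero_values_imp_summable_on)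
    have "{x. c (x + d) * b N (x + e) \<noteq> 0} \<subseteq> {- int N - e..int N - e}"
      by (auto simp: b_def inv_qpoch_def split: if_splits)
    thus "finite {x \<in> UNIV. c (x + d) * b N (x + e) \<noteq> 0}"
      using finite_subset[OF _ finite_atLeastAtMost_int] by simp
  qed
  have powq: "r powi (2 * n) = q powi n" for n
    by (simp add: q_def power_powi)
  \<comment> \<open>Two steps of the q-Pascal rule at once. All four binomials are multiples of
    \<open>X\<close> and of the product of length 2N, with polynomials in q, q^n, q^m as cofactors,
    so a polynomial identity remains.\<close>
  have recb: "b (Suc N) j = (1 + q * q ^ (2 * N)) * b N j + q powi (int N + 1 - j) * b N (j - 1) + q powi (int N + 1 + j) * b N (j + 1)" for N j
  proof -
    define m where "m = int N + j" 
    define n where "n = int N - j"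
    define X where "X = inv_qpoch q (n + 1) * inv_qpoch q (m + 1)"
    have 1: "inv_qpoch q n = (1 - q powi (n + 1)) * inv_qpoch q (n + 1)" "inv_qpoch q m = (1 - q powi (m + 1)) * inv_qpoch q (m + 1)"
            "inv_qpoch q (n - 1) = (1 - q powi n) * inv_qpoch q n" "inv_qpoch q (m - 1) = (1 - q powi m) * inv_qpoch q m"
      using inv_qpoch_rec[OF q(1), of "n + 1"] inv_qpoch_rec[OF q(1), of "m + 1"] inv_qpoch_rec[OF q(1), of "n"] inv_qpoch_rec[OF q(1), of "m"]
      by simp_all
    have e: "q ^ (2 * N) = q powi n * q powi m"
    proof -
      have "q powi n * q powi m = q powi (n + m)" using q by (simp add: power_int_add)
      also have "n + m = int (2 * N)" by (simp add: n_def m_def)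
      finally show ?thesis by (simp only: power_int_of_nat)
    qed
    have Q2: "qpoch q q (2 * Suc N) = qpoch q q (2 * N) * (1 - q * (q powi n * q powi m)) * (1 - q * q * (q powi n * q powi m))"
      using e by (simp add: qpoch_Suc mult_ac)
    have p1: "q powi (n + 1) = q * q powi n" "q powi (m + 1) = q * q powi m"
      using q by (simp_all add: power_int_add)
    have L: "b (Suc N) j = qpoch q q (2 * Suc N) * X"
      by (simp add: b_def X_def n_def m_def algebra_simps)
    have R1: "b N j = qpoch q q (2 * N) * (1 - q * q powi n) * (1 - q * q powi m) * X"
    proof -
      have "b N j = qpoch q q (2 * N) * inv_qpoch q n * inv_qpoch q m"
        by (simp only: b_def n_def m_def)
      thus ?thesis using 1 p1 by (simp add: X_def)
    qed
    have R2: "b N (j - 1) = qpoch q q (2 * N) * (1 - q powi m) * (1 - q * q powi m) * X"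
    proof -
      have "b N (j - 1) = qpoch q q (2 * N) * inv_qpoch q (n + 1) * inv_qpoch q (m - 1)"
        by (simp add: b_def n_def m_def algebra_simps)
      thus ?thesis using 1 p1 by (simp add: X_def)
    qed
    have R3: "b N (j + 1) = qpoch q q (2 * N) * (1 - q powi n) * (1 - q * q powi n) * X"
    proof -
      have "b N (j + 1) = qpoch q q (2 * N) * inv_qpoch q (n - 1) * inv_qpoch q (m + 1)"
        by (simp add: b_def n_def m_def algebra_simps)
      thus ?thesis using 1 p1 by (simp add: X_def)
    qed
    have p2: "q powi (int N + 1 - j) = q * q powi n" "q powi (int N + 1 + j) = q * q powi m"
      using p1 by (simp_all add: n_def m_def algebra_simps)
    show ?thesis unfolding L R1 R2 R3 p2 Q2 e by algebra
  qed
  have "qpoch (r * y) q N * qpoch (r / y) q N = (\<Sum>\<^sub>\<infinity>j. c j * b N j)"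
  proof (induction N)
    case 0
    have "(\<Sum>\<^sub>\<infinity>j. c j * b 0 j) = (\<Sum>\<^sub>\<infinity>j\<in>{0}. c j * b 0 j)"
      by (intro infsum_cong_neutral) (auto simp: b_def inv_qpoch_def)
    thus ?case by (simp add: c_def b_def)
  next
    case (Suc N)
    define z where "z = r * q ^ N"
    have "qpoch (r * y) q (Suc N) * qpoch (r / y) q (Suc N) = (1 - z * y) * (1 - z / y) * (\<Sum>\<^sub>\<infinity>j. c j * b N j)"
      unfolding Suc.IH[symmetric] by (simp add: qpoch_Suc z_def)
    also have "(1 - z * y) * (1 - z / y) = (1 + z ^ 2) + (- z * y) + (- z / y)"
      using y by (simp add: field_simps power2_eq_square)
    also have "\<dots> * (\<Sum>\<^sub>\<infinity>j. c j * b N j) = (1 + z ^ 2) * (\<Sum>\<^sub>\<infinity>j. c j * b N j)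
        + (- z * y) * (\<Sum>\<^sub>\<infinity>j. c (j - 1) * b N (j - 1)) + (- z / y) * (\<Sum>\<^sub>\<infinity>j. c (j + 1) * b N (j + 1))"
    proof -
      have "(\<Sum>\<^sub>\<infinity>j. c (j - 1) * b N (j - 1)) = (\<Sum>\<^sub>\<infinity>j. c j * b N j)"
        by (rule infsum_reindex_bij_witness[of _ "\<lambda>j. j + 1" "\<lambda>j. j - 1"]) auto
      moreover have "(\<Sum>\<^sub>\<infinity>j. c (j + 1) * b N (j + 1)) = (\<Sum>\<^sub>\<infinity>j. c j * b N j)"
        by (rule infsum_reindex_bij_witness[of _ "\<lambda>j. j - 1" "\<lambda>j. j + 1"]) auto
      ultimately show ?thesis by (simp only: distrib_right)
    qed
    also have "\<dots> = (\<Sum>\<^sub>\<infinity>j. (1 + z ^ 2) * (c j * b N j) + (- z * y) * (c (j - 1) * b N (j - 1)) + (- z / y) * (c (j + 1) * b N (j + 1)))"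
      by (rule infsum_lincomb3) (use fin[of 0 N 0] fin[of "-1" N "-1"] fin[of 1 N 1] in simp_all)
    also have "\<dots> = (\<Sum>\<^sub>\<infinity>j. c j * b (Suc N) j)"
    proof (rule infsum_cong)
      fix j :: int
      have z2: "z ^ 2 = q * q ^ (2 * N)" by (simp add: z_def power_mult_distrib q_def power_mult[symmetric] mult_ac)
      have zp: "z = r powi (2 * int N + 1)"
        using r by (simp add: z_def power_int_add powq power_int_of_nat)
      have m: "(- z * y) * c (j - 1) = q powi (int N + 1 - j) * c j"
      proof -
        have e1: "r powi (2 * int N + 1) * r powi ((j - 1) ^ 2) = r powi (2 * (int N + 1 - j)) * r powi (j ^ 2)"
          using r by (simp add: power_int_add[symmetric]) (simp add: power2_eq_square algebra_simps)
        have e2: "y * y powi (j - 1) = y powi j" using y by (simp add: power_int_diff)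
        have e3: "- ((-1) powi (j - 1)) = ((-1) powi j :: complex)" by (simp add: power_int_diff)
        have "(- z * y) * c (j - 1) = (- ((-1) powi (j - 1))) * (r powi (2 * int N + 1) * r powi ((j - 1) ^ 2)) * (y * y powi (j - 1))"
          by (simp add: c_def zp mult_ac)
        thus ?thesis unfolding e1 e2 e3 powq by (simp only: c_def mult_ac)
      qed
      have p: "(- z / y) * c (j + 1) = q powi (int N + 1 + j) * c j"
      proof -
        have e1: "r powi (2 * int N + 1) * r powi ((j + 1) ^ 2) = r powi (2 * (int N + 1 + j)) * r powi (j ^ 2)"
          using r by (simp add: power_int_add[symmetric]) (simp add: power2_eq_square algebra_simps)
        have e2: "y powi (j + 1) / y = y powi j" using y by (simp add: power_int_add)
        have e3: "- ((-1) powi (j + 1)) = ((-1) powi j :: complex)" by (simp add: power_int_add)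
        have "(- z / y) * c (j + 1) = (- ((-1) powi (j + 1))) * (r powi (2 * int N + 1) * r powi ((j + 1) ^ 2)) * (y powi (j + 1) / y)"
          by (simp add: c_def zp mult_ac)
        thus ?thesis unfolding e1 e2 e3 powq by (simp only: c_def mult_ac)
      qed
      have "(1 + z ^ 2) * (c j * b N j) + (- z * y) * (c (j - 1) * b N (j - 1)) + (- z / y) * (c (j + 1) * b N (j + 1))
         = (1 + z ^ 2) * c j * b N j + ((- z * y) * c (j - 1)) * b N (j - 1) + ((- z / y) * c (j + 1)) * b N (j + 1)"
        by (simp only: mult.assoc)
      also have "\<dots> = c j * b (Suc N) j" unfolding m p recb z2 by (simp add: algebra_simps)
      finally show "(1 + z ^ 2) * (c j * b N j) + (- z * y) * (c (j - 1) * b N (j - 1)) + (- z / y) * (c (j + 1) * b N (j + 1)) = c j * b (Suc N) j" .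
    qed
    finally show ?case .
  qed
  thus ?thesis by (simp add: q_def c_def b_def)
qed

text \<open>For N -> \<infinity> the q-binomial coefficients tend to 1 / (r^2; r^2)_\<infinity>.
  They are bounded uniformly in N and j, so the Gaussian factor \<open>c\<close> dominates the
  sum.\<close>

theorem triple_product:
  fixes r y :: complex
  assumes r: "norm r < 1" "r \<noteq> 0" and y: "y \<noteq> 0"
  shows "(\<Sum>\<^sub>\<infinity>j::int. (-1) powi j * r powi (j ^ 2) * y powi j) =
    qpoch_inf (r * y) (r ^ 2) * qpoch_inf (r / y) (r ^ 2) * qpoch_inf (r ^ 2) (r ^ 2)"
proof -
  define q where "q = r ^ 2"
  have q: "norm q < 1" using r by (auto simp: q_def norm_power power_less_one_iff)
  define P where "P = qpoch_inf q q"
  have P: "P \<noteq> 0" unfolding P_def by (intro qpoch_inf_nonzero' q)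
  obtain M1 where M1: "M1 > 0" "\<And>n. norm (inv_qpoch q n) \<le> M1" using inv_qpoch_bounded[OF q] by auto
  obtain M2 where M2: "M2 > 0" "\<And>n. norm (qpoch q q n) \<le> M2" using qpoch_bounded[OF q] by auto
  define c where "c = (\<lambda>j::int. (-1) powi j * r powi (j ^ 2) * y powi j)"
  have c: "(\<lambda>j. norm (c j)) summable_on UNIV"
    using abs_gauss_summable_int[OF r y] by (simp add: c_def norm_mult norm_power_int)
  have "(\<lambda>N. \<Sum>\<^sub>\<infinity>j. c j * (qpoch q q (2 * N) * inv_qpoch q (int N - j) * inv_qpoch q (int N + j))) \<longlonglongrightarrow>
        (\<Sum>\<^sub>\<infinity>j. c j * (P * inverse P * inverse P))"
  proof (rule tannery_int)
    fix j
    have "(\<lambda>N. qpoch q q (2 * N)) \<longlonglongrightarrow> P" unfolding P_def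
      by (rule filterlim_compose[OF qpoch_LIMSEQ[OF q]]) (rule mult_nat_left_at_top, simp)
    moreover have "(\<lambda>N. inv_qpoch q (int N - j)) \<longlonglongrightarrow> inverse P" "(\<lambda>N. inv_qpoch q (int N + j)) \<longlonglongrightarrow> inverse P"
      using inv_qpoch_LIMSEQ[OF q, of "-j"] inv_qpoch_LIMSEQ[OF q, of j] by (simp_all add: P_def)
    ultimately show "(\<lambda>N. c j * (qpoch q q (2 * N) * inv_qpoch q (int N - j) * inv_qpoch q (int N + j))) \<longlonglongrightarrow> c j * (P * inverse P * inverse P)"
      by (intro tendsto_intros)
  next
    fix N j
    show "norm (c j * (qpoch q q (2 * N) * inv_qpoch q (int N - j) * inv_qpoch q (int N + j))) \<le> norm (c j) * (M2 * M1 * M1)"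
      unfolding norm_mult using M1 M2 by (intro mult_mono mult_nonneg_nonneg) (auto intro: less_imp_le)
  qed (intro summable_on_cmult_left c)
  moreover have "(\<Sum>\<^sub>\<infinity>j. c j * (qpoch q q (2 * N) * inv_qpoch q (int N - j) * inv_qpoch q (int N + j))) =
     qpoch (r * y) q N * qpoch (r / y) q N" for N
    using finite_triple_product[OF r y, of N] by (simp add: c_def q_def)
  ultimately have "(\<lambda>N. qpoch (r * y) q N * qpoch (r / y) q N) \<longlonglongrightarrow> (\<Sum>\<^sub>\<infinity>j. c j * inverse P)"
    using P by simp
  moreover have "(\<lambda>N. qpoch (r * y) q N * qpoch (r / y) q N) \<longlonglongrightarrow> qpoch_inf (r * y) q * qpoch_inf (r / y) q"
    by (intro tendsto_mult qpoch_LIMSEQ q)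
  ultimately have "(\<Sum>\<^sub>\<infinity>j. c j * inverse P) = qpoch_inf (r * y) q * qpoch_inf (r / y) q"
    using LIMSEQ_unique by blast
  hence "(\<Sum>\<^sub>\<infinity>j. c j) * inverse P = qpoch_inf (r * y) q * qpoch_inf (r / y) q"
    by (simp add: infsum_cmult_left')
  hence "(\<Sum>\<^sub>\<infinity>j. c j) = qpoch_inf (r * y) q * qpoch_inf (r / y) q * P"
    using P by (simp add: field_simps)
  thus ?thesis by (simp add: c_def P_def q_def)
qed

section \<open>Products of theta series\<close>

lemma infsum_partition:
  fixes F :: "'b \<Rightarrow> complex"
  assumes C: "finite C" and bij: "bij_betw (\<lambda>(c, p). \<phi> c p) (C \<times> UNIV) UNIV"
    and F: "F summable_on UNIV"
  shows "(\<Sum>\<^sub>\<infinity>p. F p) = (\<Sum>c\<in>C. \<Sum>\<^sub>\<infinity>p. F (\<phi> c p))"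
    and "c \<in> C \<Longrightarrow> (\<lambda>p. F (\<phi> c p)) summable_on UNIV"
proof -
  have s: "(\<lambda>(c, p). F (\<phi> c p)) summable_on (C \<times> UNIV)"
    using summable_on_reindex_bij_betw[OF bij, of F] F by (simp add: case_prod_unfold)
  have "(\<Sum>\<^sub>\<infinity>p. F p) = (\<Sum>\<^sub>\<infinity>(c, p)\<in>C \<times> UNIV. F (\<phi> c p))"
    using infsum_reindex_bij_betw[OF bij, of F] by (simp add: case_prod_unfold)
  also have "\<dots> = (\<Sum>\<^sub>\<infinity>c\<in>C. \<Sum>\<^sub>\<infinity>p. F (\<phi> c p))"
    by (rule infsum_Sigma'_banach[OF s, symmetric])
  finally show "(\<Sum>\<^sub>\<infinity>p. F p) = (\<Sum>c\<in>C. \<Sum>\<^sub>\<infinity>p. F (\<phi> c p))"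
    using C by simp
  show "(\<lambda>p. F (\<phi> c p)) summable_on UNIV" if "c \<in> C"
    using summable_on_SigmaD1[OF s that] .
qed

lemma product_summable_on:
  fixes f :: "'a \<Rightarrow> complex" and g :: "'b \<Rightarrow> complex"
  assumes "f summable_on UNIV" "g summable_on UNIV"
  shows   "(\<lambda>(x, y). f x * g y) summable_on UNIV"
    and   "(\<Sum>\<^sub>\<infinity>(x, y). f x * g y) = infsum f UNIV * infsum g UNIV"
proof -
  have n: "(\<lambda>x. norm (f x)) summable_on UNIV" "(\<lambda>x. norm (g x)) summable_on UNIV"
    using assms by (auto simp: summable_on_iff_abs_summable_on_complex)
  have "(\<lambda>p. norm (case p of (x, y) \<Rightarrow> f x * g y)) summable_on (UNIV \<times> UNIV)"
    unfolding Infinite_Sum.abs_summable_on_Sigma_iff using n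
    by (auto simp: norm_mult infsum_cmult_right' abs_mult infsum_nonneg intro!: summable_on_cmult_right summable_on_cmult_left)
  thus s: "(\<lambda>(x, y). f x * g y) summable_on UNIV"
    by (simp add: summable_on_iff_abs_summable_on_complex)
  have "(\<Sum>\<^sub>\<infinity>(x, y). f x * g y) = (\<Sum>\<^sub>\<infinity>x. \<Sum>\<^sub>\<infinity>y. f x * g y)"
    using infsum_Sigma'_banach[of "\<lambda>x y. f x * g y" UNIV "\<lambda>_. UNIV"] s by simp
  thus "(\<Sum>\<^sub>\<infinity>(x, y). f x * g y) = infsum f UNIV * infsum g UNIV"
    by (simp add: infsum_cmult_right' infsum_cmult_left')
qed

text \<open>A product of two series is a sum over a lattice of rank two. In the applications
  \<open>\<phi>\<close> runs through the cosets of a sublattice in coordinates that keep the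
  quadratic form diagonal, so each coset contributes a product again.\<close>

lemma mult_infsum_partition:
  fixes f :: "'a \<Rightarrow> complex" and g :: "'b \<Rightarrow> complex"
    and f' :: "'c \<Rightarrow> 'd \<Rightarrow> complex" and g' :: "'c \<Rightarrow> 'e \<Rightarrow> complex"
  assumes C: "finite C" and bij: "bij_betw (\<lambda>(c, p). \<phi> c p) (C \<times> UNIV) UNIV"
    and fg: "f summable_on UNIV" "g summable_on UNIV"
    and fg': "\<And>c. c \<in> C \<Longrightarrow> f' c summable_on UNIV" "\<And>c. c \<in> C \<Longrightarrow> g' c summable_on UNIV"
    and eq: "\<And>c u v. c \<in> C \<Longrightarrow> f (fst (\<phi> c (u, v))) * g (snd (\<phi> c (u, v))) = k c * (f' c u * g' c v)"
  shows "infsum f UNIV * infsum g UNIV = (\<Sum>c\<in>C. k c * (infsum (f' c) UNIV * infsum (g' c) UNIV))"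
proof -
  have "infsum f UNIV * infsum g UNIV = (\<Sum>c\<in>C. \<Sum>\<^sub>\<infinity>p. (case \<phi> c p of (x, y) \<Rightarrow> f x * g y))"
    unfolding product_summable_on(2)[OF fg, symmetric]
    by (rule infsum_partition(1)[OF C bij]) (rule product_summable_on[OF fg])
  also have "\<dots> = (\<Sum>c\<in>C. k c * (infsum (f' c) UNIV * infsum (g' c) UNIV))"
  proof (rule sum.cong)
    fix c assume c: "c \<in> C"
    have "(\<Sum>\<^sub>\<infinity>p. (case \<phi> c p of (x, y) \<Rightarrow> f x * g y)) = (\<Sum>\<^sub>\<infinity>(u, v). k c * (f' c u * g' c v))"
      by (intro infsum_cong) (auto simp: case_prod_unfold eq[OF c])
    also have "\<dots> = k c * (infsum (f' c) UNIV * infsum (g' c) UNIV)"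
      unfolding product_summable_on(2)[OF fg'[OF c], symmetric]
      by (subst infsum_cmult_right'[symmetric]) (simp add: case_prod_unfold)
    finally show "(\<Sum>\<^sub>\<infinity>p. (case \<phi> c p of (x, y) \<Rightarrow> f x * g y)) = k c * (infsum (f' c) UNIV * infsum (g' c) UNIV)" .
  qed auto
  finally show ?thesis .
qed

text \<open>The class \<open>c\<close> is the parity of m + n. Up to linear terms, m^2 + n^2 becomes
  2 u^2 + 2 v^2, which is how products of theta series turn into theta series of doubled
  base.\<close>

lemma bij_lattice2:
  "bij_betw (\<lambda>(c, p). (\<lambda>(u, v). (u + v + c, u - v)) p) ({0, 1} \<times> UNIV) (UNIV :: (int \<times> int) set)"
proof (rule bij_betw_byWitness[where f' = "\<lambda>(m, n). ((m + n) mod 2, ((m + n) div 2, (m + n) div 2 - n))"])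
  show "\<forall>a\<in>{0, 1} \<times> UNIV. (case case a of (c, p) \<Rightarrow> (\<lambda>(u, v). (u + v + c, u - v)) p of
        (m, n) \<Rightarrow> ((m + n) mod 2, ((m + n) div 2, (m + n) div 2 - n))) = (a :: int \<times> int \<times> int)"
    by auto
  show "\<forall>a'\<in>UNIV. (case case a' of (m, n) \<Rightarrow> ((m + n) mod 2, (m + n) div 2, (m + n) div 2 - n) of
        (c, p) \<Rightarrow> (\<lambda>(u, v). (u + v + c, u - v)) p) = (a' :: int \<times> int)"
    by auto presburger+
qed auto

text \<open>
  The map is, up to the shift by \<open>c\<close>, complex conjugation followed by multiplication by the
  Gaussian integer \<open>2 + i\<close> of norm 5; it is responsible for the
  quadratic relations between theta functions of \<open>q\<close> and \<open>q^5\<close>.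
\<close>

lemma bij_lattice5:
  "bij_betw (\<lambda>(c, p). (\<lambda>(u, v). (2 * u + v + c, u - 2 * v)) p) ({-2, -1, 0, 1, 2} \<times> UNIV) (UNIV :: (int \<times> int) set)"
proof (rule bij_betw_byWitness[where f' = "\<lambda>(m, n). ((m - 2 * n + 2) mod 5 - 2, (n + 2 * ((m - 2 * n + 2) div 5), (m - 2 * n + 2) div 5))"])
  show "\<forall>a\<in>{-2, -1, 0, 1, 2} \<times> UNIV. (case case a of (c, p) \<Rightarrow> (\<lambda>(u, v). (2 * u + v + c, u - 2 * v)) p of
        (m, n) \<Rightarrow> ((m - 2 * n + 2) mod 5 - 2, (n + 2 * ((m - 2 * n + 2) div 5), (m - 2 * n + 2) div 5))) = (a :: int \<times> int \<times> int)"
    by auto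
  show "\<forall>a'\<in>UNIV. (case case a' of (m, n) \<Rightarrow> ((m - 2 * n + 2) mod 5 - 2, (n + 2 * ((m - 2 * n + 2) div 5), (m - 2 * n + 2) div 5)) of
        (c, p) \<Rightarrow> (\<lambda>(u, v). (2 * u + v + c, u - 2 * v)) p) = (a' :: int \<times> int)"
    by auto presburger+
qed auto

lemma bij_mod5:
  "bij_betw (\<lambda>(c, n). 5 * n + c) ({-2, -1, 0, 1, 2} \<times> UNIV) (UNIV :: int set)"
proof (rule bij_betw_byWitness[where f' = "\<lambda>n. ((n + 2) mod 5 - 2, (n + 2) div 5)"])
  show "\<forall>a\<in>{-2, -1, 0, 1, 2} \<times> UNIV. (\<lambda>n. ((n + 2) mod 5 - 2, (n + 2) div 5)) (case a of (c, n) \<Rightarrow> 5 * n + c) = (a :: int \<times> int)"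
    by auto
  show "\<forall>a'\<in>UNIV. (case ((a' + 2) mod 5 - 2, (a' + 2) div 5) of (c, n) \<Rightarrow> 5 * n + c) = (a' :: int)"
    by auto presburger+
qed auto


section \<open>Translation, reflection, dissection and multiplication of theta series\<close>

lemma theta_shift:
  assumes "r \<noteq> 0" "s \<noteq> 0"
  shows   "theta s a b r = s * r powi (a + b) * theta s a (b + 2 * a) r"
proof -
  have "theta s a b r = (\<Sum>\<^sub>\<infinity>n::int. s powi (n + 1) * r powi (a * (n + 1) ^ 2 + b * (n + 1)))"
    unfolding theta_def
    by (rule infsum_reindex_bij_witness[of _ "\<lambda>n. n + 1" "\<lambda>n. n - 1"]) auto
  also have "\<dots> = (\<Sum>\<^sub>\<infinity>n::int. s * r powi (a + b) * (s powi n * r powi (a * n ^ 2 + (b + 2 * a) * n)))"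
  proof (rule infsum_cong)
    fix n :: int
    have "a * (n + 1) ^ 2 + b * (n + 1) = (a + b) + (a * n ^ 2 + (b + 2 * a) * n)"
      by (simp add: algebra_simps power2_eq_square)
    hence "r powi (a * (n + 1) ^ 2 + b * (n + 1)) = r powi (a + b) * r powi (a * n ^ 2 + (b + 2 * a) * n)"
      using assms by (simp only: power_int_add simp_thms)
    thus "s powi (n + 1) * r powi (a * (n + 1) ^ 2 + b * (n + 1)) =
        s * r powi (a + b) * (s powi n * r powi (a * n ^ 2 + (b + 2 * a) * n))"
      using assms by (simp only: power_int_add simp_thms power_int_1_right mult_ac)
  qed
  finally show ?thesis by (simp only: infsum_cmult_right' theta_def)
qed

lemma pm1_powi_minus: "s \<in> {1, -1 :: complex} \<Longrightarrow> s powi (- n) = s powi n"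
  by (simp only: power_int_minus power_int_inverse[symmetric]) auto

lemma theta_minus:
  assumes "s \<in> {1, -1}"
  shows   "theta s a (- b) r = theta s a b r"
  unfolding theta_def
  by (rule infsum_reindex_bij_witness[of _ "\<lambda>n. - n" "\<lambda>n. - n"]) (use assms in \<open>auto simp: pm1_powi_minus\<close>)

lemma theta_power: "theta s a b (r ^ m) = theta s (int m * a) (int m * b) r"
  unfolding theta_def power_powi by (simp add: algebra_simps)

text \<open>The index shift takes the linear coefficient -a to a and changes the sign, while the
  reflection leaves the value unchanged; so the series equals its own negative.\<close>

lemma theta_eq_0:
  assumes "r \<noteq> 0"
  shows   "theta (-1) a a r = 0"
proof -
  have "theta (-1) a (- a) r = - theta (-1) a a r"
    using theta_shift[of r "-1" a "- a"] assms by simp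
  thus ?thesis using theta_minus[of "-1" a a r] by simp
qed

lemma theta_dissect5:
  assumes r: "norm r < 1" "r \<noteq> 0" and s: "s \<in> {1, -1}" and a: "a > 0"
  shows   "theta s a b r = (\<Sum>c\<in>{-2, -1, 0, 1, 2}. s powi c * r powi (a * c ^ 2 + b * c) * theta s (5 * a) (2 * a * c + b) (r ^ 5))"
proof -
  have s': "s \<noteq> 0" using s by auto
  have s5: "s ^ 5 = s" using s by auto
  have "theta s a b r = (\<Sum>c\<in>{-2, -1, 0, 1, 2}. \<Sum>\<^sub>\<infinity>n::int. s powi (5 * n + c) * r powi (a * (5 * n + c) ^ 2 + b * (5 * n + c)))"
    unfolding theta_def
    by (rule infsum_partition(1)[OF _ bij_mod5]) (use theta_summable[OF r a s'] in auto)
  also have "\<dots> = (\<Sum>c\<in>{-2, -1, 0, 1, 2}. s powi c * r powi (a * c ^ 2 + b * c) * theta s (5 * a) (2 * a * c + b) (r ^ 5))"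
  proof (rule sum.cong)
    fix c :: int
    show "(\<Sum>\<^sub>\<infinity>n::int. s powi (5 * n + c) * r powi (a * (5 * n + c) ^ 2 + b * (5 * n + c))) =
        s powi c * r powi (a * c ^ 2 + b * c) * theta s (5 * a) (2 * a * c + b) (r ^ 5)"
      unfolding theta_def infsum_cmult_right'[symmetric]
    proof (rule infsum_cong)
      fix n :: int
      have "s powi (5 * n + c) = s powi c * s powi n"
        using s' s5 power_powi[of s 5 n] by (simp add: power_int_add)
      moreover have "a * (5 * n + c) ^ 2 + b * (5 * n + c) = (a * c ^ 2 + b * c) + 5 * (5 * a * n ^ 2 + (2 * a * c + b) * n)"
        by (simp add: algebra_simps power2_eq_square)
      hence "r powi (a * (5 * n + c) ^ 2 + b * (5 * n + c)) = r powi (a * c ^ 2 + b * c) * (r ^ 5) powi (5 * a * n ^ 2 + (2 * a * c + b) * n)"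
        using r by (simp only: power_int_add power_powi simp_thms of_nat_numeral)
      ultimately show "s powi (5 * n + c) * r powi (a * (5 * n + c) ^ 2 + b * (5 * n + c)) =
          s powi c * r powi (a * c ^ 2 + b * c) * (s powi n * (r ^ 5) powi (5 * a * n ^ 2 + (2 * a * c + b) * n))"
        by (simp only: mult_ac)
    qed
  qed auto
  finally show ?thesis .
qed

lemma mult_regroup:
  fixes A B K U V S T C P Q :: complex
  assumes "A * B = K * U * V" "S * T = C * P * Q"
  shows   "S * A * (T * B) = C * K * (P * U * (Q * V))"
proof -
  have "S * A * (T * B) = (S * T) * (A * B)" by (simp only: mult_ac)
  thus ?thesis unfolding assms by (simp only: mult_ac)
qed

lemma theta_mult:
  assumes r: "norm r < 1" "r \<noteq> 0" and s: "s \<in> {1, -1}" "s' \<in> {1, -1}" and a: "a > 0"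
  shows   "theta s a b r * theta s' a b' r =
    theta (s * s') (2 * a) (b + b') r * theta (s * s') (2 * a) (b - b') r +
    s * r powi (a + b) * (theta (s * s') (2 * a) (2 * a + b + b') r * theta (s * s') (2 * a) (2 * a + b - b') r)"
proof -
  have s': "s \<noteq> 0" "s' \<noteq> 0" "s * s' \<noteq> 0" "2 * a > 0" using s a by auto
  have sm: "s' powi (u - v) = s' powi u * s' powi v" for u v
    using s' s pm1_powi_minus[of s' v] power_int_add[of s' u "-v"] by auto
  have "theta s a b r * theta s' a b' r =
      (\<Sum>c\<in>{0,1}. (s powi c * r powi (a * c ^ 2 + b * c)) *
         (theta (s * s') (2 * a) (2 * a * c + b + b') r * theta (s * s') (2 * a) (2 * a * c + b - b') r))"
    unfolding theta_def
  proof (rule mult_infsum_partition[OF _ bij_lattice2], goal_cases)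
    case (6 c u v)
    have "a * (u + v + c) ^ 2 + b * (u + v + c) + (a * (u - v) ^ 2 + b' * (u - v)) =
       (a * c ^ 2 + b * c) + (2 * a * u ^ 2 + (2 * a * c + b + b') * u) + (2 * a * v ^ 2 + (2 * a * c + b - b') * v)"
      by (simp add: algebra_simps power2_eq_square)
    hence "r powi (a * (u + v + c) ^ 2 + b * (u + v + c)) * r powi (a * (u - v) ^ 2 + b' * (u - v)) =
        r powi (a * c ^ 2 + b * c) * r powi (2 * a * u ^ 2 + (2 * a * c + b + b') * u) * r powi (2 * a * v ^ 2 + (2 * a * c + b - b') * v)"
      using r by (simp only: power_int_add[symmetric] simp_thms)
    moreover have "s powi (u + v + c) * s' powi (u - v) = s powi c * (s * s') powi u * (s * s') powi v"
      using s' by (simp add: sm power_int_add power_int_mult_distrib mult_ac)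
    ultimately show ?case unfolding fst_conv snd_conv prod.case
      by (rule mult_regroup)
  qed (use theta_summable[OF r] s' a in auto)
  thus ?thesis by (simp add: algebra_simps)
qed

text \<open>On each coset (2u + v + c)^2 + (u - 2v)^2 = 5 u^2 + 5 v^2 + 4cu + 2cv + c^2, so the
  square becomes a sum of five products with base coefficient 5a.\<close>

lemma theta_square5:
  assumes r: "norm r < 1" "r \<noteq> 0" and s: "s \<in> {1, -1}" and a: "a > 0"
  shows   "theta s a b r ^ 2 = (\<Sum>c\<in>{-2, -1, 0, 1, 2}. (s powi c * r powi (a * c ^ 2 + b * c)) *
         (theta s (5 * a) (4 * a * c + 3 * b) r * theta s (5 * a) (2 * a * c - b) r))"
proof -
  have s': "s \<noteq> 0" "5 * a > 0" using s a by auto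
  have sm: "s powi (2 * u + v + c) * s powi (u - 2 * v) = s powi c * s powi u * s powi v" for u v c
  proof -
    have "s ^ 3 = s" "inverse s = s" using s by auto
    moreover have "s powi (2 * u + v + c) * s powi (u - 2 * v) = (s ^ 3) powi u * (inverse s) powi v * s powi c"
      using s' by (simp add: power_powi power_int_inverse power_int_minus[symmetric] power_int_add[symmetric] algebra_simps)
    ultimately show ?thesis by simp
  qed
  show ?thesis unfolding theta_def power2_eq_square[of "infsum _ _"]
  proof (rule mult_infsum_partition[OF _ bij_lattice5], goal_cases)
    case (6 c u v)
    have "a * (2 * u + v + c) ^ 2 + b * (2 * u + v + c) + (a * (u - 2 * v) ^ 2 + b * (u - 2 * v)) =
       (a * c ^ 2 + b * c) + (5 * a * u ^ 2 + (4 * a * c + 3 * b) * u) + (5 * a * v ^ 2 + (2 * a * c - b) * v)"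
      by (simp add: algebra_simps power2_eq_square)
    hence "r powi (a * (2 * u + v + c) ^ 2 + b * (2 * u + v + c)) * r powi (a * (u - 2 * v) ^ 2 + b * (u - 2 * v)) =
        r powi (a * c ^ 2 + b * c) * r powi (5 * a * u ^ 2 + (4 * a * c + 3 * b) * u) * r powi (5 * a * v ^ 2 + (2 * a * c - b) * v)"
      using r by (simp only: power_int_add[symmetric] simp_thms)
    thus ?case unfolding fst_conv snd_conv prod.case
      by (rule mult_regroup[OF _ sm])
  qed (use theta_summable[OF r] s' a in auto)
qed

lemma theta_product:
  assumes r: "norm r < 1" "r \<noteq> 0" and s: "s \<in> {1, -1}" and a: "a > 0"
  shows "theta s (int a) b r = qpoch_inf (- s * r powi (int a + b)) (r ^ (2 * a)) *
    qpoch_inf (- s * r powi (int a - b)) (r ^ (2 * a)) * qpoch_inf (r ^ (2 * a)) (r ^ (2 * a))"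
proof -
  define y where "y = - s * r powi b"
  have y: "y \<noteq> 0" using s r by (auto simp: y_def)
  have ra: "norm (r ^ a) < 1" "r ^ a \<noteq> 0" using r a by (auto intro: norm_power_less_1)
  have "theta s (int a) b r = (\<Sum>\<^sub>\<infinity>j::int. (-1) powi j * (r ^ a) powi (j ^ 2) * y powi j)"
    unfolding theta_def
  proof (rule infsum_cong)
    fix j :: int
    have "(-1) powi j * y powi j = s powi j * r powi (b * j)"
      by (simp add: y_def power_int_mult power_int_mult_distrib[symmetric])
    moreover have "r powi (int a * j ^ 2 + b * j) = (r ^ a) powi (j ^ 2) * r powi (b * j)"
      using r by (simp add: power_int_add power_powi)
    ultimately show "s powi j * r powi (int a * j ^ 2 + b * j) = (-1) powi j * (r ^ a) powi (j ^ 2) * y powi j"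
      by (simp add: mult_ac)
  qed
  also have "\<dots> = qpoch_inf (r ^ a * y) ((r ^ a) ^ 2) * qpoch_inf (r ^ a / y) ((r ^ a) ^ 2) * qpoch_inf ((r ^ a) ^ 2) ((r ^ a) ^ 2)"
    by (rule triple_product[OF ra y])
  also have "r ^ a * y = - s * r powi (int a + b)"
    using r by (simp add: y_def power_int_add)
  also have "r ^ a / y = - s * r powi (int a - b)"
    using r s by (auto simp: y_def power_int_diff field_simps)
  also have "(r ^ a) ^ 2 = r ^ (2 * a)" by (simp add: power_mult[symmetric] mult.commute)
  finally show ?thesis .
qed

section \<open>The Appell--Lerch form of the mock theta function\<close>

text \<open>Up to the constant factor 1 - q^2, this is the sequence \<alpha> of a Bailey pair
  relative to q^2 in base q^2, with \<beta>_n = 1 / (q; q^2)_{n+1}^2.\<close>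

definition bailey_alpha :: "complex \<Rightarrow> nat \<Rightarrow> complex" where
  "bailey_alpha q k = (-1) ^ k * q ^ (k ^ 2 + k) * (1 + q ^ (2 * k + 1)) / (1 - q ^ (2 * k + 1))"

text \<open>Because (-q; q)_{2n} = (-q; q^2)_n (-q^2; q^2)_n, this is the summand of the q-Gauss sum
  in Bailey's lemma for the parameters -q and -q^2 in base q^2. The terms with n < k are
  zero.\<close>

definition gauss_term :: "complex \<Rightarrow> nat \<Rightarrow> nat \<Rightarrow> complex" where
  "gauss_term q n k = qpoch (- q) q (2 * n) * q ^ n * inv_qpoch (q ^ 2) (int n - int k) * inv_qpoch (q ^ 2) (int n + int k + 1)"

context
  fixes q :: complex
  assumes q: "norm q < 1" "q \<noteq> 0"
begin

private lemma inv_qpoch_step: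
  "inv_qpoch (q ^ 2) (n - 1) = (1 - q powi (2 * n)) * inv_qpoch (q ^ 2) n"
  using inv_qpoch_rec[OF square_in_disc(1)[OF q], of n] by (simp add: power_powi)

private lemma bailey_regroup:
  "a * (s * g * w * X * Z) - s * g * w * (b * X) * (c * Z) = s * g * X * Z * (w * (a - b * c))"
  for a b c s g w X Z :: complex
  by (simp add: algebra_simps)

private lemma bailey_regroup':
  "s * g * X * Z * (y * (a * b + x * c * d)) = y * (s * g * a * X * (b * Z) - (-1) * s * (g * x) * c * (d * X) * Z)"
  for a b c d s g x y X Z :: complex
  by (simp add: algebra_simps)

text \<open>On the right the term k = n vanishes, so this is a first-order recurrence in n for the
  Bailey sum. It is the recurrence satisfied by 1 / (q; q^2)_{n+1}^2.\<close>

private lemma bailey_step: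
  assumes n: "n > 0"
  shows "(1 - q ^ (2 * n + 1)) ^ 2 * (\<Sum>k\<le>n. bailey_alpha q k * inv_qpoch (q ^ 2) (int n - int k) * inv_qpoch (q ^ 2) (int n + int k + 1)) =
         (\<Sum>k\<le>n. bailey_alpha q k * inv_qpoch (q ^ 2) (int n - 1 - int k) * inv_qpoch (q ^ 2) (int n + int k))"
proof -
  txt \<open>\<open>G\<close> is a telescoper in the sense of Zeilberger's algorithm.\<close>
  define G where "G = (\<lambda>k. (-1) ^ k * q powi (int k ^ 2 - int k) * (1 - q ^ (2 * k)) *
      inv_qpoch (q ^ 2) (int n - int k) * inv_qpoch (q ^ 2) (int n + int k))"
  define y where "y = q ^ (2 * n)"
  have y: "1 - y \<noteq> 0" unfolding y_def using n by (intro one_minus_power_nonzero[OF q(1)]) auto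
  have eq: "(1 - q ^ (2 * n + 1)) ^ 2 * (bailey_alpha q k * inv_qpoch (q ^ 2) (int n - int k) * inv_qpoch (q ^ 2) (int n + int k + 1))
       - bailey_alpha q k * inv_qpoch (q ^ 2) (int n - 1 - int k) * inv_qpoch (q ^ 2) (int n + int k) =
       y / (1 - y) * (G k - G (Suc k))" for k
  proof -
    define x where "x = q ^ k"
    define g where "g = q powi (int k ^ 2 - int k)"
    define X where "X = inv_qpoch (q ^ 2) (int n - int k)"
    define Z where "Z = inv_qpoch (q ^ 2) (int n + int k + 1)"
    have x: "x \<noteq> 0" using q by (simp add: x_def)
    have xx: "q ^ (2 * k) = x ^ 2" unfolding x_def by (rule power_even_eq)
    have "q ^ (2 * Suc k) = q ^ (2 * k) * q ^ 2" by (simp add: power2_eq_square)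
    moreover have "q ^ (2 * k + 1) = q * q ^ (2 * k)" "q ^ (2 * n + 1) = q * q ^ (2 * n)" by simp_all
    ultimately have p: "q ^ (2 * k) = x ^ 2" "q ^ (2 * Suc k) = x ^ 2 * q ^ 2" "q ^ (2 * k + 1) = q * x ^ 2" "q ^ (2 * n + 1) = q * y"
      by (simp_all only: xx y_def)
    have "int (k ^ 2 + k) = int k ^ 2 - int k + int (2 * k)" by simp
    hence g1: "q ^ (k ^ 2 + k) = g * x ^ 2"
      unfolding p(1)[symmetric] g_def using q
      by (metis power_int_add power_int_of_nat)
    have "int (Suc k) ^ 2 - int (Suc k) = int k ^ 2 - int k + int (2 * k)"
      by (simp add: power2_eq_square algebra_simps)
    hence g2: "q powi (int (Suc k) ^ 2 - int (Suc k)) = g * x ^ 2"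
      unfolding p(1)[symmetric] g_def using q
      by (metis power_int_add power_int_of_nat)
    have e1: "q powi (2 * (int n - int k)) = y / x ^ 2"
    proof -
      have "2 * (int n - int k) = int (2 * n) - int (2 * k)" by simp
      thus ?thesis unfolding y_def p(1)[symmetric] using q by (metis power_int_diff power_int_of_nat)
    qed
    have e2: "q powi (2 * (int n + int k + 1)) = y * x ^ 2 * q ^ 2"
    proof -
      have "2 * (int n + int k + 1) = int (2 * n + 2 * k + 2)" by simp
      thus ?thesis unfolding y_def p(1)[symmetric] by (metis power_add power_int_of_nat)
    qed
    have i1: "inv_qpoch (q ^ 2) (int n - 1 - int k) = (1 - y / x ^ 2) * X"
      using inv_qpoch_step[of "int n - int k"] by (simp only: e1 X_def) (simp add: algebra_simps)
    have i2: "inv_qpoch (q ^ 2) (int n + int k) = (1 - y * x ^ 2 * q ^ 2) * Z"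
      using inv_qpoch_step[of "int n + int k + 1"] by (simp only: e2 Z_def) (simp add: algebra_simps)
    have i3: "inv_qpoch (q ^ 2) (int n - int (Suc k)) = (1 - y / x ^ 2) * X" "inv_qpoch (q ^ 2) (int n + int (Suc k)) = Z"
      using i1 by (simp_all add: Z_def algebra_simps)
    define s where "s = ((-1) ^ k :: complex)"
    define w where "w = (1 + q * x ^ 2) / (1 - q * x ^ 2) * x ^ 2"
    have d: "1 - q * x ^ 2 \<noteq> 0" using one_minus_power_nonzero[OF q(1), of "2 * k + 1"] p by simp
    have ba: "bailey_alpha q k = s * g * w"
      unfolding bailey_alpha_def g1 p s_def w_def by simp
    \<comment> \<open>With the common factor s g X Z removed, the telescoping relation is an
      identity of rational functions in q, x = q^k and y = q^(2n).\<close>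
    have "w * ((1 - q * y) ^ 2 - (1 - y / x ^ 2) * (1 - y * x ^ 2 * q ^ 2)) = y * (1 - (q * x ^ 2) ^ 2)"
      unfolding w_def using d x by (simp add: divide_simps) algebra
    also have "\<dots> = y / (1 - y) * ((1 - x ^ 2) * (1 - y * x ^ 2 * q ^ 2) + x ^ 2 * (1 - x ^ 2 * q ^ 2) * (1 - y / x ^ 2))"
    proof -
      have "(1 - x ^ 2) * (1 - y * x ^ 2 * q ^ 2) + x ^ 2 * (1 - x ^ 2 * q ^ 2) * (1 - y / x ^ 2) = (1 - (q * x ^ 2) ^ 2) * (1 - y)"
        using x by (simp add: divide_simps) algebra
      thus ?thesis using y by simp
    qed
    finally have main: "w * ((1 - q * y) ^ 2 - (1 - y / x ^ 2) * (1 - y * x ^ 2 * q ^ 2)) = \<dots>" .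
    have "(1 - q ^ (2 * n + 1)) ^ 2 * (bailey_alpha q k * X * Z) - bailey_alpha q k * inv_qpoch (q ^ 2) (int n - 1 - int k) * inv_qpoch (q ^ 2) (int n + int k)
       = (1 - q * y) ^ 2 * (s * g * w * X * Z) - s * g * w * ((1 - y / x ^ 2) * X) * ((1 - y * x ^ 2 * q ^ 2) * Z)"
      by (simp only: ba p i1 i2)
    also have "\<dots> = s * g * X * Z * (w * ((1 - q * y) ^ 2 - (1 - y / x ^ 2) * (1 - y * x ^ 2 * q ^ 2)))"
      by (rule bailey_regroup)
    also have "\<dots> = y / (1 - y) * (s * g * (1 - x ^ 2) * X * ((1 - y * x ^ 2 * q ^ 2) * Z)
        - (-1) * s * (g * x ^ 2) * (1 - x ^ 2 * q ^ 2) * ((1 - y / x ^ 2) * X) * Z)"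
      unfolding main by (rule bailey_regroup')
    also have "\<dots> = y / (1 - y) * (G k - G (Suc k))"
      unfolding G_def i3 g2 p i2 g_def[symmetric] X_def[symmetric] power_Suc s_def[symmetric] ..
    finally show ?thesis by (simp only: X_def Z_def)
  qed
  have "(\<Sum>k\<le>n. (1 - q ^ (2 * n + 1)) ^ 2 * (bailey_alpha q k * inv_qpoch (q ^ 2) (int n - int k) * inv_qpoch (q ^ 2) (int n + int k + 1))
       - bailey_alpha q k * inv_qpoch (q ^ 2) (int n - 1 - int k) * inv_qpoch (q ^ 2) (int n + int k)) = y / (1 - y) * (\<Sum>k\<le>n. G k - G (Suc k))"
    unfolding eq by (simp add: sum_distrib_left)
  also have "(\<Sum>k\<le>n. G k - G (Suc k)) = G 0 - G (Suc n)"
    by (rule sum_telescope)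
  \<comment> \<open>\<open>G 0\<close> contains the factor 1 - q^0, and \<open>G (Suc n)\<close>
    contains \<open>inv_qpoch\<close> at index -1.\<close>
  also have "\<dots> = 0" by (simp add: G_def)
  finally show ?thesis by (simp add: sum_subtractf sum_distrib_left)
qed

lemma bailey_pair:
  "1 / (qpoch q (q ^ 2) (n + 1)) ^ 2 =
     (\<Sum>k\<le>n. bailey_alpha q k * inv_qpoch (q ^ 2) (int n - int k) * inv_qpoch (q ^ 2) (int n + int k + 1))"
proof (induction n)
  case 0
  have "1 - q \<noteq> 0" "1 - q ^ 2 \<noteq> 0" using one_minus_power_nonzero[OF q(1), of 1] one_minus_power_nonzero[OF q(1), of 2] by auto
  thus ?case
    by (simp add: bailey_alpha_def inv_qpoch_def qpoch_Suc divide_simps) algebra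
next
  case (Suc n)
  define S where "S = (\<Sum>k\<le>Suc n. bailey_alpha q k * inv_qpoch (q ^ 2) (int (Suc n) - int k) * inv_qpoch (q ^ 2) (int (Suc n) + int k + 1))"
  have nz: "1 - q ^ (2 * Suc n + 1) \<noteq> 0" by (intro one_minus_power_nonzero[OF q(1)]) auto
  have "(1 - q ^ (2 * Suc n + 1)) ^ 2 * S = 1 / (qpoch q (q ^ 2) (n + 1)) ^ 2"
  proof -
    have "(1 - q ^ (2 * Suc n + 1)) ^ 2 * S =
        (\<Sum>k\<le>Suc n. bailey_alpha q k * inv_qpoch (q ^ 2) (int (Suc n) - 1 - int k) * inv_qpoch (q ^ 2) (int (Suc n) + int k))"
      unfolding S_def by (rule bailey_step) simp
    also have "\<dots> = (\<Sum>k\<le>n. bailey_alpha q k * inv_qpoch (q ^ 2) (int n - int k) * inv_qpoch (q ^ 2) (int n + int k + 1))"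
      by (simp add: add_ac)
    finally show ?thesis by (simp only: Suc)
  qed
  hence "S = 1 / (qpoch q (q ^ 2) (n + 1)) ^ 2 / (1 - q ^ (2 * Suc n + 1)) ^ 2"
    using nz by (metis nonzero_mult_div_cancel_left power_not_zero)
  hence "S = 1 / (qpoch q (q ^ 2) (n + 1) * (1 - q ^ (2 * Suc n + 1))) ^ 2"
    by (simp only: power_mult_distrib divide_divide_eq_left)
  also have "qpoch q (q ^ 2) (n + 1) * (1 - q ^ (2 * Suc n + 1)) = qpoch q (q ^ 2) (Suc n + 1)"
  proof -
    have "q * (q ^ 2) ^ (n + 1) = q ^ (2 * Suc n + 1)"
      unfolding power_mult[symmetric] by simp
    moreover have "qpoch q (q ^ 2) (Suc n + 1) = qpoch q (q ^ 2) (n + 1) * (1 - q * (q ^ 2) ^ (n + 1))"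
      unfolding add_Suc by (rule qpoch_Suc)
    ultimately show ?thesis by (simp only:)
  qed
  finally show ?case by (simp only: S_def)
qed


lemma gauss_term_bound:
  obtains M where "M > 0" "\<And>n i j. norm (qpoch (- q) q n * inv_qpoch (q ^ 2) i * inv_qpoch (q ^ 2) j) \<le> M"
proof -
  obtain M1 where M1: "M1 > 0" "\<And>n. norm (inv_qpoch (q ^ 2) n) \<le> M1" using inv_qpoch_bounded[OF square_in_disc(1)[OF q]] by auto
  obtain M2 where M2: "M2 > 0" "\<And>n. norm (qpoch (- q) q n) \<le> M2" using qpoch_bounded[OF q(1)] by auto
  show ?thesis
  proof (rule that[of "M2 * M1 * M1"])
    show "norm (qpoch (- q) q n * inv_qpoch (q ^ 2) i * inv_qpoch (q ^ 2) j) \<le> M2 * M1 * M1" for n i j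
      unfolding norm_mult using M1 M2 by (intro mult_mono mult_nonneg_nonneg) (auto intro: less_imp_le)
  qed (use M1 M2 in auto)
qed

lemma summable_norm_q: "summable (\<lambda>n. M * norm q ^ n)"
  using q by (intro summable_mult summable_geometric) auto

lemma gauss_term_norm:
  obtains M where "M > 0" "\<And>n k. norm (gauss_term q n k) \<le> M * norm q ^ n"
proof -
  obtain M where M: "M > 0" "\<And>n i j. norm (qpoch (- q) q n * inv_qpoch (q ^ 2) i * inv_qpoch (q ^ 2) j) \<le> M"
    using gauss_term_bound by blast
  show ?thesis
  proof (rule that[OF M(1)])
    fix n k
    have "norm (gauss_term q n k) = norm (qpoch (- q) q (2 * n) * inv_qpoch (q ^ 2) (int n - int k) * inv_qpoch (q ^ 2) (int n + int k + 1)) * norm q ^ n"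
      by (simp add: gauss_term_def norm_mult norm_power)
    also have "\<dots> \<le> M * norm q ^ n" by (intro mult_right_mono M) auto
    finally show "norm (gauss_term q n k) \<le> M * norm q ^ n" .
  qed
qed

lemma gauss_term_summable: "summable (\<lambda>n. norm (gauss_term q n k))"
proof -
  obtain M where M: "M > 0" "\<And>n k. norm (gauss_term q n k) \<le> M * norm q ^ n"
    using gauss_term_norm by blast
  show ?thesis
    by (rule summable_comparison_test'[OF summable_norm_q[of M], where N = 0]) (simp only: real_norm_def abs_norm_cancel, rule M(2))
qed

private lemma gauss_regroup:
  "a * (w * u) - b * (w * v) = c * w - d * w" if "a * u - b * v = c - d" for a b c d u v w :: complex
proof -
  have "a * (w * u) - b * (w * v) = (a * u - b * v) * w" by (simp add: algebra_simps)
  thus ?thesis unfolding that by (simp add: algebra_simps)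
qed

text \<open>
  The sum over \<open>n\<close> is a case of the \<open>q\<close>-Gauss sum. It is evaluated by a recurrence in \<open>k\<close>, obtained by
  telescoping in \<open>n\<close>, and by its behaviour as \<open>k\<close> tends to infinity.
\<close>

private lemma gauss_term_telescope:
  defines "G \<equiv> \<lambda>k n. - (1 - q ^ (2 * k + 2)) * qpoch (- q) q (2 * n) * q ^ n * inv_qpoch (q ^ 2) (int n - int k - 1) * inv_qpoch (q ^ 2) (int n + int k + 1)"
  shows "(1 + q ^ (2 * k + 3)) * gauss_term q n (Suc k) - q * (1 + q ^ (2 * k + 1)) * gauss_term q n k = G k (Suc n) - G k n"
proof -
  define x where "x = q ^ k"
  define y where "y = q ^ (2 * n)"
  define X where "X = inv_qpoch (q ^ 2) (int n - int k)"
  define Z where "Z = inv_qpoch (q ^ 2) (int n + int k + 2)"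
  define P where "P = qpoch (- q) q (2 * n) * q ^ n"
  have x: "x \<noteq> 0" using q by (simp add: x_def)
  have xx: "q ^ (2 * k) = x ^ 2" unfolding x_def by (rule power_even_eq)
  have p: "q ^ (2 * k + 1) = q * x ^ 2" "q ^ (2 * k + 2) = q ^ 2 * x ^ 2" "q ^ (2 * k + 3) = q ^ 3 * x ^ 2"
    by (simp_all only: xx[symmetric]) (simp_all add: eval_nat_numeral)
  have e1: "q powi (2 * (int n - int k)) = y / x ^ 2"
  proof -
    have "2 * (int n - int k) = int (2 * n) - int (2 * k)" by simp
    thus ?thesis unfolding y_def xx[symmetric] using q by (metis power_int_diff power_int_of_nat)
  qed
  have e2: "q powi (2 * (int n + int k + 2)) = y * x ^ 2 * q ^ 4"
  proof -
    have "2 * (int n + int k + 2) = int (2 * n + 2 * k + 4)" by simp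
    thus ?thesis unfolding y_def xx[symmetric] by (metis power_add power_int_of_nat)
  qed
  have i1: "inv_qpoch (q ^ 2) (int n - int k - 1) = (1 - y / x ^ 2) * X"
    using inv_qpoch_step[of "int n - int k"] by (simp only: e1 X_def)
  have i2: "inv_qpoch (q ^ 2) (int n + int k + 1) = (1 - y * x ^ 2 * q ^ 4) * Z"
    using inv_qpoch_step[of "int n + int k + 2"] by (simp only: e2 Z_def) (simp add: algebra_simps)
  have i3: "inv_qpoch (q ^ 2) (int n - int (Suc k)) = (1 - y / x ^ 2) * X" "inv_qpoch (q ^ 2) (int n + int (Suc k) + 1) = Z"
      "inv_qpoch (q ^ 2) (int (Suc n) - int k - 1) = X" "inv_qpoch (q ^ 2) (int (Suc n) + int k + 1) = Z"
    using i1 by (simp_all add: X_def Z_def algebra_simps)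
  have t1: "gauss_term q n (Suc k) = P * X * Z * (1 - y / x ^ 2)"
    unfolding gauss_term_def i3 P_def by (simp only: mult_ac)
  have t2: "gauss_term q n k = P * X * Z * (1 - y * x ^ 2 * q ^ 4)"
    unfolding gauss_term_def i2 X_def[symmetric] P_def by (simp only: mult_ac)
  have g1: "G k n = - (1 - q ^ 2 * x ^ 2) * (1 - y / x ^ 2) * (1 - y * x ^ 2 * q ^ 4) * (P * X * Z)"
    unfolding G_def p i1 i2 P_def by (simp only: mult_ac)
  have "qpoch (- q) q (2 * Suc n) = qpoch (- q) q (2 * n) * (1 + q * y) * (1 + q ^ 2 * y)"
    by (simp add: qpoch_Suc y_def power2_eq_square mult_ac)
  hence g2: "G k (Suc n) = - (1 - q ^ 2 * x ^ 2) * q * (1 + q * y) * (1 + q ^ 2 * y) * (P * X * Z)"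
    unfolding G_def p i3 P_def power_Suc by (simp only: mult_ac)
  have main: "(1 + q ^ 3 * x ^ 2) * (1 - y / x ^ 2) - q * (1 + q * x ^ 2) * (1 - y * x ^ 2 * q ^ 4) =
      - (1 - q ^ 2 * x ^ 2) * q * (1 + q * y) * (1 + q ^ 2 * y) - (- (1 - q ^ 2 * x ^ 2) * (1 - y / x ^ 2) * (1 - y * x ^ 2 * q ^ 4))"
    using x by (simp add: divide_simps) algebra
  show ?thesis unfolding t1 t2 g1 g2 p by (rule gauss_regroup[OF main])
qed

private lemma gauss_sum_rec:
  "(1 + q ^ (2 * k + 3)) * (\<Sum>n. gauss_term q n (Suc k)) = q * (1 + q ^ (2 * k + 1)) * (\<Sum>n. gauss_term q n k)"
proof -
  define G where "G = (\<lambda>n. - (1 - q ^ (2 * k + 2)) * qpoch (- q) q (2 * n) * q ^ n * inv_qpoch (q ^ 2) (int n - int k - 1) * inv_qpoch (q ^ 2) (int n + int k + 1))"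
  obtain M where M: "M > 0" "\<And>n i j. norm (qpoch (- q) q n * inv_qpoch (q ^ 2) i * inv_qpoch (q ^ 2) j) \<le> M"
    using gauss_term_bound by blast
  have sm: "summable (\<lambda>n. norm (1 - q ^ (2 * k + 2)) * (M * norm q ^ n))"
    by (intro summable_mult[OF summable_norm_q])
  have bd: "norm (G n) \<le> norm (1 - q ^ (2 * k + 2)) * (M * norm q ^ n)" for n
  proof -
    have "norm (G n) = norm (1 - q ^ (2 * k + 2)) * (norm (qpoch (- q) q (2 * n) * inv_qpoch (q ^ 2) (int n - int k - 1) * inv_qpoch (q ^ 2) (int n + int k + 1)) * norm q ^ n)"
      by (simp add: G_def norm_mult norm_power norm_minus_commute)
    also have "\<dots> \<le> norm (1 - q ^ (2 * k + 2)) * (M * norm q ^ n)" by (intro mult_left_mono mult_right_mono M) auto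
    finally show ?thesis .
  qed
  have "summable G"
    by (rule summable_comparison_test'[OF sm, where N = 0]) (rule bd)
  hence "G \<longlonglongrightarrow> 0" by (rule summable_LIMSEQ_zero)
  \<comment> \<open>\<open>G 0\<close> vanishes too, since it contains \<open>inv_qpoch\<close> at
    the negative index -k - 1. Hence the recurrence in k has no inhomogeneous term.\<close>
  hence "(\<lambda>n. G (Suc n) - G n) sums (0 - G 0)" by (rule telescope_sums)
  hence "(\<lambda>n. (1 + q ^ (2 * k + 3)) * gauss_term q n (Suc k) - q * (1 + q ^ (2 * k + 1)) * gauss_term q n k) sums 0"
    unfolding gauss_term_telescope by (simp add: G_def)
  moreover have "(\<lambda>n. (1 + q ^ (2 * k + 3)) * gauss_term q n (Suc k) - q * (1 + q ^ (2 * k + 1)) * gauss_term q n k) sums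
     ((1 + q ^ (2 * k + 3)) * (\<Sum>n. gauss_term q n (Suc k)) - q * (1 + q ^ (2 * k + 1)) * (\<Sum>n. gauss_term q n k))"
    by (intro sums_diff sums_mult summable_sums summable_norm_cancel[OF gauss_term_summable])
  ultimately have "(1 + q ^ (2 * k + 3)) * (\<Sum>n. gauss_term q n (Suc k)) - q * (1 + q ^ (2 * k + 1)) * (\<Sum>n. gauss_term q n k) = 0"
    using sums_unique2 by blast
  thus ?thesis by simp
qed

text \<open>Weighted with 1 + q^(2k+1), the recurrence says that the sums form a geometric
  progression with ratio q.\<close>

lemma gauss_sum_eq:
  "(1 + q ^ (2 * k + 1)) * (\<Sum>n. gauss_term q n k) = q ^ k * ((1 + q) * (\<Sum>n. gauss_term q n 0))"
proof (induction k)
  case 0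
  have "2 * 0 + 1 = (1 :: nat)" by simp
  thus ?case by (simp only: power_0 mult_1_left power_one_right)
next
  case (Suc k)
  have "(1 + q ^ (2 * Suc k + 1)) * (\<Sum>n. gauss_term q n (Suc k)) = q * ((1 + q ^ (2 * k + 1)) * (\<Sum>n. gauss_term q n k))"
  proof -
    have "2 * Suc k + 1 = 2 * k + 3" by simp
    thus ?thesis using gauss_sum_rec[of k] by (simp only: mult.assoc)
  qed
  thus ?case unfolding Suc by (simp only: power_Suc mult.assoc)
qed

end

text \<open>Euler's expansion of 1 / (z; q)_\<infinity>. The series satisfies e(w) (1 - w) = e(wq);
  iteration leads to e(z q^n), which tends to the constant term 1.\<close>

lemma euler_sum:
  fixes q z :: complex
  assumes q: "norm q < 1" and z: "norm z < 1"
  shows "(\<Sum>m. z ^ m * inv_qpoch q (int m)) * qpoch_inf z q = 1"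
proof -
  obtain M where M: "M > 0" "\<And>n. norm (inv_qpoch q n) \<le> M" using inv_qpoch_bounded[OF q] by blast
  have b: "norm (w ^ m * inv_qpoch q i) \<le> M * norm w ^ m" for w m i
  proof -
    have "norm (w ^ m * inv_qpoch q i) \<le> norm w ^ m * M"
      unfolding norm_mult norm_power by (intro mult_left_mono M) auto
    thus ?thesis by (simp only: mult.commute)
  qed
  have sg: "summable (\<lambda>m. M * norm w ^ m)" if "norm w < 1" for w :: complex
    using that by (intro summable_mult summable_geometric) auto
  have sm: "summable (\<lambda>m. w ^ m * inv_qpoch q (int m + d))" if "norm w < 1" for w d
    by (rule summable_comparison_test'[OF sg[OF that], of 0]) (use b in auto)
  define e where "e = (\<lambda>z. \<Sum>m. z ^ m * inv_qpoch q (int m))"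
  have step: "e w * (1 - w) = e (w * q)" if w: "norm w < 1" for w
  proof -
    have wq: "norm (w * q) < 1" 
      using mult_strict_mono'[OF w q] by (simp add: norm_mult)
    have "w * e w = (\<Sum>m. w ^ Suc m * inv_qpoch q (int m))"
      unfolding e_def using sm[OF w, of 0] by (subst suminf_mult[symmetric]) (auto simp: mult_ac)
    also have "\<dots> = (\<Sum>m. w ^ m * inv_qpoch q (int m - 1))"
      using suminf_split_head[of "\<lambda>m. w ^ m * inv_qpoch q (int m - 1)"] sm[OF w, of "-1"] by simp
    also have "\<dots> = (\<Sum>m. w ^ m * inv_qpoch q (int m) - (w * q) ^ m * inv_qpoch q (int m))"
      by (intro suminf_cong) (simp add: inv_qpoch_rec[OF q] algebra_simps power_mult_distrib)
    also have "\<dots> = e w - e (w * q)"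
      unfolding e_def using sm[OF w, of 0] sm[OF wq, of 0] by (subst suminf_diff) auto
    finally show ?thesis by (simp add: algebra_simps)
  qed
  have zq: "norm (z * q ^ n) < 1" for n
  proof -
    have "norm (z * q ^ n) \<le> norm z * 1" unfolding norm_mult norm_power
      using q by (intro mult_left_mono power_le_one) auto
    thus ?thesis using z by simp
  qed
  have it: "e z * qpoch z q n = e (z * q ^ n)" for n
  proof (induction n)
    case (Suc n)
    have "e z * qpoch z q (Suc n) = e (z * q ^ n) * (1 - z * q ^ n)" by (simp add: qpoch_Suc Suc[symmetric])
    also have "\<dots> = e (z * q ^ n * q)" by (rule step[OF zq])
    finally show ?case by (simp add: mult_ac)
  qed simp
  have "(\<lambda>n. e (z * q ^ n)) \<longlonglongrightarrow> (\<Sum>m. if m = 0 then 1 else 0)"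
    unfolding e_def
  proof (rule tannery_nat[OF _ _ sg[OF z]])
    fix m :: nat
    have "(\<lambda>n. (z * q ^ n) ^ m * inv_qpoch q (int m)) \<longlonglongrightarrow> (z * 0) ^ m * inv_qpoch q (int m)"
      using q by (intro tendsto_intros LIMSEQ_power_zero) auto
    thus "(\<lambda>n. (z * q ^ n) ^ m * inv_qpoch q (int m)) \<longlonglongrightarrow> (if m = 0 then 1 else 0)"
      by (cases "m = 0") (auto simp: power_0_left)
  next
    fix n m
    have "norm (z * q ^ n) \<le> norm z * 1" unfolding norm_mult norm_power
      using q by (intro mult_left_mono power_le_one) auto
    hence "norm (z * q ^ n) ^ m \<le> norm z ^ m" by (intro power_mono) auto
    thus "norm ((z * q ^ n) ^ m * inv_qpoch q (int m)) \<le> M * norm z ^ m"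
      using b[of "z * q ^ n" m "int m"] M by (meson dual_order.trans mult_left_mono less_imp_le)
  qed
  also have "(\<Sum>m. if m = 0 then 1 else 0 :: complex) = 1"
    using suminf_finite[of "{0}" "\<lambda>m. if m = 0 then 1 else 0 :: complex"] by simp
  finally have "(\<lambda>n. e z * qpoch z q n) \<longlonglongrightarrow> 1" by (simp only: it)
  moreover have "(\<lambda>n. e z * qpoch z q n) \<longlonglongrightarrow> e z * qpoch_inf z q"
    by (intro tendsto_intros qpoch_LIMSEQ q)
  ultimately show ?thesis unfolding e_def using LIMSEQ_unique by blast
qed

context
  fixes q :: complex
  assumes q: "norm q < 1" "q \<noteq> 0"
begin

text \<open>The shift n = m + k extracts q^k from the sum, and by the geometric progression what is
  left, weighted with 1 + q^(2k+1), is constant in k. Its limit for k -> \<infinity> is a multiple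
  of Euler's series at z = q in base q^2.\<close>

lemma gauss_sum_0:
  "(1 + q) * (\<Sum>n. gauss_term q n 0) = qpoch_inf (- q) q * inverse (qpoch_inf (q ^ 2) (q ^ 2)) * inverse (qpoch_inf q (q ^ 2))"
proof -
  define t where "t = (\<lambda>k m. q ^ m * (qpoch (- q) q (2 * (m + k)) * inv_qpoch (q ^ 2) (int m) * inv_qpoch (q ^ 2) (int m + int (2 * k + 1))))"
  define L where "L = qpoch_inf (- q) q * inverse (qpoch_inf (q ^ 2) (q ^ 2))"
  obtain M where M: "M > 0" "\<And>n i j. norm (qpoch (- q) q n * inv_qpoch (q ^ 2) i * inv_qpoch (q ^ 2) j) \<le> M"
    using gauss_term_bound[OF q] by blast
  have S: "(\<Sum>n. gauss_term q n k) = q ^ k * (\<Sum>m. t k m)" for k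
  proof -
    have e: "gauss_term q (m + k) k = q ^ k * t k m" for m
    proof -
      have "int (m + k) - int k = int m" "int (m + k) + int k + 1 = int m + int (2 * k + 1)" by simp_all
      thus ?thesis unfolding gauss_term_def t_def power_add by (simp only: mult_ac)
    qed
    have sm: "summable (\<lambda>m. t k m)"
    proof -
      have "summable (\<lambda>m. q ^ k * t k m)"
        unfolding e[symmetric] by (rule summable_ignore_initial_segment[OF summable_norm_cancel[OF gauss_term_summable[OF q]]])
      thus ?thesis using q by (subst (asm) summable_cmult_iff) auto
    qed
    have "(\<Sum>n. gauss_term q n k) = (\<Sum>n. gauss_term q (n + k) k) + (\<Sum>n<k. gauss_term q n k)"
      by (rule suminf_split_initial_segment[OF summable_norm_cancel[OF gauss_term_summable[OF q]]])
    also have "(\<Sum>n<k. gauss_term q n k) = 0" by (intro sum.neutral) (auto simp: gauss_term_def)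
    finally show ?thesis unfolding e using suminf_mult[OF sm] by simp
  qed
  have "(1 + q ^ (2 * k + 1)) * (\<Sum>m. t k m) = (1 + q) * (\<Sum>n. gauss_term q n 0)" for k
  proof -
    have "q ^ k * ((1 + q ^ (2 * k + 1)) * (\<Sum>m. t k m)) = q ^ k * ((1 + q) * (\<Sum>n. gauss_term q n 0))"
      using gauss_sum_eq[OF q, of k] unfolding S[of k] by (simp only: mult_ac)
    thus ?thesis using q by simp
  qed
  moreover have "(\<lambda>k. (1 + q ^ (2 * k + 1)) * (\<Sum>m. t k m)) \<longlonglongrightarrow> (1 + 0) * (\<Sum>m. q ^ m * (qpoch_inf (- q) q * inv_qpoch (q ^ 2) (int m) * inverse (qpoch_inf (q ^ 2) (q ^ 2))))"
  proof (intro tendsto_mult tendsto_add tendsto_const)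
    have "filterlim (\<lambda>k. 2 * k + 1 :: nat) at_top sequentially"
      by (rule filterlim_at_top_mono[OF filterlim_ident]) auto
    thus "(\<lambda>k. q ^ (2 * k + 1)) \<longlonglongrightarrow> 0"
      using filterlim_compose[OF LIMSEQ_power_zero[OF q(1)]] by blast
  next
    show "(\<lambda>k. \<Sum>m. t k m) \<longlonglongrightarrow> (\<Sum>m. q ^ m * (qpoch_inf (- q) q * inv_qpoch (q ^ 2) (int m) * inverse (qpoch_inf (q ^ 2) (q ^ 2))))"
    proof (rule tannery_nat)
      fix m
      have "filterlim (\<lambda>k. 2 * (m + k) :: nat) at_top sequentially"
        by (rule filterlim_at_top_mono[OF filterlim_ident]) auto
      hence "(\<lambda>k. qpoch (- q) q (2 * (m + k))) \<longlonglongrightarrow> qpoch_inf (- q) q"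
        using filterlim_compose[OF qpoch_LIMSEQ[OF q(1)]] by blast
      moreover have "filterlim (\<lambda>k. 2 * k + 1 :: nat) at_top sequentially"
        by (rule filterlim_at_top_mono[OF filterlim_ident]) auto
      hence "(\<lambda>k. inv_qpoch (q ^ 2) (int (2 * k + 1) + int m)) \<longlonglongrightarrow> inverse (qpoch_inf (q ^ 2) (q ^ 2))"
        using filterlim_compose[OF inv_qpoch_LIMSEQ[OF square_in_disc(1)[OF q]]] by blast
      ultimately show "(\<lambda>k. t k m) \<longlonglongrightarrow> q ^ m * (qpoch_inf (- q) q * inv_qpoch (q ^ 2) (int m) * inverse (qpoch_inf (q ^ 2) (q ^ 2)))"
        unfolding t_def by (intro tendsto_mult tendsto_const) (simp_all only: add.commute)
    next
      fix k m
      have "norm (t k m) \<le> norm q ^ m * M"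
        unfolding t_def norm_mult[of "q ^ m"] norm_power by (intro mult_left_mono M) auto
      thus "norm (t k m) \<le> M * norm q ^ m" by (simp only: mult.commute)
    qed (rule summable_norm_q[OF q])
  qed
  ultimately have "(1 + q) * (\<Sum>n. gauss_term q n 0) = (\<Sum>m. q ^ m * (qpoch_inf (- q) q * inv_qpoch (q ^ 2) (int m) * inverse (qpoch_inf (q ^ 2) (q ^ 2))))"
    by (simp add: LIMSEQ_const_iff)
  also have "\<dots> = (\<Sum>m. L * (q ^ m * inv_qpoch (q ^ 2) (int m)))"
    unfolding L_def by (simp only: mult_ac)
  also have "\<dots> = L * (\<Sum>m. q ^ m * inv_qpoch (q ^ 2) (int m))"
  proof (rule suminf_mult)
    obtain M' where M': "M' > 0" "\<And>n. norm (inv_qpoch (q ^ 2) n) \<le> M'" using inv_qpoch_bounded[OF square_in_disc(1)[OF q]] by blast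
    show "summable (\<lambda>m. q ^ m * inv_qpoch (q ^ 2) (int m))"
    proof (rule summable_comparison_test'[OF summable_norm_q[OF q, of M'], where N = 0])
      fix n
      have "norm (q ^ n * inv_qpoch (q ^ 2) (int n)) \<le> norm q ^ n * M'"
        unfolding norm_mult norm_power by (intro mult_left_mono M') auto
      thus "norm (q ^ n * inv_qpoch (q ^ 2) (int n)) \<le> M' * norm q ^ n" by (simp only: mult.commute)
    qed
  qed
  also have "(\<Sum>m. q ^ m * inv_qpoch (q ^ 2) (int m)) = inverse (qpoch_inf q (q ^ 2))"
    using euler_sum[OF square_in_disc(1)[OF q] q(1)] by (metis inverse_unique mult.commute)
  finally show ?thesis by (simp only: L_def)
qed

text \<open>This rests on Euler's identity (q; q^2)_\<infinity> (-q; q)_\<infinity> = 1. It also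
  shows that the theta series has no zero in the punctured disc.\<close>

lemma theta_mult_gauss_sum_0:
  "theta (-1) 1 0 q * ((1 + q) * (\<Sum>n. gauss_term q n 0)) = 1"
proof -
  have t: "theta (-1) 1 0 q = qpoch_inf q (q ^ 2) ^ 2 * qpoch_inf (q ^ 2) (q ^ 2)"
    using theta_product[OF q, of "-1" 1 0] by (simp add: power2_eq_square)
  have nz: "qpoch_inf q (q ^ 2) \<noteq> 0" "qpoch_inf (q ^ 2) (q ^ 2) \<noteq> 0"
    by (intro qpoch_inf_nonzero' q square_in_disc[OF q])+
  have "qpoch_inf q q * qpoch_inf (- q) q = qpoch_inf (q ^ 2) (q ^ 2)"
    by (rule qpoch_inf_minus[OF q(1)])
  moreover have "qpoch_inf q q = qpoch_inf q (q ^ 2) * qpoch_inf (q ^ 2) (q ^ 2)"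
    using qpoch_inf_split2[OF q(1), of q] by (simp add: power2_eq_square)
  ultimately have "qpoch_inf q (q ^ 2) * qpoch_inf (- q) q = 1" using nz by simp
  thus ?thesis unfolding gauss_sum_0 t using nz
    by (simp add: power2_eq_square field_simps)
qed

lemma norm_bailey_alpha: "norm (bailey_alpha q k) \<le> 2 / (1 - norm q) * norm q ^ k"
proof -
  have "norm (q ^ (2 * k + 1)) \<le> norm q"
    using q power_decreasing[of 1 "2 * k + 1" "norm q"] by (simp add: norm_mult norm_power mult_left_le)
  hence "norm (1 - q ^ (2 * k + 1)) \<ge> 1 - norm q" "norm (1 + q ^ (2 * k + 1)) \<le> 2"
    using norm_triangle_ineq2[of 1 "q ^ (2 * k + 1)"] norm_triangle_ineq[of 1 "q ^ (2 * k + 1)"] q by auto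
  moreover have "norm (q ^ (k ^ 2 + k)) \<le> norm q ^ k"
    using q power_decreasing[of k "k ^ 2 + k" "norm q"] by (simp add: norm_power)
  ultimately have "norm (q ^ (k ^ 2 + k)) * norm (1 + q ^ (2 * k + 1)) / norm (1 - q ^ (2 * k + 1)) \<le> (norm q ^ k * 2) / (1 - norm q)"
    using q by (intro frac_le mult_mono) auto
  thus ?thesis by (simp add: bailey_alpha_def norm_mult norm_divide norm_power mult_ac)
qed

private lemma cancel_regroup:
  "s * g * v / w * (x * K / v) = K * (s * (g * x) / w)" if "v \<noteq> 0" for s g v w x K :: complex
  using that by simp

text \<open>One absolutely convergent double series is summed in both orders. Over k the Bailey pair
  restores the terms of \<open>mock_phi\<close>; over n the q-Gauss sum applies, and its denominator
  1 + q^(2k+1) cancels against the numerator of \<open>bailey_alpha\<close>.\<close>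

lemma mock_phi_eq_sum:
  "theta (-1) 1 0 q * mock_phi q = (\<Sum>\<^sub>\<infinity>k. (-1) ^ k * q ^ ((k + 1) ^ 2) / (1 - q ^ (2 * k + 1)))"
proof -
  define h where "h = (\<lambda>n k. bailey_alpha q k * gauss_term q n k)"
  define K where "K = (1 + q) * (\<Sum>n. gauss_term q n 0)"
  obtain M where M: "M > 0" "\<And>n k. norm (gauss_term q n k) \<le> M * norm q ^ n"
    using gauss_term_norm[OF q] by blast
  define C where "C = 2 / (1 - norm q)"
  have C: "C > 0" using q by (simp add: C_def)
  have geo: "(\<lambda>n::nat. of_real (D * norm q ^ n) :: complex) summable_on UNIV" if "D > 0" for D
    unfolding summable_on_nat_iff using summable_norm_q[OF q, of D] that by (simp add: norm_mult norm_power)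
  have hs: "(\<lambda>(n, k). h n k) summable_on UNIV \<times> UNIV"
  proof -
    have "(\<lambda>p. norm (case p of (n, k) \<Rightarrow> (of_real (M * norm q ^ n) * of_real (C * norm q ^ k) :: complex))) summable_on UNIV"
      using product_summable_on(1)[OF geo[OF M(1)] geo[OF C]] by (simp add: summable_on_iff_abs_summable_on_complex)
    hence "(\<lambda>p. norm (case p of (n, k) \<Rightarrow> h n k)) summable_on UNIV"
    proof (rule Infinite_Sum.abs_summable_on_comparison_test)
      fix p :: "nat \<times> nat"
      obtain n k where p: "p = (n, k)" by (cases p)
      have "norm (h n k) \<le> (C * norm q ^ k) * (M * norm q ^ n)"
        unfolding h_def norm_mult using M C norm_bailey_alpha[of k]
        by (intro mult_mono) (auto simp: C_def)
      also have "\<dots> = norm ((of_real (M * norm q ^ n) * of_real (C * norm q ^ k) :: complex))"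
        using M C by (simp add: norm_mult norm_power mult_ac)
      finally show "norm (case p of (n, k) \<Rightarrow> h n k) \<le> norm (case p of (n, k) \<Rightarrow> (of_real (M * norm q ^ n) * of_real (C * norm q ^ k) :: complex))"
        by (simp only: p prod.case)
    qed
    thus ?thesis by (simp add: summable_on_iff_abs_summable_on_complex)
  qed
  have row: "(\<Sum>\<^sub>\<infinity>k. h n k) = qpoch (- q) q (2 * n) * q ^ n / qpoch q (q ^ 2) (n + 1) ^ 2" for n
  proof -
    have "(\<Sum>\<^sub>\<infinity>k. h n k) = (\<Sum>\<^sub>\<infinity>k\<in>{..n}. h n k)"
      by (intro infsum_cong_neutral) (auto simp: h_def gauss_term_def)
    also have "\<dots> = (\<Sum>k\<le>n. h n k)" by simp
    also have "\<dots> = qpoch (- q) q (2 * n) * q ^ n * (\<Sum>k\<le>n. bailey_alpha q k * inv_qpoch (q ^ 2) (int n - int k) * inv_qpoch (q ^ 2) (int n + int k + 1))"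
      unfolding sum_distrib_left h_def gauss_term_def by (simp only: mult_ac)
    finally show ?thesis unfolding bailey_pair[OF q, symmetric] by simp
  qed
  have "mock_phi q = (\<Sum>n. q * (\<Sum>\<^sub>\<infinity>k. h n k))"
    unfolding mock_phi_def row by (simp add: mult_ac)
  also have "\<dots> = (\<Sum>\<^sub>\<infinity>n. q * (\<Sum>\<^sub>\<infinity>k. h n k))"
    using summable_on_Sigma_banach[OF hs] by (intro infsum_nat_eq_suminf[symmetric] summable_on_cmult_right)
  also have "\<dots> = q * (\<Sum>\<^sub>\<infinity>n. \<Sum>\<^sub>\<infinity>k. h n k)" by (rule infsum_cmult_right')
  also have "(\<Sum>\<^sub>\<infinity>n. \<Sum>\<^sub>\<infinity>k. h n k) = (\<Sum>\<^sub>\<infinity>k. \<Sum>\<^sub>\<infinity>n. h n k)"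
    by (rule infsum_swap_banach[OF hs])
  finally have mp: "mock_phi q = q * (\<Sum>\<^sub>\<infinity>k. \<Sum>\<^sub>\<infinity>n. h n k)" .
  have col: "(\<Sum>\<^sub>\<infinity>n. h n k) = K * ((-1) ^ k * q ^ (k ^ 2 + 2 * k) / (1 - q ^ (2 * k + 1)))" for k
  proof -
    have "(\<Sum>\<^sub>\<infinity>n. h n k) = bailey_alpha q k * (\<Sum>n. gauss_term q n k)"
      unfolding h_def using gauss_term_summable[OF q, of k]
      by (simp add: infsum_cmult_right' infsum_nat_eq_suminf summable_on_nat_iff)
    moreover have "(\<Sum>n. gauss_term q n k) = q ^ k * K / (1 + q ^ (2 * k + 1))"
      using gauss_sum_eq[OF q, of k] one_plus_power_nonzero[OF q(1), of "2 * k + 1"] unfolding K_def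
      by (metis nonzero_mult_div_cancel_left zero_less_Suc Suc_eq_plus1)
    ultimately have "(\<Sum>\<^sub>\<infinity>n. h n k) = bailey_alpha q k * (q ^ k * K / (1 + q ^ (2 * k + 1)))" by simp
    also have "\<dots> = K * ((-1) ^ k * (q ^ (k ^ 2 + k) * q ^ k) / (1 - q ^ (2 * k + 1)))"
      unfolding bailey_alpha_def by (rule cancel_regroup, rule one_plus_power_nonzero[OF q(1)]) simp
    also have "q ^ (k ^ 2 + k) * q ^ k = q ^ (k ^ 2 + 2 * k)"
      by (simp add: power_add[symmetric] mult_2 add.assoc)
    finally show ?thesis .
  qed
  have "mock_phi q = q * (K * (\<Sum>\<^sub>\<infinity>k. (-1) ^ k * q ^ (k ^ 2 + 2 * k) / (1 - q ^ (2 * k + 1))))"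
    unfolding mp col by (simp only: infsum_cmult_right')
  hence "theta (-1) 1 0 q * mock_phi q = (theta (-1) 1 0 q * K) * (q * (\<Sum>\<^sub>\<infinity>k. (-1) ^ k * q ^ (k ^ 2 + 2 * k) / (1 - q ^ (2 * k + 1))))"
    by (simp only: mult_ac)
  also have "\<dots> = (\<Sum>\<^sub>\<infinity>k. q * ((-1) ^ k * q ^ (k ^ 2 + 2 * k) / (1 - q ^ (2 * k + 1))))"
    unfolding K_def theta_mult_gauss_sum_0 by (simp only: infsum_cmult_right' mult_1_left)
  also have "\<dots> = (\<Sum>\<^sub>\<infinity>k. (-1) ^ k * q ^ ((k + 1) ^ 2) / (1 - q ^ (2 * k + 1)))"
  proof (rule infsum_cong)
    fix k :: nat
    have "(k + 1) ^ 2 = Suc (k ^ 2 + 2 * k)" by (simp add: power2_eq_square)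
    hence "q ^ ((k + 1) ^ 2) = q * q ^ (k ^ 2 + 2 * k)" by (simp only: power_Suc)
    thus "q * ((-1) ^ k * q ^ (k ^ 2 + 2 * k) / (1 - q ^ (2 * k + 1))) = (-1) ^ k * q ^ ((k + 1) ^ 2) / (1 - q ^ (2 * k + 1))"
      by (simp only: mult_ac times_divide_eq_right)
  qed
  finally show ?thesis .
qed

end

section \<open>The odd part of the mock theta function\<close>

text \<open>The exponents 4m - 2 are even, and m^2 has the parity of m. So replacing q by -q amounts
  to replacing the sign \<open>s\<close> by \<open>- s\<close>.\<close>

definition appell_sum :: "complex \<Rightarrow> complex \<Rightarrow> complex" where
  "appell_sum s q = (\<Sum>\<^sub>\<infinity>m::int. s powi m * q powi (m ^ 2) / (1 - q powi (4 * m - 2)))"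

text \<open>In the double series for the odd part, this is the sum over v that remains for u = j,
  with q^2 in the place of q.\<close>

definition appell_shifted :: "complex \<Rightarrow> int \<Rightarrow> complex" where
  "appell_shifted q j = (\<Sum>\<^sub>\<infinity>i::int. (-1) powi i * q powi (i ^ 2 + i) / (1 - q powi (2 * (i + j) + 1)))"

text \<open>For negative m the power has norm at least 1 / |q|, and 1 / |q| \<ge> 2 - |q|; so one
  lower bound covers both signs of m. It makes the denominators harmless for absolute
  convergence.\<close>

lemma norm_one_minus_powi:
  assumes q: "norm (q :: complex) < 1" "q \<noteq> 0" and m: "m \<noteq> (0 :: int)"
  shows   "norm (1 - q powi m) \<ge> 1 - norm q" "1 - q powi m \<noteq> 0"
proof -
  have *: "norm q powi n \<le> norm q" if "n > 0" for n :: int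
  proof -
    have "norm q ^ nat n \<le> norm q ^ 1" using q that by (intro power_decreasing) auto
    thus ?thesis using that by (simp add: power_int_def)
  qed
  show "norm (1 - q powi m) \<ge> 1 - norm q"
  proof (cases "m > 0")
    case True
    thus ?thesis
      using norm_triangle_ineq2[of 1 "q powi m"] *[of m] by (simp add: norm_power_int)
  next
    case False
    hence "norm q powi (- m) \<le> norm q" using m by (intro *) auto
    hence "inverse (norm q powi m) \<le> norm q" by (simp only: power_int_minus)
    moreover have "0 < norm q powi m" using q by simp
    ultimately have "inverse (norm q) \<le> norm q powi m"
      using le_imp_inverse_le[of "inverse (norm q powi m)" "norm q"] by simp
    moreover have "inverse (norm q) \<ge> 2 - norm q"
    proof -
      have "(2 - norm q) * norm q \<le> 1" using zero_le_power2[of "1 - norm q"] by (simp add: power2_eq_square algebra_simps)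
      thus ?thesis using q by (simp add: field_simps)
    qed
    ultimately show ?thesis
      using norm_triangle_ineq2[of "q powi m" 1] by (simp add: norm_power_int norm_minus_commute)
  qed
  thus "1 - q powi m \<noteq> 0" using q by auto
qed

lemma appell_sum_term_summable:
  fixes f :: "'a \<Rightarrow> complex" and q :: complex
  assumes q: "norm q < 1" "q \<noteq> 0" and f: "f summable_on UNIV" and m: "\<And>i. m i \<noteq> (0::int)"
  shows   "(\<lambda>i. f i / (1 - q powi (m i))) summable_on UNIV"
proof -
  have "(\<lambda>i. norm (f i * (1 / of_real (1 - norm q)))) summable_on UNIV"
    using summable_on_cmult_left[OF f] by (subst (asm) summable_on_iff_abs_summable_on_complex)
  hence "(\<lambda>i. norm (f i / (1 - q powi (m i)))) summable_on UNIV"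
  proof (rule Infinite_Sum.abs_summable_on_comparison_test)
    fix i
    have "norm (f i) / norm (1 - q powi (m i)) \<le> norm (f i) / (1 - norm q)"
      using norm_one_minus_powi[OF q m] q by (intro divide_left_mono mult_pos_pos) auto
    thus "norm (f i / (1 - q powi (m i))) \<le> norm (f i * (1 / of_real (1 - norm q)))"
      using q by (simp add: norm_divide norm_mult del: of_real_diff)
  qed
  thus ?thesis by (simp add: summable_on_iff_abs_summable_on_complex)
qed

lemma summable_int_nat:
  fixes f :: "int \<Rightarrow> complex"
  assumes "f summable_on UNIV"
  shows "summable (\<lambda>n. norm (f (int n)))" "summable (\<lambda>n. norm (f (- 1 - int n)))"
proof -
  have "f summable_on range int" "f summable_on range (\<lambda>n. - 1 - int n)"
    using assms summable_on_subset_banach by blast+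
  moreover have i: "inj int" "inj (\<lambda>n. - 1 - int n)" by (auto simp: inj_def)
  ultimately have "(f \<circ> int) summable_on UNIV" "(f \<circ> (\<lambda>n. - 1 - int n)) summable_on UNIV"
    by (simp_all add: summable_on_reindex)
  thus "summable (\<lambda>n. norm (f (int n)))" "summable (\<lambda>n. norm (f (- 1 - int n)))"
    by (simp_all add: summable_on_nat_iff o_def)
qed

context
  fixes q :: complex
  assumes q: "norm q < 1" "q \<noteq> 0"
begin

private lemma odd_powi:
  "q powi (2 * int k + 1) = q ^ (2 * k + 1)" "q powi (- (2 * int k + 1)) = inverse (q ^ (2 * k + 1))"
proof -
  have "2 * int k + 1 = int (2 * k + 1)" by simp
  thus "q powi (2 * int k + 1) = q ^ (2 * k + 1)" by (simp only: power_int_of_nat)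
  thus "q powi (- (2 * int k + 1)) = inverse (q ^ (2 * k + 1))" by (simp only: power_int_minus)
qed

text \<open>With w = q^(2k+1), the indices m = k + 1 and m = -k have the denominators 1 - w^2 and 1
  - w^(-2), and their terms add up to one term with denominator 1 - w.\<close>

lemma theta_mult_mock_phi: "theta (-1) 1 0 q * mock_phi q = - appell_sum (-1) q"
proof -
  define g where "g = (\<lambda>m::int. (-1) powi m * q powi (m ^ 2) / (1 - q powi (4 * m - 2)))"
  have gs: "g summable_on UNIV"
    unfolding g_def using theta_summable[OF q, of 1 "-1" 0] by (intro appell_sum_term_summable q) (auto, presburger)
  have "(\<lambda>m. g (m + 1)) summable_on UNIV"
  proof -
    have "bij_betw (\<lambda>m::int. m + 1) UNIV UNIV"
      by (rule bij_betw_byWitness[where f' = "\<lambda>m. m - 1"]) auto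
    thus ?thesis using summable_on_reindex_bij_betw gs by blast
  qed
  note s = summable_int_nat[OF this]
  have "appell_sum (-1) q = (\<Sum>\<^sub>\<infinity>m. g (m + 1))"
    unfolding appell_sum_def g_def[symmetric]
    by (rule infsum_reindex_bij_witness[of _ "\<lambda>m. m + 1" "\<lambda>m. m - 1"]) auto
  also have "\<dots> = (\<Sum>\<^sub>\<infinity>n::nat. g (int n + 1) + g (- 1 - int n + 1))"
    by (rule sum_decode_summable(2)[OF s])
  also have "\<dots> = (\<Sum>\<^sub>\<infinity>k. - ((-1) ^ k * q ^ ((k + 1) ^ 2) / (1 - q ^ (2 * k + 1))))"
  proof (rule infsum_cong)
    fix k :: nat
    define w where "w = q ^ (2 * k + 1)"
    have w: "1 - w \<noteq> 0" "1 + w \<noteq> 0" "w \<noteq> 0"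
      unfolding w_def by (intro one_minus_power_nonzero[OF q(1)] one_plus_power_nonzero[OF q(1)], simp)+ (use q in auto)
    define y where "y = q ^ ((k + 1) ^ 2)"
    have y: "q powi ((int k + 1) ^ 2) = y"
    proof -
      have "(int k + 1) ^ 2 = int ((k + 1) ^ 2)" by simp
      thus ?thesis unfolding y_def by (simp only: power_int_of_nat)
    qed
    have e1: "q powi (4 * (int k + 1) - 2) = w * w"
    proof -
      have "4 * (int k + 1) - 2 = int ((2 * k + 1) + (2 * k + 1))" by simp
      thus ?thesis unfolding w_def by (simp only: power_int_of_nat power_add)
    qed
    have e2: "q powi (4 * (- 1 - int k + 1) - 2) = inverse (w * w)"
    proof -
      have "4 * (- 1 - int k + 1) - 2 = - int ((2 * k + 1) + (2 * k + 1))" by simp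
      thus ?thesis unfolding w_def by (simp only: power_int_minus power_int_of_nat power_add)
    qed
    have e3: "q powi ((- 1 - int k + 1) ^ 2) = y / w"
    proof -
      have "(- 1 - int k + 1) ^ 2 = int ((k + 1) ^ 2) - int (2 * k + 1)" by (simp add: power2_eq_square algebra_simps)
      thus ?thesis unfolding w_def y_def using q by (simp only: power_int_diff power_int_of_nat simp_thms)
    qed
    have s1: "(-1) powi (int k + 1) = - ((-1) ^ k :: complex)" by (simp add: power_int_add power_int_of_nat)
    have s2: "(-1) powi (- 1 - int k + 1) = ((-1) ^ k :: complex)"
      using pm1_powi_minus[of "-1" "int k"] by simp
    define s where "s = ((-1) ^ k :: complex)"
    have "1 - w * w = (1 - w) * (1 + w)" by (simp add: algebra_simps)
    hence "1 - w * w \<noteq> 0" using w by simp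
    hence "- s * y / (1 - w * w) + s * (y / w) / (1 - inverse (w * w)) = - (s * y / (1 - w))"
      using w by (simp add: divide_simps) algebra
    thus "g (int k + 1) + g (- 1 - int k + 1) = - ((-1) ^ k * q ^ ((k + 1) ^ 2) / (1 - q ^ (2 * k + 1)))"
      unfolding g_def e1 e2 e3 s1 s2 y w_def[symmetric] y_def[symmetric] s_def[symmetric] by simp
  qed
  finally have "appell_sum (-1) q = - (\<Sum>\<^sub>\<infinity>k. (-1) ^ k * q ^ ((k + 1) ^ 2) / (1 - q ^ (2 * k + 1)))"
    by (simp only: infsum_uminus)
  thus ?thesis unfolding mock_phi_eq_sum[OF q] by simp
qed

text \<open>After a shift of the index, 1 / (1 - z) = 1 + z / (1 - z) splits off the series
  \<open>c\<close>. It is a theta series that vanishes by symmetry; the rest is the sum for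
  \<open>j\<close>, up to a factor.\<close>

lemma appell_shifted_Suc: "appell_shifted q (j + 1) = - (q powi (2 * j + 1)) * appell_shifted q j"
proof -
  define w where "w = q powi (2 * j + 1)"
  define c where "c = (\<lambda>i::int. (-1) powi i * q powi (i ^ 2 - i) :: complex)"
  have cs: "c summable_on UNIV"
    unfolding c_def using theta_summable[OF q, of 1 "-1" "-1"] by simp
  have ts: "(\<lambda>i::int. (-1) powi i * q powi (i ^ 2 + i) / (1 - q powi (2 * (i + j) + 1))) summable_on UNIV"
    using theta_summable[OF q, of 1 "-1" 1] by (intro appell_sum_term_summable q) (simp_all, presburger)
  have "(\<Sum>\<^sub>\<infinity>i. c i) = theta (-1) 1 (-1) q" by (simp add: c_def theta_def)
  also have "\<dots> = 0" using theta_minus[of "-1" 1 1 q] theta_eq_0[OF q(2), of 1] by simp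
  finally have c0: "(\<Sum>\<^sub>\<infinity>i. c i) = 0" .
  have "appell_shifted q (j + 1) = (\<Sum>\<^sub>\<infinity>i::int. (-1) powi (i - 1) * q powi ((i - 1) ^ 2 + (i - 1)) / (1 - q powi (2 * (i - 1 + (j + 1)) + 1)))"
    unfolding appell_shifted_def
    by (rule infsum_reindex_bij_witness[of _ "\<lambda>m. m - 1" "\<lambda>m. m + 1"]) auto
  also have "\<dots> = (\<Sum>\<^sub>\<infinity>i. (-1) * c i + (- w) * ((-1) powi i * q powi (i ^ 2 + i) / (1 - q powi (2 * (i + j) + 1))) + 0 * c i)"
  proof (rule infsum_cong)
    fix i :: int
    define x where "x = q powi (2 * i)"
    have x: "x \<noteq> 0" using q by (simp add: x_def)
    have e: "(i - 1) ^ 2 + (i - 1) = i ^ 2 - i" by (simp add: power2_eq_square algebra_simps)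
    have "i ^ 2 + i = (i ^ 2 - i) + 2 * i" by simp
    hence f: "q powi (i ^ 2 + i) = q powi (i ^ 2 - i) * x" unfolding x_def using q by (simp only: power_int_add simp_thms)
    have d: "q powi (2 * (i + j) + 1) = x * w"
    proof -
      have "2 * (i + j) + 1 = 2 * i + (2 * j + 1)" by simp
      thus ?thesis unfolding x_def w_def using q by (simp only: power_int_add simp_thms)
    qed
    have d': "q powi (2 * (i - 1 + (j + 1)) + 1) = x * w" using d by simp
    have n: "1 - x * w \<noteq> 0"
      unfolding d[symmetric] by (rule norm_one_minus_powi[OF q]) presburger
    have s: "(-1) powi (i - 1) = - ((-1) powi i :: complex)" by (simp add: power_int_diff)
    define t where "t = q powi (i ^ 2 - i)"
    define u where "u = ((-1) powi i :: complex)"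
    show "(-1) powi (i - 1) * q powi ((i - 1) ^ 2 + (i - 1)) / (1 - q powi (2 * (i - 1 + (j + 1)) + 1)) =
       (-1) * c i + (- w) * ((-1) powi i * q powi (i ^ 2 + i) / (1 - q powi (2 * (i + j) + 1))) + 0 * c i"
      unfolding c_def e d d' f s t_def[symmetric] u_def[symmetric] using n by (simp add: field_simps)
  qed
  also have "\<dots> = (-1) * (\<Sum>\<^sub>\<infinity>i. c i) + (- w) * appell_shifted q j + 0 * (\<Sum>\<^sub>\<infinity>i. c i)"
    unfolding appell_shifted_def by (rule infsum_lincomb3[symmetric]) (intro cs ts)+
  finally show ?thesis by (simp add: c0 w_def)
qed

lemma appell_shifted_eq: "appell_shifted q j = (-1) powi j * q powi (j ^ 2) * appell_shifted q 0"
proof (induction j rule: int_induct[where k = 0])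
  case (step1 i)
  have "(i + 1) ^ 2 = (2 * i + 1) + i ^ 2" by (simp add: power2_eq_square algebra_simps)
  hence "q powi ((i + 1) ^ 2) = q powi (2 * i + 1) * q powi (i ^ 2)" using q by (simp only: power_int_add simp_thms)
  moreover have "(-1) powi (i + 1) = - ((-1) powi i :: complex)" by (simp add: power_int_add)
  ultimately show ?case using step1(2) unfolding appell_shifted_Suc[of i] by simp
next
  case (step2 i)
  define A where "A = q powi (2 * (i - 1) + 1)"
  have A: "A \<noteq> 0" using q by (simp add: A_def)
  have "i ^ 2 = (2 * (i - 1) + 1) + (i - 1) ^ 2" by (simp add: power2_eq_square algebra_simps)
  hence e: "q powi (i ^ 2) = A * q powi ((i - 1) ^ 2)"
    unfolding A_def using q by (simp only: power_int_add simp_thms)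
  have s: "(-1) powi i = - ((-1) powi (i - 1) :: complex)" by (simp add: power_int_diff)
  have "i - 1 + 1 = i" by simp
  hence "appell_shifted q i = - A * appell_shifted q (i - 1)"
    using appell_shifted_Suc[of "i - 1"] by (simp only: A_def)
  thus ?case using step2(2) A unfolding e s by (simp add: mult.assoc)
qed simp

text \<open>Pairing i with -1 - i yields the terms \<open>bailey_alpha\<close>. Their sum is found
  by letting n tend to infinity in the Bailey pair relation.\<close>

lemma appell_shifted_0: "appell_shifted q 0 = (qpoch_inf (q ^ 2) (q ^ 2) / qpoch_inf q (q ^ 2)) ^ 2"
proof -
  define Q where "Q = q ^ 2"
  have Q: "norm Q < 1" unfolding Q_def using q by (intro norm_power_less_1) auto
  define P where "P = qpoch_inf Q Q"
  have nz: "P \<noteq> 0" "qpoch_inf q Q \<noteq> 0" unfolding P_def by (intro qpoch_inf_nonzero' q Q)+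
  define g where "g = (\<lambda>i::int. (-1) powi i * q powi (i ^ 2 + i) / (1 - q powi (2 * i + 1)))"
  have gs: "g summable_on UNIV"
    unfolding g_def using theta_summable[OF q, of 1 "-1" 1] by (intro appell_sum_term_summable q) (simp_all, presburger)
  have "appell_shifted q 0 = (\<Sum>\<^sub>\<infinity>i. g i)" by (simp add: appell_shifted_def g_def)
  also have "\<dots> = (\<Sum>\<^sub>\<infinity>k::nat. g (int k) + g (- 1 - int k))"
    by (rule sum_decode_summable(2)[OF summable_int_nat[OF gs]])
  also have "\<dots> = (\<Sum>\<^sub>\<infinity>k. bailey_alpha q k)"
  proof (rule infsum_cong)
    fix k :: nat
    define w where "w = q ^ (2 * k + 1)"
    have w: "1 - w \<noteq> 0" "w \<noteq> 0"
      unfolding w_def by (intro one_minus_power_nonzero[OF q(1)], simp) (use q in auto)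
    have p: "q powi (int k ^ 2 + int k) = q ^ (k ^ 2 + k)"
      by (metis of_nat_add of_nat_power power_int_of_nat)
    have e: "(- 1 - int k) ^ 2 + (- 1 - int k) = int k ^ 2 + int k" "2 * (- 1 - int k) + 1 = - (2 * int k + 1)"
      by (simp_all add: power2_eq_square algebra_simps)
    have s: "(-1) powi (- 1 - int k) = - ((-1) ^ k :: complex)"
    proof -
      have "- 1 - int k = - int (Suc k)" by simp
      thus ?thesis using pm1_powi_minus[of "-1" "int (Suc k)"]
        by (simp only: power_int_of_nat power_Suc) simp
    qed
    define s where "s = ((-1) ^ k * q ^ (k ^ 2 + k))"
    have "g (int k) + g (- 1 - int k) = s / (1 - w) - s / (1 - inverse w)"
      unfolding g_def e odd_powi p s w_def[symmetric] s_def by (simp add: power_int_of_nat)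
    also have "\<dots> = s * (1 + w) / (1 - w)" using w by (simp add: divide_simps) algebra
    finally show "g (int k) + g (- 1 - int k) = bailey_alpha q k"
      unfolding bailey_alpha_def s_def w_def .
  qed
  also have "\<dots> = (\<Sum>k. bailey_alpha q k)"
  proof (rule infsum_nat_eq_suminf)
    show "bailey_alpha q summable_on UNIV"
      unfolding summable_on_nat_iff
      by (rule summable_comparison_test'[OF summable_norm_q[OF q, of "2 / (1 - norm q)"], where N = 0])
         (simp only: real_norm_def abs_norm_cancel norm_bailey_alpha[OF q])
  qed
  finally have A: "appell_shifted q 0 = (\<Sum>k. bailey_alpha q k)" .
  obtain M where M: "M > 0" "\<And>n. norm (inv_qpoch Q n) \<le> M" using inv_qpoch_bounded[OF Q] by blast
  have "(\<lambda>n. \<Sum>k. bailey_alpha q k * inv_qpoch Q (int n - int k) * inv_qpoch Q (int n + int k + 1)) \<longlonglongrightarrow> (\<Sum>k. bailey_alpha q k * inverse P * inverse P)"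
  proof (rule tannery_nat)
    fix k
    have "(\<lambda>n. inv_qpoch Q (int n - int k)) \<longlonglongrightarrow> inverse P" "(\<lambda>n. inv_qpoch Q (int n + int k + 1)) \<longlonglongrightarrow> inverse P"
      using inv_qpoch_LIMSEQ[OF Q, of "- int k"] inv_qpoch_LIMSEQ[OF Q, of "int k + 1"] by (simp_all add: P_def add.assoc)
    thus "(\<lambda>n. bailey_alpha q k * inv_qpoch Q (int n - int k) * inv_qpoch Q (int n + int k + 1)) \<longlonglongrightarrow> bailey_alpha q k * inverse P * inverse P"
      by (intro tendsto_mult tendsto_const)
  next
    fix n k
    have "norm (bailey_alpha q k * inv_qpoch Q (int n - int k) * inv_qpoch Q (int n + int k + 1)) \<le> (2 / (1 - norm q) * norm q ^ k) * M * M"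
      unfolding norm_mult using q M by (intro mult_mono norm_bailey_alpha[OF q] mult_nonneg_nonneg) (auto intro: less_imp_le)
    also have "\<dots> = (2 / (1 - norm q) * M * M) * norm q ^ k" by (simp only: mult_ac)
    finally show "norm (bailey_alpha q k * inv_qpoch Q (int n - int k) * inv_qpoch Q (int n + int k + 1)) \<le> (2 / (1 - norm q) * M * M) * norm q ^ k" .
  qed (rule summable_norm_q[OF q])
  moreover have "(\<Sum>k. bailey_alpha q k * inv_qpoch Q (int n - int k) * inv_qpoch Q (int n + int k + 1)) = 1 / (qpoch q Q (n + 1)) ^ 2" for n
  proof -
    have "(\<Sum>k. bailey_alpha q k * inv_qpoch Q (int n - int k) * inv_qpoch Q (int n + int k + 1)) =
          (\<Sum>k\<le>n. bailey_alpha q k * inv_qpoch Q (int n - int k) * inv_qpoch Q (int n + int k + 1))"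
      by (rule suminf_finite) auto
    thus ?thesis unfolding Q_def bailey_pair[OF q] .
  qed
  ultimately have "(\<lambda>n. 1 / (qpoch q Q (n + 1)) ^ 2) \<longlonglongrightarrow> (\<Sum>k. bailey_alpha q k * inverse P * inverse P)"
    by simp
  moreover have "(\<lambda>n. 1 / (qpoch q Q (n + 1)) ^ 2) \<longlonglongrightarrow> 1 / (qpoch_inf q Q) ^ 2"
    by (intro tendsto_intros LIMSEQ_ignore_initial_segment[OF qpoch_LIMSEQ[OF Q]]) (use nz in auto)
  ultimately have "(\<Sum>k. bailey_alpha q k * inverse P * inverse P) = 1 / (qpoch_inf q Q) ^ 2"
    using LIMSEQ_unique by blast
  moreover have "(\<Sum>k. bailey_alpha q k * inverse P * inverse P) = (\<Sum>k. bailey_alpha q k) * inverse P * inverse P"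
    using suminf_mult2[of "bailey_alpha q" "inverse P * inverse P"]
      summable_comparison_test'[OF summable_norm_q[OF q, of "2 / (1 - norm q)"], where N = 0, OF norm_bailey_alpha[OF q]]
    by (simp only: mult.assoc)
  ultimately have "(\<Sum>k. bailey_alpha q k) * inverse P * inverse P = 1 / (qpoch_inf q Q) ^ 2"
    by (simp only:)
  hence "(\<Sum>k. bailey_alpha q k) = P ^ 2 / (qpoch_inf q Q) ^ 2"
    using nz by (simp add: power2_eq_square field_simps)
  thus ?thesis unfolding A Q_def[symmetric] P_def[symmetric] power_divide .
qed

end

section \<open>The substitution of -q for q and the double series for the odd part\<close>

lemma minus_one_powi_square: "(-1) powi (n ^ 2) = ((-1) powi n :: complex)"
proof -
  have "even (n ^ 2 - n)" by simp
  then obtain k where "n ^ 2 - n = 2 * k" by (rule evenE)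
  hence "n ^ 2 = n + 2 * k" by simp
  thus ?thesis by (simp add: power_int_add power_int_mult)
qed

lemma minus_powi_square: "(- q) powi (n ^ 2) = (-1) powi n * (q :: complex) powi (n ^ 2)"
  using power_int_mult_distrib[of "-1" q "n ^ 2"] by (simp add: minus_one_powi_square)

lemma theta_uminus: "theta (-1) 1 0 (- q) = theta 1 1 0 q"
  unfolding theta_def by (simp add: minus_powi_square mult.assoc[symmetric] power_int_mult_distrib[symmetric])

lemma appell_sum_uminus: "appell_sum (-1) (- q) = appell_sum 1 q"
proof -
  have "(- q) powi (4 * m - 2) = q powi (4 * m - 2)" for m
  proof -
    have "even (4 * m - 2)" by simp
    thus ?thesis by (simp add: power_int_minus_left)
  qed
  thus ?thesis
    unfolding appell_sum_def by (simp add: minus_powi_square mult.assoc[symmetric] power_int_mult_distrib[symmetric])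
qed

lemma psi_product:
  assumes q: "norm q < 1" "q \<noteq> 0"
  shows   "theta 1 2 1 q * qpoch_inf q (q ^ 2) = qpoch_inf (q ^ 2) (q ^ 2)"
proof -
  have q2: "norm (q ^ 2) < 1" using q by (intro norm_power_less_1) auto
  have "theta 1 2 1 q = qpoch_inf (- (q ^ 3)) (q ^ 4) * qpoch_inf (- q) (q ^ 4) * qpoch_inf (q ^ 4) (q ^ 4)"
    using theta_product[OF q, of 1 2 1] by simp
  also have "qpoch_inf (- (q ^ 3)) (q ^ 4) * qpoch_inf (- q) (q ^ 4) = qpoch_inf (- q) (q ^ 2)"
    using qpoch_inf_split2[OF q2, of "- q"] by (simp add: power_mult[symmetric] eval_nat_numeral mult_ac)
  finally have t: "theta 1 2 1 q = qpoch_inf (- q) (q ^ 2) * qpoch_inf (q ^ 4) (q ^ 4)" .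
  have a: "qpoch_inf q (q ^ 2) * qpoch_inf (- q) (q ^ 2) = qpoch_inf (q ^ 2) (q ^ 4)"
    using qpoch_inf_minus[OF q2, of q] by (simp add: power_mult[symmetric])
  have b: "qpoch_inf (q ^ 2) (q ^ 2) = qpoch_inf (q ^ 2) (q ^ 4) * qpoch_inf (q ^ 4) (q ^ 4)"
    using qpoch_inf_split2[OF q2, of "q ^ 2"] by (simp add: power_mult[symmetric] power_add[symmetric])
  show ?thesis unfolding t b a[symmetric] by (simp only: mult_ac)
qed

text \<open>The two products carry the signs (-1)^m and (-1)^n, which cancel for even m + n and
  reinforce each other for odd m + n. On the odd class the denominator depends only on u + v, so for
  fixed u the sum over v is an \<open>appell_shifted\<close>.\<close>

lemma appell_sum_theta:
  assumes q: "norm q < 1" "q \<noteq> 0"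
  shows "appell_sum (-1) q * theta 1 1 0 q - appell_sum 1 q * theta (-1) 1 0 q =
         - 2 * q * theta 1 2 1 (q ^ 2) * appell_shifted (q ^ 2) 0"
proof -
  define Q where "Q = q ^ 2"
  have Q: "norm Q < 1" "Q \<noteq> 0" using q by (auto simp: Q_def intro: norm_power_less_1)
  define a where "a = (\<lambda>s m. s powi m * q powi (m ^ 2) / (1 - q powi (4 * m - 2)))"
  define b where "b = (\<lambda>s n::int. s powi n * q powi (n ^ 2))"
  have bs: "b s summable_on UNIV" if "s \<noteq> 0" for s
    unfolding b_def using theta_summable[OF q, of 1 s 0] that by simp
  have as: "a s summable_on UNIV" if "s \<noteq> 0" for s
    unfolding a_def using theta_summable[OF q, of 1 s 0] that by (intro appell_sum_term_summable q) (simp_all, presburger)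
  define F where "F = (\<lambda>p. (case p of (m, n) \<Rightarrow> a (-1) m * b 1 n) - (case p of (m, n) \<Rightarrow> a 1 m * b (-1) n))"
  have s1: "(\<lambda>(m, n). a (-1) m * b 1 n) summable_on UNIV" "(\<lambda>(m, n). a 1 m * b (-1) n) summable_on UNIV"
    by (intro product_summable_on(1) as bs; simp)+
  have F: "F summable_on UNIV" unfolding F_def
    using summable_on_add[OF s1(1) summable_on_uminus[THEN iffD2, OF s1(2)]] by simp
  have e: "infsum (a s) UNIV = appell_sum s q" "infsum (b s) UNIV = theta s 1 0 q" for s
    by (simp_all add: a_def b_def appell_sum_def theta_def)
  have pt: "F (u + v + 1, u - v) = (- 2 * q * ((-1) powi u * Q powi (u ^ 2 + u))) * ((-1) powi v * Q powi (v ^ 2 + v) / (1 - Q powi (2 * (v + u) + 1)))" for u v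
  proof -
    define x where "x = ((-1) powi u * (-1) powi v :: complex)"
    have x: "(-1) powi (u + v + 1) = - x" "(-1) powi (u - v) = x"
      using pm1_powi_minus[of "-1" v] power_int_add[of "-1 :: complex" u "- v"] by (simp_all add: x_def power_int_add)
    have "(u + v + 1) ^ 2 + (u - v) ^ 2 = 1 + 2 * (u ^ 2 + u) + 2 * (v ^ 2 + v)"
      by (simp add: power2_eq_square algebra_simps)
    hence y: "q powi ((u + v + 1) ^ 2) * q powi ((u - v) ^ 2) = q * Q powi (u ^ 2 + u) * Q powi (v ^ 2 + v)"
      unfolding Q_def power_powi using q
      by (simp only: power_int_add[symmetric] simp_thms of_nat_numeral) (simp only: power_int_add power_int_1_right simp_thms)
    have z: "q powi (4 * (u + v + 1) - 2) = Q powi (2 * (v + u) + 1)"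
      unfolding Q_def power_powi by (simp add: algebra_simps)
    have "F (u + v + 1, u - v) = - 2 * x * (q powi ((u + v + 1) ^ 2) * q powi ((u - v) ^ 2)) / (1 - Q powi (2 * (v + u) + 1))"
      unfolding F_def a_def b_def prod.case x z by (simp add: diff_divide_distrib[symmetric] add_divide_distrib[symmetric])
    also have "\<dots> = (- 2 * q * ((-1) powi u * Q powi (u ^ 2 + u))) * ((-1) powi v * Q powi (v ^ 2 + v) / (1 - Q powi (2 * (v + u) + 1)))"
      unfolding y x_def by simp
    finally show "F (u + v + 1, u - v) = (- 2 * q * ((-1) powi u * Q powi (u ^ 2 + u))) * ((-1) powi v * Q powi (v ^ 2 + v) / (1 - Q powi (2 * (v + u) + 1)))" .
  qed
  have "appell_sum (-1) q * theta 1 1 0 q - appell_sum 1 q * theta (-1) 1 0 q = infsum F UNIV"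
  proof -
    have "infsum F UNIV = (\<Sum>\<^sub>\<infinity>(m, n). a (-1) m * b 1 n) + (\<Sum>\<^sub>\<infinity>p. - (case p of (m, n) \<Rightarrow> a 1 m * b (-1) n))"
      unfolding F_def diff_conv_add_uminus using s1 by (intro infsum_add) (simp_all add: summable_on_uminus)
    also have "(\<Sum>\<^sub>\<infinity>(m, n). a (-1) m * b 1 n) = appell_sum (-1) q * theta 1 1 0 q"
      using product_summable_on(2)[OF as bs, of "-1" 1] by (simp add: e)
    also have "(\<Sum>\<^sub>\<infinity>p. - (case p of (m, n) \<Rightarrow> a 1 m * b (-1) n)) = - (appell_sum 1 q * theta (-1) 1 0 q)"
      using product_summable_on(2)[OF as bs, of 1 "-1"] by (simp add: e infsum_uminus)
    finally show ?thesis by simp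
  qed
  also have "infsum F UNIV = (\<Sum>c\<in>{0, 1}. \<Sum>\<^sub>\<infinity>p. F ((\<lambda>(u, v). (u + v + c, u - v)) p))"
    by (rule infsum_partition(1)[OF _ bij_lattice2 F]) simp
  also have "\<dots> = (\<Sum>\<^sub>\<infinity>(u, v). F (u + v, u - v)) + (\<Sum>\<^sub>\<infinity>(u, v). F (u + v + 1, u - v))"
    by (simp add: case_prod_unfold)
  also have "(\<Sum>\<^sub>\<infinity>(u, v). F (u + v, u - v)) = 0"
  proof (rule infsum_0, clarify)
    fix u v :: int
    have "(-1) powi (u + v) = ((-1) powi (u - v) :: complex)"
      using pm1_powi_minus[of "-1" v] power_int_add[of "-1 :: complex" u v] power_int_add[of "-1 :: complex" u "- v"] by simp
    thus "F (u + v, u - v) = 0" by (simp add: F_def a_def b_def)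
  qed
  also have "(\<Sum>\<^sub>\<infinity>(u, v). F (u + v + 1, u - v)) =
      (\<Sum>\<^sub>\<infinity>(u, v). (- 2 * q * ((-1) powi u * Q powi (u ^ 2 + u))) * ((-1) powi v * Q powi (v ^ 2 + v) / (1 - Q powi (2 * (v + u) + 1))))"
    unfolding pt ..
  also have "\<dots> = (\<Sum>\<^sub>\<infinity>u. \<Sum>\<^sub>\<infinity>v. (- 2 * q * ((-1) powi u * Q powi (u ^ 2 + u))) * ((-1) powi v * Q powi (v ^ 2 + v) / (1 - Q powi (2 * (v + u) + 1))))"
  proof -
    have "(\<lambda>p. F ((\<lambda>(u, v). (u + v + 1, u - v)) p)) summable_on UNIV"
      by (rule infsum_partition(2)[OF _ bij_lattice2 F]) simp_all
    also have "(\<lambda>p. F ((\<lambda>(u, v). (u + v + 1, u - v)) p)) = (\<lambda>(u, v). (- 2 * q * ((-1) powi u * Q powi (u ^ 2 + u))) * ((-1) powi v * Q powi (v ^ 2 + v) / (1 - Q powi (2 * (v + u) + 1))))"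
      by (simp only: fun_eq_iff split_paired_All prod.case pt simp_thms)
    finally have "(\<lambda>(u, v). (- 2 * q * ((-1) powi u * Q powi (u ^ 2 + u))) * ((-1) powi v * Q powi (v ^ 2 + v) / (1 - Q powi (2 * (v + u) + 1)))) summable_on UNIV \<times> UNIV"
      by simp
    from infsum_Sigma'_banach[OF this] show ?thesis by simp
  qed
  also have "\<dots> = (\<Sum>\<^sub>\<infinity>u. - 2 * q * appell_shifted Q 0 * (1 powi u * Q powi (2 * u ^ 2 + 1 * u)))"
  proof (rule infsum_cong)
    fix u :: int
    have "(\<Sum>\<^sub>\<infinity>v. (- 2 * q * ((-1) powi u * Q powi (u ^ 2 + u))) * ((-1) powi v * Q powi (v ^ 2 + v) / (1 - Q powi (2 * (v + u) + 1))))
        = (- 2 * q * ((-1) powi u * Q powi (u ^ 2 + u))) * appell_shifted Q u"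
      unfolding appell_shifted_def by (rule infsum_cmult_right')
    \<comment> \<open>The sign and the power Q^(u^2) from the shift formula combine with the outer
      factor: the signs cancel, and the exponent 2 u^2 + u is that of \<psi>(Q).\<close>
    also have "\<dots> = - 2 * q * ((-1) powi u * (-1) powi u) * (Q powi (u ^ 2 + u) * Q powi (u ^ 2)) * appell_shifted Q 0"
      unfolding appell_shifted_eq[OF Q, of u] by (simp only: mult_ac)
    also have "(-1) powi u * (-1) powi u = (1 :: complex)"
      by (simp add: power_int_mult_distrib[symmetric])
    also have "Q powi (u ^ 2 + u) * Q powi (u ^ 2) = Q powi (2 * u ^ 2 + 1 * u)"
      using Q by (simp add: power_int_add[symmetric] algebra_simps)
    finally show "(\<Sum>\<^sub>\<infinity>v. (- 2 * q * ((-1) powi u * Q powi (u ^ 2 + u))) * ((-1) powi v * Q powi (v ^ 2 + v) / (1 - Q powi (2 * (v + u) + 1))))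
       = - 2 * q * appell_shifted Q 0 * (1 powi u * Q powi (2 * u ^ 2 + 1 * u))" by simp
  qed
  also have "\<dots> = - 2 * q * appell_shifted Q 0 * theta 1 2 1 Q"
    unfolding theta_def by (rule infsum_cmult_right')
  finally show ?thesis by (simp add: Q_def mult_ac)
qed

lemma theta_nonzero:
  assumes q: "norm q < 1" "q \<noteq> 0"
  shows "theta (-1) 1 0 q \<noteq> 0"
  using theta_mult_gauss_sum_0[OF q] by auto

text \<open>The common denominator is \<theta>(q) \<theta>(-q) = \<theta>(q^2)^2. One factor
  \<psi>(q^2) comes from the outer sum over u and two from the value of the inner sum.\<close>

theorem mock_phi_odd_part:
  assumes q: "norm q < 1" "q \<noteq> 0"
  shows "mock_phi q - mock_phi (- q) = 2 * q * theta 1 2 1 (q ^ 2) ^ 3 / theta (-1) 1 0 (q ^ 2) ^ 2"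
proof -
  define Q where "Q = q ^ 2"
  have Q: "norm Q < 1" "Q \<noteq> 0" using q by (auto simp: Q_def intro: norm_power_less_1)
  have q': "norm (- q) < 1" "- q \<noteq> 0" using q by auto
  have nz: "theta (-1) 1 0 q \<noteq> 0" "theta 1 1 0 q \<noteq> 0"
    using theta_nonzero[OF q] theta_nonzero[OF q'] by (simp_all add: theta_uminus)
  have "theta 1 1 0 q * theta (-1) 1 0 q = theta (-1) 1 0 Q ^ 2"
    using theta_mult[OF q, of 1 "-1" 1 0 0] theta_eq_0[OF q(2), of 2] theta_power[of "-1" 1 0 q 2]
    by (simp add: Q_def power2_eq_square)
  moreover have "appell_shifted Q 0 = theta 1 2 1 Q ^ 2"
  proof -
    have "norm (Q ^ 2) < 1" using Q by (intro norm_power_less_1) auto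
    hence "qpoch_inf Q (Q ^ 2) \<noteq> 0" using Q by (intro qpoch_inf_nonzero')
    thus ?thesis unfolding appell_shifted_0[OF Q] psi_product[OF Q, symmetric] by simp
  qed
  moreover have "mock_phi q = - appell_sum (-1) q / theta (-1) 1 0 q"
    using theta_mult_mock_phi[OF q] nz by (simp add: field_simps)
  moreover have "mock_phi (- q) = - appell_sum 1 q / theta 1 1 0 q"
    using theta_mult_mock_phi[OF q'] nz by (simp add: field_simps theta_uminus appell_sum_uminus)
  moreover have "- appell_sum (-1) q / theta (-1) 1 0 q - (- appell_sum 1 q / theta 1 1 0 q) =
      - (appell_sum (-1) q * theta 1 1 0 q - appell_sum 1 q * theta (-1) 1 0 q) / (theta 1 1 0 q * theta (-1) 1 0 q)"
    using nz by (simp add: field_simps)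
  ultimately have "mock_phi q - mock_phi (- q) = - (- 2 * q * theta 1 2 1 Q * theta 1 2 1 Q ^ 2) / theta (-1) 1 0 Q ^ 2"
    unfolding appell_sum_theta[OF q] Q_def by simp
  thus ?thesis unfolding Q_def by (simp add: power2_eq_square power3_eq_cube mult_ac)
qed

section \<open>Theta functions of level 10\<close>

lemma bij_halves: "bij_betw (\<lambda>(c, n). if c = 0 then 2 * n else - 2 * n - 1) ({0, 1 :: nat} \<times> UNIV) (UNIV :: int set)"
proof (rule bij_betw_byWitness[where f' = "\<lambda>n. if even n then (0, n div 2) else (1, (- 1 - n) div 2)"])
  show "\<forall>a'\<in>UNIV. (case if even a' then (0, a' div 2) else (1, (- 1 - a') div 2) of (c, n) \<Rightarrow> if c = (0::nat) then 2 * n else - 2 * n - 1) = (a' :: int)"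
    by auto
qed auto

text \<open>The map n -> -1 - n preserves n (n + 1) and exchanges even and odd n, so both parities
  contribute the same series. \<psi> is dissected and squared in the doubled form on the left, where
  each component is a single theta series.\<close>

lemma theta_halves:
  assumes r: "norm r < 1" "r \<noteq> 0" and a: "a > 0"
  shows   "theta 1 a a r = 2 * theta 1 (4 * a) (2 * a) r"
proof -
  have "theta 1 a a r = (\<Sum>c\<in>{0, 1::nat}. \<Sum>\<^sub>\<infinity>n::int. (\<lambda>n. 1 powi n * r powi (a * n ^ 2 + a * n)) (if c = 0 then 2 * n else - 2 * n - 1))"
    unfolding theta_def
    by (rule infsum_partition(1)[OF _ bij_halves]) (use theta_summable[OF r a, of 1] in auto)
  also have "\<dots> = (\<Sum>c\<in>{0, 1::nat}. theta 1 (4 * a) (2 * a) r)"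
    unfolding theta_def
  proof (intro sum.cong infsum_cong)
    fix c n assume "c \<in> {0, 1 :: nat}"
    have e: "a * (2 * n) ^ 2 + a * (2 * n) = 4 * a * n ^ 2 + 2 * a * n"
         "a * (- 2 * n - 1) ^ 2 + a * (- 2 * n - 1) = 4 * a * n ^ 2 + 2 * a * n" for n :: int
      by (simp_all add: power2_eq_square algebra_simps)
    show "1 powi (if c = 0 then 2 * n else - 2 * n - 1) * r powi (a * (if c = 0 then 2 * n else - 2 * n - 1) ^ 2 + a * (if c = 0 then 2 * n else - 2 * n - 1)) =
          1 powi n * r powi (4 * a * n ^ 2 + 2 * a * n)"
      by (cases "c = 0") (simp_all only: e if_True if_False simp_thms power_int_1_left)
  qed auto
  finally show ?thesis by simp
qed

text \<open>In the doubled form the residues c and -1 - c modulo 5 belong together. The residue 2 is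
  its own partner; its series is doubled itself and is halved once more.\<close>

lemma psi_dissect5:
  assumes w: "norm w < 1" "w \<noteq> 0"
  shows "theta 1 4 2 w = theta 1 5 1 (w ^ 5) + w ^ 2 * theta 1 5 3 (w ^ 5) + w ^ 6 * theta 1 20 10 (w ^ 5)"
proof -
  have "norm (w ^ 5) < 1" "w ^ 5 \<noteq> 0" using w by (auto intro!: norm_power_less_1)
  hence "theta 1 5 5 (w ^ 5) = 2 * theta 1 20 10 (w ^ 5)"
    using theta_halves[of "w ^ 5" 5] by simp
  moreover have "2 * theta 1 4 2 w = theta 1 1 1 w" using theta_halves[OF w, of 1] by simp
  moreover have "theta 1 1 1 w = w ^ 2 * theta 1 5 (-3) (w ^ 5) + theta 1 5 (-1) (w ^ 5) + theta 1 5 1 (w ^ 5) + w ^ 2 * theta 1 5 3 (w ^ 5) + w ^ 6 * theta 1 5 5 (w ^ 5)"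
    using theta_dissect5[OF w, of 1 1 1] by (simp add: add_ac)
  ultimately have "2 * theta 1 4 2 w = 2 * (theta 1 5 1 (w ^ 5) + w ^ 2 * theta 1 5 3 (w ^ 5) + w ^ 6 * theta 1 20 10 (w ^ 5))"
    using theta_minus[of 1 5 1 "w ^ 5"] theta_minus[of 1 5 3 "w ^ 5"] by (simp add: algebra_simps)
  thus ?thesis by (simp only: mult_cancel_left) simp
qed

lemma theta4_dissect5:
  assumes w: "norm w < 1" "w \<noteq> 0"
  shows "theta (-1) 2 0 w = theta (-1) 10 0 (w ^ 5) - 2 * w ^ 2 * theta (-1) 10 4 (w ^ 5) + 2 * w ^ 8 * theta (-1) 10 8 (w ^ 5)"
  using theta_dissect5[OF w, of "-1" 2 0] theta_minus[of "-1" 10 4 "w ^ 5"] theta_minus[of "-1" 10 8 "w ^ 5"]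
  by (simp add: power_int_minus)

text \<open>With q = r^2 and Ramanujan's f(a, b), this is \<psi>(q)^2 = f(q^2, q^3) f(q, q^4) + q
  \<psi>(q^5)^2. It later makes h + 1 an eta quotient.\<close>

lemma psi_square:
  assumes r: "norm r < 1" "r \<noteq> 0"
  shows "theta 1 4 2 r ^ 2 = theta 1 5 1 r * theta 1 5 3 r + r ^ 2 * theta 1 20 10 r ^ 2"
proof -
  have h: "theta 1 1 1 r = 2 * theta 1 4 2 r" "theta 1 5 5 r = 2 * theta 1 20 10 r"
    using theta_halves[OF r, of 1] theta_halves[OF r, of 5] by simp_all
  have m: "theta 1 5 (-1) r = theta 1 5 1 r" "theta 1 5 (-3) r = theta 1 5 3 r" "theta 1 5 (-5) r = theta 1 5 5 r"
    using theta_minus[of 1 5 1 r] theta_minus[of 1 5 3 r] theta_minus[of 1 5 5 r] by simp_all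
  have s: "r ^ 2 * theta 1 5 7 r = theta 1 5 3 r" "r ^ 6 * theta 1 5 11 r = theta 1 5 1 r"
    using theta_shift[OF r(2), of 1 5 "-3"] theta_shift[OF r(2), of 1 5 1] m by simp_all
  have "theta 1 1 1 r ^ 2 = r ^ 2 * (theta 1 5 (-5) r * theta 1 5 (-5) r) + theta 1 5 (-1) r * theta 1 5 (-3) r
     + theta 1 5 3 r * theta 1 5 (-1) r + (r ^ 2 * theta 1 5 7 r) * theta 1 5 1 r + (r ^ 6 * theta 1 5 11 r) * theta 1 5 3 r"
    using theta_square5[OF r, of 1 1 1] by (simp add: add_ac mult.assoc)
  hence "4 * theta 1 4 2 r ^ 2 = 4 * (theta 1 5 1 r * theta 1 5 3 r + r ^ 2 * theta 1 20 10 r ^ 2)"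
    unfolding h m s by (simp add: power2_eq_square algebra_simps)
  thus ?thesis by (simp only: mult_cancel_left) simp
qed

text \<open>The companion of \<open>psi_square\<close> for \<theta>, which makes 1 - 4 / h an eta
  quotient. The shift brings the linear coefficient 16 back to 4, so that only j_1 j_3 appears
  beside \<theta>(q^5)^2.\<close>

lemma theta4_square:
  assumes r: "norm r < 1" "r \<noteq> 0"
  shows "theta (-1) 2 0 r ^ 2 = theta (-1) 10 0 r ^ 2 - 4 * r ^ 2 * theta (-1) 10 8 r * theta (-1) 10 4 r"
proof -
  have m: "theta (-1) 10 (-4) r = theta (-1) 10 4 r" "theta (-1) 10 (-8) r = theta (-1) 10 8 r" "theta (-1) 10 (-16) r = theta (-1) 10 16 r"
    using theta_minus[of "-1" 10 4 r] theta_minus[of "-1" 10 8 r] theta_minus[of "-1" 10 16 r] by simp_all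
  have "theta (-1) 10 4 r = - (r ^ 6 * theta (-1) 10 16 r)"
    using theta_shift[OF r(2), of "-1" 10 "-4"] m by simp
  moreover have "r ^ 8 = r ^ 2 * r ^ 6" by (simp add: power_add[symmetric])
  ultimately have s: "r ^ 8 * theta (-1) 10 16 r = - (r ^ 2 * theta (-1) 10 4 r)" by simp
  have "theta (-1) 2 0 r ^ 2 = (r ^ 8 * theta (-1) 10 (-16) r) * theta (-1) 10 (-8) r - r ^ 2 * (theta (-1) 10 (-8) r * theta (-1) 10 (-4) r)
     + theta (-1) 10 0 r ^ 2 - r ^ 2 * (theta (-1) 10 8 r * theta (-1) 10 4 r) + (r ^ 8 * theta (-1) 10 16 r) * theta (-1) 10 8 r"
    using theta_square5[OF r, of "-1" 2 0] by (simp add: add_ac mult.assoc power2_eq_square power_int_minus)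
  thus ?thesis unfolding m s by (simp add: algebra_simps)
qed

text \<open>
  By \<open>theta_mult\<close> every product of two of the \<open>j_i\<close> is a two by two minor in the values \<open>U z\<close>, so the relations
  are instances of the Pluecker relation.
\<close>

lemma weierstrass:
  assumes r: "norm r < 1" "r \<noteq> 0"
  defines "j1 \<equiv> theta (-1) 10 8 r" and "j2 \<equiv> theta (-1) 10 6 r" and "j3 \<equiv> theta (-1) 10 4 r"
    and "j4 \<equiv> theta (-1) 10 2 r" and "j5 \<equiv> theta (-1) 10 0 r"
  shows "(j4 * j3) * (j4 * j1) + r ^ 2 * (j4 * j1) * (j2 * j1) = (j3 * j2) * (j5 * j2)"
    and "(j4 * j3) * (j3 * j2) - r ^ 2 * (j2 * j1) * (j3 * j2) = (j4 * j1) * (j5 * j4)"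
proof -
  define U where "U = (\<lambda>z. theta 1 20 z r)"
  have Um: "U (- z) = U z" for z unfolding U_def by (rule theta_minus) auto
  have Us: "U z = r powi (20 - z) * U (40 - z)" for z
    using theta_shift[OF r(2), of 1 20 "- z"] Um[of z] by (simp add: U_def)
  have P: "theta (-1) 10 b r * theta (-1) 10 b' r = U (b + b') * U (b' - b) - r powi (10 + b) * (U (20 + b + b') * U (20 + b - b'))" for b b'
    using theta_mult[OF r, of "-1" "-1" 10 b b'] Um[of "b' - b"] by (simp add: U_def)
  \<comment> \<open>The shift reduces all arguments to 2, 6, 10, 14, 18, so both relations become
    polynomial identities in r and five values of \<open>U\<close>.\<close>
  have U26: "r ^ 6 * U 26 = U 14" and U30: "r ^ 10 * U 30 = U 10" and U34: "r ^ 14 * U 34 = U 6" and U22: "r ^ 2 * U 22 = U 18"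
    using Us[of 14] Us[of 10] Us[of 6] Us[of 18] by simp_all
  have 43: "j4 * j3 = U 6 * U 2 - r ^ 6 * U 14 * U 18"
  proof -
    have "j4 * j3 = U 6 * U 2 - r ^ 12 * (U 26 * U 18)"
      unfolding j4_def j3_def P by simp
    also have "r ^ 12 = r ^ 6 * r ^ 6" by (simp add: power_add[symmetric])
    finally have "j4 * j3 = U 6 * U 2 - r ^ 6 * (r ^ 6 * U 26) * U 18" by (simp only: mult_ac)
    thus ?thesis unfolding U26 .
  qed
  have 41: "j4 * j1 = U 10 * U 6 - r ^ 2 * U 10 * U 14"
  proof -
    have "j4 * j1 = U 10 * U 6 - r ^ 12 * (U 30 * U 14)"
      unfolding j4_def j1_def P by simp
    also have "r ^ 12 = r ^ 2 * r ^ 10" by (simp add: power_add[symmetric])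
    finally have "j4 * j1 = U 10 * U 6 - r ^ 2 * (r ^ 10 * U 30) * U 14" by (simp only: mult_ac)
    thus ?thesis unfolding U30 .
  qed
  have 21: "j2 * j1 = U 14 * U 2 - r ^ 2 * U 6 * U 18"
  proof -
    have "j2 * j1 = U 14 * U 2 - r ^ 16 * (U 34 * U 18)"
      unfolding j2_def j1_def P by simp
    also have "r ^ 16 = r ^ 2 * r ^ 14" by (simp add: power_add[symmetric])
    finally have "j2 * j1 = U 14 * U 2 - r ^ 2 * (r ^ 14 * U 34) * U 18" by (simp only: mult_ac)
    thus ?thesis unfolding U34 .
  qed
  have 32: "j3 * j2 = U 10 * U 2 - r ^ 4 * U 10 * U 18"
  proof -
    have "j3 * j2 = U 10 * U 2 - r ^ 14 * (U 30 * U 18)"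
      unfolding j3_def j2_def P by simp
    also have "r ^ 14 = r ^ 4 * r ^ 10" by (simp add: power_add[symmetric])
    finally have "j3 * j2 = U 10 * U 2 - r ^ 4 * (r ^ 10 * U 30) * U 18" by (simp only: mult_ac)
    thus ?thesis unfolding U30 .
  qed
  have 52: "j5 * j2 = U 6 * U 6 - r ^ 4 * U 14 * U 14"
  proof -
    have "j5 * j2 = U 6 * U 6 - r ^ 10 * (U 26 * U 14)"
      unfolding j5_def j2_def P by simp
    also have "r ^ 10 = r ^ 4 * r ^ 6" by (simp add: power_add[symmetric])
    finally have "j5 * j2 = U 6 * U 6 - r ^ 4 * (r ^ 6 * U 26) * U 14" by (simp only: mult_ac)
    thus ?thesis unfolding U26 .
  qed
  have 54: "j5 * j4 = U 2 * U 2 - r ^ 8 * U 18 * U 18"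
  proof -
    have "j5 * j4 = U 2 * U 2 - r ^ 10 * (U 22 * U 18)"
      unfolding j5_def j4_def P by simp
    also have "r ^ 10 = r ^ 8 * r ^ 2" by (simp add: power_add[symmetric])
    finally have "j5 * j4 = U 2 * U 2 - r ^ 8 * (r ^ 2 * U 22) * U 18" by (simp only: mult_ac)
    thus ?thesis unfolding U22 .
  qed
  show "(j4 * j3) * (j4 * j1) + r ^ 2 * (j4 * j1) * (j2 * j1) = (j3 * j2) * (j5 * j2)"
    unfolding 43 41 21 32 52 by algebra
  show "(j4 * j3) * (j3 * j2) - r ^ 2 * (j2 * j1) * (j3 * j2) = (j4 * j1) * (j5 * j4)"
    unfolding 43 41 21 32 54 by algebra
qed


section \<open>Theta functions of level 10 as infinite products and eta quotients\<close>

lemma psi_eta: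
  assumes q: "norm q < 1" "q \<noteq> 0"
  shows "theta 1 2 1 q * euler_E 1 q = euler_E 2 q ^ 2"
proof -
  have "qpoch_inf q q = qpoch_inf q (q ^ 2) * qpoch_inf (q ^ 2) (q ^ 2)"
    using qpoch_inf_split2[OF q(1), of q] by (simp add: power2_eq_square)
  thus ?thesis using psi_product[OF q] by (simp add: euler_E_def power2_eq_square)
qed

lemma theta4_eta:
  assumes q: "norm q < 1" "q \<noteq> 0"
  shows "theta (-1) 1 0 q * euler_E 2 q = euler_E 1 q ^ 2"
proof -
  have "qpoch_inf q q = qpoch_inf q (q ^ 2) * qpoch_inf (q ^ 2) (q ^ 2)"
    using qpoch_inf_split2[OF q(1), of q] by (simp add: power2_eq_square)
  thus ?thesis using theta_product[OF q, of "-1" 1 0] by (simp add: euler_E_def power2_eq_square)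
qed

lemma euler_E_power: "euler_E m (q ^ n) = euler_E (n * m) q"
  by (simp add: euler_E_def power_mult)

lemma euler_E_nonzero:
  assumes "norm q < 1" "m > 0"
  shows "euler_E m q \<noteq> 0"
  unfolding euler_E_def using norm_power_less_1[OF assms] by (intro qpoch_inf_nonzero')

context
  fixes r q :: complex
  assumes r: "norm r < 1" "r \<noteq> 0" and q_def: "q = r ^ 2"
begin

private lemma q: "norm q < 1" "q \<noteq> 0" "norm (q ^ 5) < 1" "q ^ 5 \<noteq> 0" "norm (q ^ 2) < 1"
  using r by (auto simp: q_def intro!: norm_power_less_1)

private abbreviation P :: "nat \<Rightarrow> complex" where "P i \<equiv> qpoch_inf (q ^ i) (q ^ 10)"

private lemma theta_P:
  "theta (-1) 10 8 r = P 9 * P 1 * P 10" "theta (-1) 10 6 r = P 8 * P 2 * P 10" "theta (-1) 10 4 r = P 7 * P 3 * P 10"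
  "theta (-1) 10 2 r = P 6 * P 4 * P 10" "theta (-1) 10 0 r = P 5 * P 5 * P 10"
  using theta_product[OF r, of "-1" 10 8] theta_product[OF r, of "-1" 10 6] theta_product[OF r, of "-1" 10 4]
    theta_product[OF r, of "-1" 10 2] theta_product[OF r, of "-1" 10 0]
  by (simp_all add: q_def power_mult[symmetric])

private lemma E10: "euler_E 10 q = P 10"
  by (simp add: euler_E_def)

private lemma E5: "euler_E 5 q = P 5 * P 10"
  using qpoch_inf_split2[OF q(3), of "q ^ 5"] by (simp add: euler_E_def power_mult[symmetric] power_add[symmetric])

text \<open>The bracket is (q^i; q^5)_\<infinity> split modulo 10. The components of \<psi>(t),
  products with plus signs, thereby become quotients of the j_i.\<close>

private lemma minus_P:
  "qpoch_inf (- (q ^ i)) (q ^ 5) * (P i * P (i + 5)) = P (2 * i)"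
proof -
  have "qpoch_inf (q ^ i) (q ^ 5) = P i * P (i + 5)"
    using qpoch_inf_split2[OF q(3), of "q ^ i"] by (simp add: power_mult[symmetric] power_add[symmetric])
  moreover have "qpoch_inf (q ^ i) (q ^ 5) * qpoch_inf (- (q ^ i)) (q ^ 5) = P (2 * i)"
    using qpoch_inf_minus[OF q(3), of "q ^ i"] by (simp add: power_mult[symmetric] mult.commute)
  ultimately show ?thesis by (simp add: mult_ac)
qed

lemma theta_10_0_eta: "theta (-1) 10 0 r * euler_E 10 q = euler_E 5 q ^ 2"
  unfolding theta_P E10 E5 by (simp add: power2_eq_square)

lemma theta_20_10_eta: "theta 1 20 10 r * euler_E 5 q = euler_E 10 q ^ 2"
proof -
  have "theta 1 20 10 r = theta 1 2 1 (q ^ 5)"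
    using theta_power[of 1 2 1 r 10] by (simp add: q_def power_mult[symmetric])
  thus ?thesis using psi_eta[OF q(3,4)] by (simp add: euler_E_power)
qed

private lemma theta_A: "theta 1 5 1 r = qpoch_inf (- (q ^ 3)) (q ^ 5) * qpoch_inf (- (q ^ 2)) (q ^ 5) * euler_E 5 q"
  using theta_product[OF r, of 1 5 1] by (simp add: q_def euler_E_def power_mult[symmetric])

private lemma theta_B: "theta 1 5 3 r = qpoch_inf (- (q ^ 4)) (q ^ 5) * qpoch_inf (- (q ^ 1)) (q ^ 5) * euler_E 5 q"
  using theta_product[OF r, of 1 5 3] by (simp add: q_def euler_E_def power_mult[symmetric])

private lemma E5_C: "euler_E 5 q * (euler_E 10 q) ^ 2 = theta 1 20 10 r * theta (-1) 10 0 r * P 10"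
proof -
  have nz: "euler_E 5 q \<noteq> 0" by (intro euler_E_nonzero q) auto
  have "euler_E 5 q * (theta 1 20 10 r * theta (-1) 10 0 r * P 10) = (theta 1 20 10 r * euler_E 5 q) * (theta (-1) 10 0 r * euler_E 10 q)"
    by (simp add: E10)
  also have "\<dots> = euler_E 5 q * (euler_E 5 q * (euler_E 10 q) ^ 2)"
    unfolding theta_20_10_eta theta_10_0_eta by (simp add: power2_eq_square)
  finally show ?thesis using nz by simp
qed

lemma theta_A_eq:
  "theta 1 5 1 r * theta (-1) 10 6 r * theta (-1) 10 4 r = theta 1 20 10 r * theta (-1) 10 2 r * theta (-1) 10 0 r"
proof -
  have "theta 1 5 1 r * theta (-1) 10 6 r * theta (-1) 10 4 r =
      (qpoch_inf (- (q ^ 2)) (q ^ 5) * (P 2 * P (2 + 5))) * (qpoch_inf (- (q ^ 3)) (q ^ 5) * (P 3 * P (3 + 5))) * (euler_E 5 q * (euler_E 10 q) ^ 2)"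
    unfolding theta_A theta_P E10 by (simp add: power2_eq_square)
  also have "\<dots> = P 4 * P 6 * (euler_E 5 q * (euler_E 10 q) ^ 2)"
    unfolding minus_P by simp
  also have "\<dots> = theta 1 20 10 r * theta (-1) 10 2 r * theta (-1) 10 0 r"
    unfolding E5_C theta_P(4) by (simp only: mult_ac)
  finally show ?thesis .
qed

lemma theta_B_eq:
  "theta 1 5 3 r * theta (-1) 10 8 r * theta (-1) 10 2 r = theta 1 20 10 r * theta (-1) 10 6 r * theta (-1) 10 0 r"
proof -
  have "theta 1 5 3 r * theta (-1) 10 8 r * theta (-1) 10 2 r =
      (qpoch_inf (- (q ^ 1)) (q ^ 5) * (P 1 * P (1 + 5))) * (qpoch_inf (- (q ^ 4)) (q ^ 5) * (P 4 * P (4 + 5))) * (euler_E 5 q * (euler_E 10 q) ^ 2)"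
    unfolding theta_B theta_P E10 by (simp add: power2_eq_square)
  also have "\<dots> = P 2 * P 8 * (euler_E 5 q * (euler_E 10 q) ^ 2)"
    unfolding minus_P by simp
  also have "\<dots> = theta 1 20 10 r * theta (-1) 10 6 r * theta (-1) 10 0 r"
    unfolding E5_C theta_P(2) by (simp only: mult_ac)
  finally show ?thesis .
qed

text \<open>The residues 1, 3, 7, 9 modulo 10 are the odd ones other than 5, so j_1 j_3 contains (q;
  q^2)_\<infinity> without its factors at odd multiples of 5.\<close>

lemma theta_FG_eta:
  "theta (-1) 10 8 r * theta (-1) 10 4 r * (euler_E 2 q * euler_E 5 q) = euler_E 1 q * euler_E 10 q ^ 3"
proof -
  have "qpoch_inf q q = qpoch_inf q (q ^ 2) * euler_E 2 q"
    using qpoch_inf_split2[OF q(1), of q] by (simp add: euler_E_def power2_eq_square)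
  moreover have "qpoch_inf q (q ^ 2) = P 1 * P 3 * P 5 * P 7 * P 9"
    using qpoch_inf_split5[OF q(5), of q] by (simp add: power_mult[symmetric] power_Suc[symmetric] del: power_Suc)
  ultimately have "euler_E 1 q = P 1 * P 3 * P 5 * P 7 * P 9 * euler_E 2 q"
    by (simp add: euler_E_def)
  thus ?thesis unfolding theta_P E10 E5 by (simp add: power3_eq_cube)
qed

lemma theta_nonzero_10:
  "theta (-1) 10 8 r \<noteq> 0" "theta (-1) 10 6 r \<noteq> 0" "theta (-1) 10 4 r \<noteq> 0" "theta (-1) 10 2 r \<noteq> 0" "theta (-1) 10 0 r \<noteq> 0"
proof -
  have nz: "P i \<noteq> 0" if "i > 0" for i
    using norm_power_less_1[OF q(1)] that by (intro qpoch_inf_nonzero') auto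
  show "theta (-1) 10 8 r \<noteq> 0" "theta (-1) 10 6 r \<noteq> 0" "theta (-1) 10 4 r \<noteq> 0" "theta (-1) 10 2 r \<noteq> 0" "theta (-1) 10 0 r \<noteq> 0"
    unfolding theta_P by (intro no_zero_divisors nz; simp)+
qed

lemma theta_psi_eta: "theta 1 4 2 r * euler_E 1 q = euler_E 2 q ^ 2"
  using psi_eta[OF q(1,2)] theta_power[of 1 2 1 r 2] by (simp add: q_def)

lemma theta_theta4_eta: "theta (-1) 2 0 r * euler_E 2 q = euler_E 1 q ^ 2"
  using theta4_eta[OF q(1,2)] theta_power[of "-1" 1 0 r 2] by (simp add: q_def)

end

section \<open>The component of weight zero\<close>

text \<open>
  In the application, \<open>f\<close> and \<open>g\<close> are ratios of components of \<open>\<theta>(t)\<close>. When \<open>t\<close> is multiplied by a fifth root of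
  unity \<open>\<zeta>\<close>, they are multiplied by \<open>\<zeta>\<close> and
  \<open>\<zeta>^4\<close>, so that \<open>x0\<close> is the only component of weight zero.
\<close>

definition weight_vec :: "complex \<Rightarrow> complex \<Rightarrow> complex \<Rightarrow> complex \<Rightarrow> complex \<Rightarrow> complex \<Rightarrow> complex \<Rightarrow> complex" where
  "weight_vec f g x0 x1 x2 x3 x4 = x0 + x1 * f + x2 * f ^ 2 + x3 * g ^ 2 + x4 * g"

text \<open>The basis 1, f, f^2, g^2, g has weights 0 to 4 modulo 5. The three relations reduce
  every product of basis elements to a multiple of the one of the right weight. Since they are
  preserved by f -> \<zeta> f, g -> \<zeta>^4 g, the formula holds for all five conjugates at
  once.\<close>

lemma weight_vec_mult:
  assumes e: "f * g = e" and l: "f ^ 3 = l * g ^ 2" and l': "g ^ 3 = l' * f ^ 2"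
  shows "weight_vec f g x0 x1 x2 x3 x4 * weight_vec f g y0 y1 y2 y3 y4 =
    weight_vec f g (x0 * y0 + e * (x1 * y4 + x4 * y1) + e ^ 2 * (x2 * y3 + x3 * y2))
      (x0 * y1 + x1 * y0 + e * (x2 * y4 + x4 * y2) + l' * e * (x3 * y3))
      (x0 * y2 + x2 * y0 + x1 * y1 + l' * (x3 * y4 + x4 * y3))
      (x0 * y3 + x3 * y0 + x4 * y4 + l * (x1 * y2 + x2 * y1))
      (x0 * y4 + x4 * y0 + e * (x1 * y3 + x3 * y1) + l * e * (x2 * y2))"
proof -
  have f4: "f ^ 4 = l * e * g"
  proof -
    have "f ^ 4 = f * f ^ 3" by (simp add: eval_nat_numeral)
    also have "\<dots> = l * (f * g) * g" unfolding l by (simp add: power2_eq_square)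
    finally show ?thesis unfolding e .
  qed
  have g4: "g ^ 4 = l' * e * f"
  proof -
    have "g ^ 4 = g * g ^ 3" by (simp add: eval_nat_numeral)
    also have "\<dots> = l' * (f * g) * f" unfolding l' by (simp add: power2_eq_square)
    finally show ?thesis unfolding e .
  qed
  have "weight_vec f g x0 x1 x2 x3 x4 * weight_vec f g y0 y1 y2 y3 y4 =
     (x0 * y0 + (f * g) * (x1 * y4 + x4 * y1) + (f * g) ^ 2 * (x2 * y3 + x3 * y2))
     + (x0 * y1 + x1 * y0 + (f * g) * (x2 * y4 + x4 * y2)) * f + g ^ 4 * (x3 * y3)
     + (x0 * y2 + x2 * y0 + x1 * y1) * f ^ 2 + g ^ 3 * (x3 * y4 + x4 * y3)
     + (x0 * y3 + x3 * y0 + x4 * y4) * g ^ 2 + f ^ 3 * (x1 * y2 + x2 * y1)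
     + (x0 * y4 + x4 * y0 + (f * g) * (x1 * y3 + x3 * y1)) * g + f ^ 4 * (x2 * y2)"
    unfolding weight_vec_def by algebra
  thus ?thesis unfolding e l l' f4 g4 weight_vec_def by (simp add: algebra_simps)
qed

text \<open>The coefficients \<open>V1\<close> to \<open>V4\<close> are fixed before
  \<open>f\<close> and \<open>g\<close>, so the same ones serve every fifth root of unity. In the
  application \<open>\<alpha>\<close> and \<open>\<beta>\<close> are the factors that express the
  ratios of the components of \<psi>(t) by f^2 and g^2.\<close>

lemma weight_component:
  fixes k :: complex
  assumes k: "k \<noteq> 0" "1 - k \<noteq> 0" "1 + k \<noteq> 0"
  defines "h \<equiv> (1 - k ^ 2) / k"
  assumes mu: "h + 1 \<noteq> 0" and nu: "1 - 4 / h \<noteq> 0"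
  defines "e \<equiv> - 4 * k / ((1 - k) * (1 + k))" and "l \<equiv> - 2 / (k * (1 - k))" and "l' \<equiv> 2 * k ^ 2 / (1 + k)"
    and "\<alpha> \<equiv> (1 + k) * (1 - k) ^ 2 / (4 * k)" and "\<beta> \<equiv> (1 - k) * (1 + k) ^ 2 / (4 * k ^ 2)"
  obtains V1 V2 V3 V4 where
    "\<And>f g. f * g = e \<Longrightarrow> f ^ 3 = l * g ^ 2 \<Longrightarrow> g ^ 3 = l' * f ^ 2 \<Longrightarrow> 1 + f + g \<noteq> 0 \<Longrightarrow>
      (1 + \<alpha> * f ^ 2 + \<beta> * g ^ 2) ^ 3 / (1 + f + g) ^ 2 =
      weight_vec f g (5 * (46 * h ^ 2 / (h + 1) + 460 * h / ((1 - 4 / h) * (h + 1)) + 1125 / ((1 - 4 / h) ^ 2 * (h + 1))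
         + 1875 / (1 - 4 / h) ^ 4 + 15625 / ((1 - 4 / h) ^ 6 * (h + 1)))) V1 V2 V3 V4"
proof -
  txt \<open>\<open>d\<close>, \<open>l1\<close>, \<open>l2\<close>, \<open>l3\<close>, \<open>l4\<close> are the components of \<open>N / (1 + f + g)\<close>, where \<open>N\<close> is the norm of \<open>1 + f + g\<close>.\<close>
  define n where "n = 1 - 4 / h"
  define m where "m = h + 1"
  define d where "d = 1 - 3 * e + e ^ 2"
  define l2 where "l2 = 1 - e - l'"
  define l3 where "l3 = 1 - e - l"
  define l1 where "l1 = - d - e * l2"
  define l4 where "l4 = - d - e * l3"
  have kk: "(1 - k) * (1 + k) \<noteq> 0" "1 - k ^ 2 = (1 - k) * (1 + k)"
    by (simp only: mult_eq_0_iff k simp_thms) (simp add: power2_eq_square algebra_simps)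
  have hh: "h = (1 - k) * (1 + k) / k" unfolding h_def kk ..
  have ll: "l * l' = e" unfolding l_def l'_def e_def using k by (simp add: divide_simps; algebra)
  define N where "N = d + e * (l4 + l1)"
  have nn: "n = ((1 - k) * (1 + k) - 4 * k) / ((1 - k) * (1 + k))"
    unfolding n_def hh using k by (simp add: divide_simps)
  \<comment> \<open>In general the norm is 1 - 5e + 5e^2 + (l + l') e^2. Here n = 1 + e, and the
    cube reflects that the product of \<theta>(\<zeta> t) over the fifth roots of unity \<zeta> is
    \<theta>(q)^6 / \<theta>(q^5).\<close>
  have N: "N = n ^ 3"
    unfolding N_def nn l4_def l1_def l2_def l3_def d_def e_def l_def l'_def using k
    by (simp add: divide_simps; algebra)
  have inv: "(1 + f + g) * weight_vec f g d l1 l2 l3 l4 = N"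
    if "f * g = e" "f ^ 3 = l * g ^ 2" "g ^ 3 = l' * f ^ 2" for f g
  proof -
    have "1 + f + g = weight_vec f g 1 1 0 0 1" by (simp add: weight_vec_def)
    hence *: "(1 + f + g) * weight_vec f g d l1 l2 l3 l4 = weight_vec f g (d + e * (l4 + l1)) (l1 + d + e * l2) (l2 + l1 + l' * l3) (l3 + l4 + l * l2) (l4 + d + e * l3)"
      using weight_vec_mult[OF that, of 1 1 0 0 1 d l1 l2 l3 l4] by (simp add: add_ac)
    have z: "l1 + d + e * l2 = 0" "l4 + d + e * l3 = 0" by (simp_all add: l1_def l4_def)
    have z': "l2 + l1 + l' * l3 = 0" unfolding l1_def l2_def l3_def d_def ll[symmetric] by (simp add: algebra_simps power2_eq_square)
    have z'': "l3 + l4 + l * l2 = 0" unfolding l4_def l2_def l3_def d_def ll[symmetric] by (simp add: algebra_simps power2_eq_square)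
    show ?thesis unfolding * z z' z'' by (simp add: weight_vec_def N_def)
  qed
  \<comment> \<open>The \<open>p\<close> and \<open>r\<close> are the components of the square and
    the cube of 1 + \<alpha> f^2 + \<beta> g^2, and the \<open>m\<close> those of the squared
    cofactor of the norm. Products with zero stay so that the terms match
    \<open>weight_vec_mult\<close> literally.\<close>
  define p0 where "p0 = 1 * 1 + e * (0 * 0 + 0 * 0) + e ^ 2 * (\<alpha> * \<beta> + \<beta> * \<alpha>)"
  define p1 where "p1 = 1 * 0 + 0 * 1 + e * (\<alpha> * 0 + 0 * \<alpha>) + l' * e * (\<beta> * \<beta>)"
  define p2 where "p2 = 1 * \<alpha> + \<alpha> * 1 + 0 * 0 + l' * (\<beta> * 0 + 0 * \<beta>)"
  define p3 where "p3 = 1 * \<beta> + \<beta> * 1 + 0 * 0 + l * (0 * \<alpha> + \<alpha> * 0)"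
  define p4 where "p4 = 1 * 0 + 0 * 1 + e * (0 * \<beta> + \<beta> * 0) + l * e * (\<alpha> * \<alpha>)"
  have p0: "p0 = (2 + 1 * k - 2 * k ^ 2) / (k)"
    unfolding p0_def \<alpha>_def \<beta>_def e_def l_def l'_def using k by (simp add: divide_simps; algebra)
  have p1: "p1 = - 1 * (1 - k) * (1 + k) ^ 2 / (2 * k)"
    unfolding p1_def \<alpha>_def \<beta>_def e_def l_def l'_def using k by (simp add: divide_simps; algebra)
  have p2: "p2 = (1 - k) ^ 2 * (1 + k) / (2 * k)"
    unfolding p2_def \<alpha>_def \<beta>_def e_def l_def l'_def using k by (simp add: divide_simps; algebra)
  have p3: "p3 = (1 - k) * (1 + k) ^ 2 / (2 * k ^ 2)"
    unfolding p3_def \<alpha>_def \<beta>_def e_def l_def l'_def using k by (simp add: divide_simps; algebra)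
  have p4: "p4 = (1 - k) ^ 2 * (1 + k) / (2 * k ^ 2)"
    unfolding p4_def \<alpha>_def \<beta>_def e_def l_def l'_def using k by (simp add: divide_simps; algebra)
  define r0 where "r0 = p0 * 1 + e * (p1 * 0 + p4 * 0) + e ^ 2 * (p2 * \<beta> + p3 * \<alpha>)"
  define r1 where "r1 = p0 * 0 + p1 * 1 + e * (p2 * 0 + p4 * \<alpha>) + l' * e * (p3 * \<beta>)"
  define r2 where "r2 = p0 * \<alpha> + p2 * 1 + p1 * 0 + l' * (p3 * 0 + p4 * \<beta>)"
  define r3 where "r3 = p0 * \<beta> + p3 * 1 + p4 * 0 + l * (p1 * \<alpha> + p2 * 0)"
  define r4 where "r4 = p0 * 0 + p4 * 1 + e * (p1 * \<beta> + p3 * 0) + l * e * (p2 * \<alpha>)"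
  have r0: "r0 = (6 + 1 * k - 6 * k ^ 2) / (k)"
    unfolding r0_def p0 p1 p2 p3 p4 \<alpha>_def \<beta>_def e_def l_def l'_def using k by (simp add: divide_simps; algebra)
  have r1: "r1 = (-1 - 1 * k - 4 * k ^ 2) * (1 - k) * (1 + k) / (2 * k ^ 2)"
    unfolding r1_def p0 p1 p2 p3 p4 \<alpha>_def \<beta>_def e_def l_def l'_def using k by (simp add: divide_simps; algebra)
  have r2: "r2 = (3 + 3 * k - 3 * k ^ 2) * (1 - k) ^ 2 * (1 + k) / (4 * k ^ 2)"
    unfolding r2_def p0 p1 p2 p3 p4 \<alpha>_def \<beta>_def e_def l_def l'_def using k by (simp add: divide_simps; algebra)
  have r3: "r3 = (3 + 3 * k - 3 * k ^ 2) * (1 - k) * (1 + k) ^ 2 / (4 * k ^ 3)"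
    unfolding r3_def p0 p1 p2 p3 p4 \<alpha>_def \<beta>_def e_def l_def l'_def using k by (simp add: divide_simps; algebra)
  have r4: "r4 = (4 - 1 * k + 1 * k ^ 2) * (1 - k) * (1 + k) / (2 * k ^ 2)"
    unfolding r4_def p0 p1 p2 p3 p4 \<alpha>_def \<beta>_def e_def l_def l'_def using k by (simp add: divide_simps; algebra)
  have d: "d = (1 + 12 * k + 14 * k ^ 2 - 12 * k ^ 3 + 1 * k ^ 4) / ((1 - k) ^ 2 * (1 + k) ^ 2)"
    unfolding d_def e_def l_def l'_def using k by (simp add: divide_simps; algebra)
  have l1: "l1 = (-1 - 9 * k - 7 * k ^ 2 - 7 * k ^ 3) / ((1 - k) * (1 + k) ^ 2)"
    unfolding l1_def l2_def d_def e_def l_def l'_def using k by (simp add: divide_simps; algebra)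
  have l2: "l2 = (1 + 4 * k - 3 * k ^ 2 + 2 * k ^ 3) / ((1 - k) * (1 + k))"
    unfolding l2_def e_def l_def l'_def using k by (simp add: divide_simps; algebra)
  have l3: "l3 = (2 + 3 * k + 4 * k ^ 2 - 1 * k ^ 3) / (k * (1 - k) * (1 + k))"
    unfolding l3_def e_def l_def l'_def using k by (simp add: divide_simps; algebra)
  have l4: "l4 = (7 - 7 * k + 9 * k ^ 2 - 1 * k ^ 3) / ((1 - k) ^ 2 * (1 + k))"
    unfolding l4_def l3_def d_def e_def l_def l'_def using k by (simp add: divide_simps; algebra)
  define m0 where "m0 = d * d + e * (l1 * l4 + l4 * l1) + e ^ 2 * (l2 * l3 + l3 * l2)"
  define m1 where "m1 = d * l1 + l1 * d + e * (l2 * l4 + l4 * l2) + l' * e * (l3 * l3)"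
  define m2 where "m2 = d * l2 + l2 * d + l1 * l1 + l' * (l3 * l4 + l4 * l3)"
  define m3 where "m3 = d * l3 + l3 * d + l4 * l4 + l * (l1 * l2 + l2 * l1)"
  define m4 where "m4 = d * l4 + l4 * d + e * (l1 * l3 + l3 * l1) + l * e * (l2 * l2)"
  have m0: "m0 = (1 + 144 * k + 972 * k ^ 2 + 592 * k ^ 3 + 870 * k ^ 4 - 592 * k ^ 5 + 972 * k ^ 6 - 144 * k ^ 7 + 1 * k ^ 8) / ((1 - k) ^ 4 * (1 + k) ^ 4)"
    unfolding m0_def d l1 l2 l3 l4 e_def l_def l'_def using k by (simp add: divide_simps; algebra)
  have m1: "m1 = (-2 - 128 * k - 504 * k ^ 2 - 104 * k ^ 3 + 60 * k ^ 4 - 16 * k ^ 5 + 536 * k ^ 6 - 392 * k ^ 7 + 38 * k ^ 8) / ((1 - k) ^ 4 * (1 + k) ^ 4)"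
    unfolding m1_def d l1 l2 l3 l4 e_def l_def l'_def using k by (simp add: divide_simps; algebra)
  have m2: "m2 = (3 + 107 * k + 311 * k ^ 2 + 311 * k ^ 3 - 15 * k ^ 4 + 49 * k ^ 5 + 141 * k ^ 6 - 147 * k ^ 7 + 8 * k ^ 8) / ((1 - k) ^ 3 * (1 + k) ^ 4)"
    unfolding m2_def d l1 l2 l3 l4 e_def l_def l'_def using k by (simp add: divide_simps; algebra)
  have m3: "m3 = (8 + 147 * k + 141 * k ^ 2 - 49 * k ^ 3 - 15 * k ^ 4 - 311 * k ^ 5 + 311 * k ^ 6 - 107 * k ^ 7 + 3 * k ^ 8) / (k * (1 - k) ^ 4 * (1 + k) ^ 3)"
    unfolding m3_def d l1 l2 l3 l4 e_def l_def l'_def using k by (simp add: divide_simps; algebra)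
  have m4: "m4 = (38 + 392 * k + 536 * k ^ 2 + 16 * k ^ 3 + 60 * k ^ 4 + 104 * k ^ 5 - 504 * k ^ 6 + 128 * k ^ 7 - 2 * k ^ 8) / ((1 - k) ^ 4 * (1 + k) ^ 4)"
    unfolding m4_def d l1 l2 l3 l4 e_def l_def l'_def using k by (simp add: divide_simps; algebra)
  define V where "V = r0 * m0 + e * (r1 * m4 + r4 * m1) + e ^ 2 * (r2 * m3 + r3 * m2)"
  define D where "D = k * (1 - k) ^ 4 * (1 + k) ^ 4"
  have D0: "k * ((1 - k) ^ 4 * (1 + k) ^ 4) = D"
    unfolding D_def by algebra
  have t0: "r0 * m0 = ((6 + 1 * k - 6 * k ^ 2) * (1 + 144 * k + 972 * k ^ 2 + 592 * k ^ 3 + 870 * k ^ 4 - 592 * k ^ 5 + 972 * k ^ 6 - 144 * k ^ 7 + 1 * k ^ 8)) / D"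
    unfolding r0 m0 times_divide_times_eq D0 ..
  have s1: "e * r1 = (2 + 2 * k + 8 * k ^ 2) / k"
    unfolding r1 e_def using k by (simp add: divide_simps; algebra)
  have D1: "k * ((1 - k) ^ 4 * (1 + k) ^ 4) = D"
    unfolding D_def by algebra
  have t1: "e * r1 * m4 = ((2 + 2 * k + 8 * k ^ 2) * (38 + 392 * k + 536 * k ^ 2 + 16 * k ^ 3 + 60 * k ^ 4 + 104 * k ^ 5 - 504 * k ^ 6 + 128 * k ^ 7 - 2 * k ^ 8)) / D"
    unfolding s1 m4 times_divide_times_eq D1 ..
  have s2: "e * r4 = (- 8 + 2 * k - 2 * k ^ 2) / k"
    unfolding r4 e_def using k by (simp add: divide_simps; algebra)
  have D2: "k * ((1 - k) ^ 4 * (1 + k) ^ 4) = D"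
    unfolding D_def by algebra
  have t2: "e * r4 * m1 = ((- 8 + 2 * k - 2 * k ^ 2) * (-2 - 128 * k - 504 * k ^ 2 - 104 * k ^ 3 + 60 * k ^ 4 - 16 * k ^ 5 + 536 * k ^ 6 - 392 * k ^ 7 + 38 * k ^ 8)) / D"
    unfolding s2 m1 times_divide_times_eq D2 ..
  have s3: "e ^ 2 * r2 = (12 + 12 * k - 12 * k ^ 2) / (1 + k)"
    unfolding r2 e_def using k by (simp add: divide_simps; algebra)
  have D3: "(1 + k) * (k * (1 - k) ^ 4 * (1 + k) ^ 3) = D"
    unfolding D_def by algebra
  have t3: "e ^ 2 * r2 * m3 = ((12 + 12 * k - 12 * k ^ 2) * (8 + 147 * k + 141 * k ^ 2 - 49 * k ^ 3 - 15 * k ^ 4 - 311 * k ^ 5 + 311 * k ^ 6 - 107 * k ^ 7 + 3 * k ^ 8)) / D"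
    unfolding s3 m3 times_divide_times_eq D3 ..
  have s4: "e ^ 2 * r3 = (12 + 12 * k - 12 * k ^ 2) / (k * (1 - k))"
    unfolding r3 e_def using k by (simp add: divide_simps; algebra)
  have D4: "(k * (1 - k)) * ((1 - k) ^ 3 * (1 + k) ^ 4) = D"
    unfolding D_def by algebra
  have t4: "e ^ 2 * r3 * m2 = ((12 + 12 * k - 12 * k ^ 2) * (3 + 107 * k + 311 * k ^ 2 + 311 * k ^ 3 - 15 * k ^ 4 + 49 * k ^ 5 + 141 * k ^ 6 - 147 * k ^ 7 + 8 * k ^ 8)) / D"
    unfolding s4 m2 times_divide_times_eq D4 ..
  have "V = r0 * m0 + e * r1 * m4 + e * r4 * m1 + (e ^ 2 * r2 * m3 + e ^ 2 * r3 * m2)"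
    unfolding V_def by (simp only: distrib_left add.assoc mult.assoc)
  also have "\<dots> = (230 + 5925 * k + 20250 * k ^ 2 + 13500 * k ^ 3 + 2100 * k ^ 4 - 11970 * k ^ 5 - 2100 * k ^ 6 + 13500 * k ^ 7 - 20250 * k ^ 8 + 5925 * k ^ 9 - 230 * k ^ 10) / D"
    unfolding t0 t1 t2 t3 t4 add_divide_distrib[symmetric] by (rule arg_cong[of _ _ "\<lambda>x. x / D"]) algebra
  finally have V: "V = (230 + 5925 * k + 20250 * k ^ 2 + 13500 * k ^ 3 + 2100 * k ^ 4 - 11970 * k ^ 5 - 2100 * k ^ 6 + 13500 * k ^ 7 - 20250 * k ^ 8 + 5925 * k ^ 9 - 230 * k ^ 10) / (k * (1 - k) ^ 4 * (1 + k) ^ 4)"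
    by (simp only: D_def)
  define W where "W = 5 * (46 * h ^ 2 / m + 460 * h / (n * m) + 1125 / (n ^ 2 * m) + 1875 / n ^ 4 + 15625 / (n ^ 6 * m))"
  have nz: "n \<noteq> 0" "m \<noteq> 0" using mu nu by (simp_all add: n_def m_def)
  have mm: "m = (1 + k - k ^ 2) / k"
    unfolding m_def hh using k by (simp add: divide_simps; algebra)
  define S where "S = (1 - k) * (1 + k)"
  define T where "T = S - 4 * k"
  have S: "S \<noteq> 0" using kk by (simp add: S_def)
  have "V * m = (230 + 5925 * k + 20250 * k ^ 2 + 13500 * k ^ 3 + 2100 * k ^ 4 - 11970 * k ^ 5 - 2100 * k ^ 6 + 13500 * k ^ 7 - 20250 * k ^ 8 + 5925 * k ^ 9 - 230 * k ^ 10) * (1 + k - k ^ 2) / (k ^ 2 * S ^ 4)"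
    unfolding V mm S_def power_mult_distrib by (simp add: power2_eq_square)
  \<comment> \<open>The numerator of \<open>V\<close> is multiplied by -k^(-10) under k -> -1 / k.
    It is thus k^5 times a polynomial in h = 1 / k - k. Here h = S / k and n = T / S, and the
    rewriting in \<open>S\<close> and \<open>T\<close> exhibits the five coefficients of the
    theorem.\<close>
  also have "(230 + 5925 * k + 20250 * k ^ 2 + 13500 * k ^ 3 + 2100 * k ^ 4 - 11970 * k ^ 5 - 2100 * k ^ 6 + 13500 * k ^ 7 - 20250 * k ^ 8 + 5925 * k ^ 9 - 230 * k ^ 10) * (1 + k - k ^ 2) =
      5 * (46 * T ^ 6 + 460 * k * T ^ 5 + 1125 * k ^ 2 * T ^ 4 + 1875 * T ^ 2 * (1 + k - k ^ 2) * k * S ^ 2 + 15625 * k ^ 2 * S ^ 4)"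
    unfolding T_def S_def by algebra
  also have "\<dots> / (k ^ 2 * S ^ 4) = 5 * (46 * h ^ 2 * n ^ 6 + 460 * h * n ^ 5 + 1125 * n ^ 4 + 1875 * n ^ 2 * m + 15625)"
    unfolding mm nn hh S_def[symmetric] T_def[symmetric] using k S by (simp add: divide_simps; algebra)
  also have "\<dots> = W * N ^ 2 * m"
  proof -
    have p: "n ^ 6 = n * n ^ 5" "n ^ 6 = n ^ 2 * n ^ 4" "n ^ 6 = n ^ 4 * n ^ 2" by algebra+
    have gen: "x / (a * m) * (a * b * m) = x * b" and gen': "x / a * (a * b * m) = x * b * m" if "a \<noteq> 0" for x a b
      using nz that by simp_all
    have "46 * h ^ 2 / m * (n ^ 6 * m) = 46 * h ^ 2 * n ^ 6"
      using nz by simp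
    moreover have "460 * h / (n * m) * (n ^ 6 * m) = 460 * h * n ^ 5"
      unfolding p(1) by (rule gen) (use nz in simp)
    moreover have "1125 / (n ^ 2 * m) * (n ^ 6 * m) = 1125 * n ^ 4"
      unfolding p(2) by (rule gen) (use nz in simp)
    moreover have "1875 / n ^ 4 * (n ^ 6 * m) = 1875 * n ^ 2 * m"
      unfolding p(3) by (rule gen') (use nz in simp)
    moreover have "15625 / (n ^ 6 * m) * (n ^ 6 * m) = 15625"
      using nz by simp
    moreover have "W * N ^ 2 * m = 5 * (46 * h ^ 2 / m * (n ^ 6 * m) + 460 * h / (n * m) * (n ^ 6 * m) + 1125 / (n ^ 2 * m) * (n ^ 6 * m)
        + 1875 / n ^ 4 * (n ^ 6 * m) + 15625 / (n ^ 6 * m) * (n ^ 6 * m))"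
      unfolding W_def N by (simp only: distrib_right mult.assoc power_mult[symmetric]) simp
    ultimately show ?thesis by simp
  qed
  finally have VW: "V / N ^ 2 = W" using nz by (simp add: N)
  \<comment> \<open>The components other than the one of weight zero enter through equations free of
    \<open>f\<close> and \<open>g\<close>, which \<open>refl\<close> later turns into the
    witnesses.\<close>
  have main: "(1 + \<alpha> * f ^ 2 + \<beta> * g ^ 2) ^ 3 / (1 + f + g) ^ 2 = weight_vec f g W V1 V2 V3 V4"
    if fg: "f * g = e" "f ^ 3 = l * g ^ 2" "g ^ 3 = l' * f ^ 2" "1 + f + g \<noteq> 0"
      and Vs: "V1 = (r0 * m1 + r1 * m0 + e * (r2 * m4 + r4 * m2) + l' * e * (r3 * m3)) / N ^ 2"
        "V2 = (r0 * m2 + r2 * m0 + r1 * m1 + l' * (r3 * m4 + r4 * m3)) / N ^ 2"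
        "V3 = (r0 * m3 + r3 * m0 + r4 * m4 + l * (r1 * m2 + r2 * m1)) / N ^ 2"
        "V4 = (r0 * m4 + r4 * m0 + e * (r1 * m3 + r3 * m1) + l * e * (r2 * m2)) / N ^ 2" for f g V1 V2 V3 V4
  proof -
    define x where "x = 1 + \<alpha> * f ^ 2 + \<beta> * g ^ 2"
    define y where "y = 1 + f + g"
    define z where "z = weight_vec f g d l1 l2 l3 l4"
    have x: "x = weight_vec f g 1 0 \<alpha> \<beta> 0" by (simp add: x_def weight_vec_def)
    have "x * x = weight_vec f g p0 p1 p2 p3 p4"
      unfolding x weight_vec_mult[OF fg(1-3)] p0_def p1_def p2_def p3_def p4_def ..
    hence "x ^ 3 = weight_vec f g p0 p1 p2 p3 p4 * weight_vec f g 1 0 \<alpha> \<beta> 0"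
      using x by (simp add: power3_eq_cube)
    hence x3: "x ^ 3 = weight_vec f g r0 r1 r2 r3 r4"
      unfolding weight_vec_mult[OF fg(1-3)] r0_def r1_def r2_def r3_def r4_def .
    have z2: "z * z = weight_vec f g m0 m1 m2 m3 m4"
      unfolding z_def weight_vec_mult[OF fg(1-3)] m0_def m1_def m2_def m3_def m4_def ..
    have "y * z = N" unfolding y_def z_def by (rule inv[OF fg(1-3)])
    moreover have y0: "y \<noteq> 0" using fg(4) by (simp add: y_def)
    moreover have N0: "N \<noteq> 0" using nz by (simp add: N)
    ultimately have z0: "z \<noteq> 0" "N = y * z" by auto
    hence "x ^ 3 / y ^ 2 = x ^ 3 * (z * z) / N ^ 2"
      by (simp add: power_mult_distrib power2_eq_square)
    also have "x ^ 3 * (z * z) = weight_vec f g V (V1 * N ^ 2) (V2 * N ^ 2) (V3 * N ^ 2) (V4 * N ^ 2)"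
      unfolding x3 z2 weight_vec_mult[OF fg(1-3)] V_def Vs using N0 by simp
    also have "\<dots> / N ^ 2 = weight_vec f g W V1 V2 V3 V4"
      using N0 unfolding VW[symmetric] weight_vec_def by (simp add: add_divide_distrib)
    finally show ?thesis unfolding x_def y_def .
  qed
  show ?thesis
    by (rule that) (unfold n_def[symmetric] m_def[symmetric] W_def[symmetric], rule main[OF _ _ _ _ refl refl refl refl])
qed

section \<open>Extraction of the coefficients\<close>

lemma fifth_root_of_unity:
  obtains \<omega> :: complex where "\<omega> ^ 5 = 1" "1 + \<omega> + \<omega> ^ 2 + \<omega> ^ 3 + \<omega> ^ 4 = 0"
proof -
  define \<omega> where "\<omega> = cis (2 * pi / 5)"
  have w5: "\<omega> ^ 5 = 1"
  proof -
    have "\<omega> ^ 5 = cis (real 5 * (2 * pi / 5))" unfolding \<omega>_def by (rule Complex.DeMoivre)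
    also have "real 5 * (2 * pi / 5) = 2 * pi" by simp
    finally show ?thesis by (simp only: cis_2pi)
  qed
  have "cos (2 * pi / 5) < cos 0" by (intro cos_monotone_0_pi) auto
  hence "\<omega> \<noteq> 1" by (auto simp: \<omega>_def complex_eq_iff)
  moreover have "\<omega> ^ 5 - 1 = (\<omega> - 1) * (1 + \<omega> + \<omega> ^ 2 + \<omega> ^ 3 + \<omega> ^ 4)"
    by algebra
  ultimately have "1 + \<omega> + \<omega> ^ 2 + \<omega> ^ 3 + \<omega> ^ 4 = 0" using w5 by simp
  with w5 show ?thesis by (rule that)
qed

lemma less_5_cases: "(x::nat) < 5 \<Longrightarrow> x = 0 \<or> x = 1 \<or> x = 2 \<or> x = 3 \<or> x = 4"
  by linarith

lemma sum_fifth_roots: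
  fixes \<omega> :: complex
  assumes w5: "\<omega> ^ 5 = 1" and w: "1 + \<omega> + \<omega> ^ 2 + \<omega> ^ 3 + \<omega> ^ 4 = 0"
  shows "(\<Sum>i<5. (\<omega> ^ i) ^ m) = (if 5 dvd m then 5 else 0)"
proof -
  have "\<omega> ^ m = \<omega> ^ (m mod 5)"
  proof -
    have "\<omega> ^ m = \<omega> ^ (5 * (m div 5) + m mod 5)" by simp
    also have "\<dots> = \<omega> ^ (m mod 5)" unfolding power_add power_mult w5 by simp
    finally show ?thesis .
  qed
  hence e: "(\<omega> ^ i) ^ m = (\<omega> ^ (m mod 5)) ^ i" for i
    by (simp only: power_mult[symmetric] mult.commute[of i]) (simp only: power_mult)
  have sum5: "(\<Sum>i<5. x ^ i) = 1 + x + x ^ 2 + x ^ 3 + x ^ 4" for x :: complex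
    by (simp add: eval_nat_numeral)
  have S: "(\<Sum>i<5. (\<omega> ^ i) ^ m) = 1 + \<omega> ^ (m mod 5) + (\<omega> ^ (m mod 5)) ^ 2 + (\<omega> ^ (m mod 5)) ^ 3 + (\<omega> ^ (m mod 5)) ^ 4"
    unfolding e by (rule sum5)
  have "m mod 5 < 5" by simp
  from less_5_cases[OF this] show ?thesis
  proof (elim disjE, goal_cases)
    case 1
    hence "5 dvd m" by (simp add: dvd_eq_mod_eq_0)
    thus ?thesis unfolding S 1 by simp
  next
    case 2
    hence "\<not> 5 dvd m" by (simp add: dvd_eq_mod_eq_0)
    thus ?thesis unfolding S 2 power_one_right w by (simp only: if_False)
  next
    case 3
    hence "\<not> 5 dvd m" by (simp add: dvd_eq_mod_eq_0)
    moreover have "1 + \<omega> ^ 2 + (\<omega> ^ 2) ^ 2 + (\<omega> ^ 2) ^ 3 + (\<omega> ^ 2) ^ 4 = 0"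
      using w5 w by algebra
    ultimately show ?thesis unfolding S 3 by (simp only: if_False)
  next
    case 4
    hence "\<not> 5 dvd m" by (simp add: dvd_eq_mod_eq_0)
    moreover have "1 + \<omega> ^ 3 + (\<omega> ^ 3) ^ 2 + (\<omega> ^ 3) ^ 3 + (\<omega> ^ 3) ^ 4 = 0"
      using w5 w by algebra
    ultimately show ?thesis unfolding S 4 by (simp only: if_False)
  next
    case 5
    hence "\<not> 5 dvd m" by (simp add: dvd_eq_mod_eq_0)
    moreover have "1 + \<omega> ^ 4 + (\<omega> ^ 4) ^ 2 + (\<omega> ^ 4) ^ 3 + (\<omega> ^ 4) ^ 4 = 0"
      using w5 w by algebra
    ultimately show ?thesis unfolding S 5 by (simp only: if_False)
  qed
qed

section \<open>Behaviour of the infinite products at the origin\<close>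

lemma norm_qpoch_inf_minus_1:
  assumes "norm z < 1"
  shows "norm (qpoch_inf z z - 1) \<le> exp (norm z / (1 - norm z)) - 1"
proof (rule Lim_bounded[OF tendsto_norm[OF tendsto_diff[OF qpoch_LIMSEQ[OF assms] tendsto_const]]], intro allI impI)
  fix n :: nat
  have "norm (qpoch z z n - 1) = norm ((\<Prod>k<n. 1 + - (z * z ^ k)) - 1)"
    by (simp add: qpoch_def)
  also have "\<dots> \<le> (\<Prod>k<n. 1 + norm (- (z * z ^ k))) - 1"
    by (rule norm_prod_minus1_le_prod_minus1)
  also have "(\<Prod>k<n. 1 + norm (- (z * z ^ k))) \<le> (\<Prod>k<n. exp (norm z * norm z ^ k))"
    by (intro prod_mono conjI) (simp_all add: norm_mult norm_power exp_ge_add_one_self)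
  also have "(\<Prod>k<n. exp (norm z * norm z ^ k)) = exp (norm z * (\<Sum>k<n. norm z ^ k))"
    by (simp add: exp_sum[symmetric] sum_distrib_left)
  also have "\<dots> \<le> exp (norm z * (1 / (1 - norm z)))"
  proof -
    have "(\<Sum>k<n. norm z ^ k) \<le> (\<Sum>k. norm z ^ k)"
      using assms by (intro sum_le_suminf summable_geometric) auto
    also have "\<dots> = 1 / (1 - norm z)" using assms by (intro suminf_geometric) auto
    finally show ?thesis by (intro exp_le_cancel_iff[THEN iffD2] mult_left_mono) auto
  qed
  finally show "norm (qpoch z z n - 1) \<le> exp (norm z / (1 - norm z)) - 1" by simp
qed

lemma isCont_euler_E:
  assumes "j > 0"
  shows "euler_E j 0 = 1" "isCont (euler_E j) 0"
proof -
  have e1: "euler_E 1 0 = 1"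
    using norm_qpoch_inf_minus_1[of 0] by (simp add: euler_E_def)
  have "((\<lambda>z. euler_E 1 z - 1) \<longlongrightarrow> 0) (at 0)"
  proof (rule Lim_null_comparison)
    show "\<forall>\<^sub>F z in at 0. norm (euler_E 1 z - 1) \<le> exp (norm z / (1 - norm z)) - 1"
    proof -
      have "\<forall>\<^sub>F z in at 0. z \<in> ball (0 :: complex) 1 \<and> z \<in> UNIV"
        by (intro eventually_at_ball) simp
      thus ?thesis
      proof (rule eventually_mono)
        fix z :: complex
        assume "z \<in> ball 0 1 \<and> z \<in> UNIV"
        hence "norm z < 1" by simp
        from norm_qpoch_inf_minus_1[OF this]
        show "norm (euler_E 1 z - 1) \<le> exp (norm z / (1 - norm z)) - 1"
          unfolding euler_E_def power_one_right .
      qed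
    qed
    have "((\<lambda>z :: complex. exp (norm z / (1 - norm z)) - 1) \<longlongrightarrow> exp (norm (0 :: complex) / (1 - norm (0 :: complex))) - 1) (at 0)"
      by (intro tendsto_intros) auto
    thus "((\<lambda>z :: complex. exp (norm z / (1 - norm z)) - 1) \<longlongrightarrow> 0) (at 0)" by simp
  qed
  hence "isCont (euler_E 1) 0"
    unfolding isCont_def e1 by (simp add: Lim_null[symmetric])
  hence "isCont (\<lambda>z. euler_E 1 (z ^ j)) 0"
    using assms by (intro isCont_o2[of 0 "\<lambda>z. z ^ j" "euler_E 1"]) (auto simp: power_0_left)
  thus "isCont (euler_E j) 0" by (simp add: euler_E_power)
  show "euler_E j 0 = 1" using e1 euler_E_power[of 1 0 j] assms by (simp add: power_0_left)
qed

section \<open>The series of odd index and its average over the fifth roots of unity\<close>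

lemma mock_phi_odd_series:
  fixes a :: "nat \<Rightarrow> int"
  assumes a: "\<And>z :: complex. norm z < 1 \<Longrightarrow> (\<lambda>n. of_int (a (Suc n)) * z ^ Suc n) sums mock_phi z"
    and v: "norm v < 1" "v \<noteq> 0"
  shows "(\<lambda>n. of_int (a (2 * n + 1)) * v ^ (2 * n)) sums (theta 1 4 2 v ^ 3 / theta (-1) 2 0 v ^ 2)"
proof -
  define H where "H = theta 1 4 2 v ^ 3 / theta (-1) 2 0 v ^ 2"
  have "(\<lambda>n. of_int (a (Suc n)) * v ^ Suc n - of_int (a (Suc n)) * (- v) ^ Suc n) sums (mock_phi v - mock_phi (- v))"
    using v by (intro sums_diff a) auto
  also have "mock_phi v - mock_phi (- v) = 2 * v * H"
    using mock_phi_odd_part[OF v] theta_power[of 1 2 1 v 2] theta_power[of "-1" 1 0 v 2] by (simp add: H_def)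
  finally have "(\<lambda>n. of_int (a (Suc (2 * n))) * v ^ Suc (2 * n) - of_int (a (Suc (2 * n))) * (- v) ^ Suc (2 * n)) sums (2 * v * H)"
  proof (subst sums_mono_reindex[where g = "\<lambda>n. 2 * n"])
    fix n :: nat
    assume "n \<notin> range (\<lambda>n. 2 * n)"
    hence "odd n" by (metis dvdE rangeI)
    thus "of_int (a (Suc n)) * v ^ Suc n - of_int (a (Suc n)) * (- v) ^ Suc n = 0" by simp
  qed (auto simp: strict_mono_def)
  hence "(\<lambda>n. of_int (a (Suc (2 * n))) * v ^ Suc (2 * n) - of_int (a (Suc (2 * n))) * (- v) ^ Suc (2 * n)) sums (2 * v * H)" .
  hence "(\<lambda>n. (2 * v) * (of_int (a (2 * n + 1)) * v ^ (2 * n))) sums (2 * v * H)"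
    by (simp add: mult_ac)
  thus ?thesis unfolding H_def[symmetric] using v by (subst (asm) sums_mult_iff) auto
qed

text \<open>Each of the five summands is a monomial in q and the E_j, so they are compared one at a
  time. The prefactor is q \<psi>(q^5)^3 / \<theta>(q^5)^2.\<close>

lemma eta_identity:
  fixes q x1 x2 x5 x10 :: complex
  assumes nz: "q \<noteq> 0" "x1 \<noteq> 0" "x2 \<noteq> 0" "x5 \<noteq> 0" "x10 \<noteq> 0"
    and h: "h = x2 * x5 ^ 5 / (q * x1 * x10 ^ 5)"
    and m: "m = x2 ^ 4 * x5 ^ 2 / (q * x1 ^ 2 * x10 ^ 4)"
    and n: "n = x1 ^ 4 * x10 ^ 2 / (x2 ^ 2 * x5 ^ 4)"
  shows "q * (x10 ^ 8 / x5 ^ 7) * (5 * (46 * h ^ 2 / m + 460 * h / (n * m) + 1125 / (n ^ 2 * m) + 1875 / n ^ 4 + 15625 / (n ^ 6 * m))) =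
    5 * (46 * (x5 * x10 ^ 2 / x2 ^ 2) + 460 * q * (x10 ^ 5 / (x1 ^ 3 * x2)) + 1125 * q ^ 2 * (x10 ^ 8 / (x1 ^ 6 * x5))
        + 1875 * q * (x2 ^ 8 * x5 ^ 9 / x1 ^ 16) + 15625 * q ^ 2 * (x2 ^ 8 * x5 ^ 15 / x1 ^ 22))"
proof -
  define p where "p = q * (x10 ^ 8 / x5 ^ 7)"
  have 1: "p * (46 * h ^ 2 / m) = 46 * (x5 * x10 ^ 2 / x2 ^ 2)"
    unfolding p_def h m using nz by (simp add: divide_simps; algebra)
  have 2: "p * (460 * h / (n * m)) = 460 * q * (x10 ^ 5 / (x1 ^ 3 * x2))"
    unfolding p_def h m n using nz by (simp add: divide_simps; algebra)
  have 3: "p * (1125 / (n ^ 2 * m)) = 1125 * q ^ 2 * (x10 ^ 8 / (x1 ^ 6 * x5))"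
    unfolding p_def m n using nz by (simp add: divide_simps; algebra)
  have 4: "p * (1875 / n ^ 4) = 1875 * q * (x2 ^ 8 * x5 ^ 9 / x1 ^ 16)"
    unfolding p_def n using nz by (simp add: divide_simps; algebra)
  have 5: "p * (15625 / (n ^ 6 * m)) = 15625 * q ^ 2 * (x2 ^ 8 * x5 ^ 15 / x1 ^ 22)"
    unfolding p_def m n using nz by (simp add: divide_simps; algebra)
  have "p * (5 * (46 * h ^ 2 / m + 460 * h / (n * m) + 1125 / (n ^ 2 * m) + 1875 / n ^ 4 + 15625 / (n ^ 6 * m))) =
      5 * (p * (46 * h ^ 2 / m) + p * (460 * h / (n * m)) + p * (1125 / (n ^ 2 * m)) + p * (1875 / n ^ 4) + p * (15625 / (n ^ 6 * m)))"
    by (simp only: distrib_left mult.left_commute)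
  thus ?thesis unfolding 1 2 3 4 5 unfolding p_def .
qed

text \<open>Replacing w by \<eta> w fixes r = w^5 and multiplies t = w^2 by \<zeta> = \<eta>^2. The
  exponents 2, 4, 16, 8 of \<eta> belong to f, f^2, g^2, g; none is a multiple of 5, so averaging
  removes these terms.\<close>

lemma theta_dissection_component:
  fixes w :: complex
  assumes w: "norm w < 1" "w \<noteq> 0" and q_def: "q = w ^ 10"
  defines "rhs \<equiv> 5 * (46 * (euler_E 5 q * euler_E 10 q ^ 2 / euler_E 2 q ^ 2)
        + 460 * q * (euler_E 10 q ^ 5 / (euler_E 1 q ^ 3 * euler_E 2 q))
        + 1125 * q ^ 2 * (euler_E 10 q ^ 8 / (euler_E 1 q ^ 6 * euler_E 5 q))
        + 1875 * q * (euler_E 2 q ^ 8 * euler_E 5 q ^ 9 / euler_E 1 q ^ 16)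
        + 15625 * q ^ 2 * (euler_E 2 q ^ 8 * euler_E 5 q ^ 15 / euler_E 1 q ^ 22))"
  obtains X1 X2 X3 X4 where
    "\<And>\<eta>. \<eta> ^ 5 = 1 \<Longrightarrow> \<eta> ^ 2 * (theta 1 4 2 (\<eta> * w) ^ 3 / theta (-1) 2 0 (\<eta> * w) ^ 2) =
       w ^ 8 * rhs + X1 * \<eta> ^ 2 + X2 * \<eta> ^ 4 + X3 * \<eta> ^ 16 + X4 * \<eta> ^ 8"
proof -
  define r where "r = w ^ 5"
  have r: "norm r < 1" "r \<noteq> 0" using w by (auto simp: r_def intro!: norm_power_less_1)
  have qr: "q = r ^ 2" by (simp add: q_def r_def power_mult[symmetric])
  have q: "norm q < 1" "q \<noteq> 0" using r by (auto simp: qr intro!: norm_power_less_1)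
  define t where "t = w ^ 2"
  have t: "t \<noteq> 0" "t ^ 5 = q" using w by (simp_all add: t_def q_def power_mult[symmetric])
  \<comment> \<open>Up to powers of t and the factor 2, \<open>A\<close>, \<open>B\<close>,
    \<open>C\<close> are the components of \<psi>(t), and \<open>D\<close>, \<open>j3\<close>,
    \<open>j1\<close> those of \<theta>(t).\<close>
  define A where "A = theta 1 5 1 r"
  define B where "B = theta 1 5 3 r"
  define C where "C = theta 1 20 10 r"
  define D where "D = theta (-1) 10 0 r"
  define j1 where "j1 = theta (-1) 10 8 r"
  define j2 where "j2 = theta (-1) 10 6 r"
  define j3 where "j3 = theta (-1) 10 4 r"
  define j4 where "j4 = theta (-1) 10 2 r"
  define x1 where "x1 = euler_E 1 q"
  define x2 where "x2 = euler_E 2 q"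
  define x5 where "x5 = euler_E 5 q"
  define x10 where "x10 = euler_E 10 q"
  define \<psi> where "\<psi> = theta 1 4 2 r"
  define \<phi> where "\<phi> = theta (-1) 2 0 r"
  have x: "x1 \<noteq> 0" "x2 \<noteq> 0" "x5 \<noteq> 0" "x10 \<noteq> 0"
    unfolding x1_def x2_def x5_def x10_def by (intro euler_E_nonzero q; simp)+
  have j: "j1 \<noteq> 0" "j2 \<noteq> 0" "j3 \<noteq> 0" "j4 \<noteq> 0" "D \<noteq> 0"
    unfolding j1_def j2_def j3_def j4_def D_def by (rule theta_nonzero_10[OF r qr])+
  have W1: "(j4 * j3) * (j4 * j1) + q * (j4 * j1) * (j2 * j1) = (j3 * j2) * (D * j2)"
    and W2: "(j4 * j3) * (j3 * j2) - q * (j2 * j1) * (j3 * j2) = (j4 * j1) * (D * j4)"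
    unfolding j1_def j2_def j3_def j4_def D_def qr by (rule weierstrass[OF r])+
  have Ceq: "C = x10 ^ 2 / x5" using theta_20_10_eta[OF r qr] x unfolding C_def x5_def x10_def by (simp add: field_simps)
  have Deq: "D = x5 ^ 2 / x10" using theta_10_0_eta[OF r qr] x unfolding D_def x5_def x10_def by (simp add: field_simps)
  have psieq: "\<psi> = x2 ^ 2 / x1" using theta_psi_eta[OF r qr] x unfolding \<psi>_def x1_def x2_def by (simp add: field_simps)
  have phieq: "\<phi> = x1 ^ 2 / x2" using theta_theta4_eta[OF r qr] x unfolding \<phi>_def x1_def x2_def by (simp add: field_simps)
  have C0: "C \<noteq> 0" using x by (simp add: Ceq)
  have Aeq: "A = C * j4 * D / (j2 * j3)"
    using theta_A_eq[OF r qr] j unfolding A_def C_def j2_def j3_def j4_def D_def by (simp add: field_simps)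
  have Beq: "B = C * j2 * D / (j1 * j4)"
    using theta_B_eq[OF r qr] j unfolding B_def C_def j1_def j2_def j4_def D_def by (simp add: field_simps)
  have j13: "j1 * j3 = x1 * x10 ^ 3 / (x2 * x5)"
    using theta_FG_eta[OF r qr] x unfolding j1_def j3_def x1_def x2_def x5_def x10_def by (simp add: field_simps)
  define k where "k = q * j1 * j2 / (j3 * j4)"
  have k0: "k \<noteq> 0" using q j by (simp add: k_def)
  \<comment> \<open>Divided by suitable products, the two Weierstrass relations make 1 + k and 1 - k
    monomials in the theta functions. Every rational expression in k, 1 + k and 1 - k below becomes
    a monomial as well.\<close>
  have k1: "1 + k = j2 ^ 2 * D / (j4 ^ 2 * j1)"
  proof -
    have "(1 + k) * (j4 ^ 2 * j1) * j3 = (j4 * j3) * (j4 * j1) + q * (j4 * j1) * (j2 * j1)"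
      unfolding k_def using j by (simp add: field_simps power2_eq_square)
    also have "\<dots> = (j2 ^ 2 * D) * j3" unfolding W1 by (simp add: power2_eq_square)
    finally have "(1 + k) * (j4 ^ 2 * j1) = j2 ^ 2 * D" using j by simp
    thus ?thesis using j by (simp add: eq_divide_eq)
  qed
  have k2: "1 - k = j1 * j4 * D / (j2 * j3 ^ 2)"
  proof -
    have "(1 - k) * (j2 * j3 ^ 2) * j4 = (j4 * j3) * (j3 * j2) - q * (j2 * j1) * (j3 * j2)"
      unfolding k_def using j by (simp add: field_simps power2_eq_square)
    also have "\<dots> = (j1 * j4 * D) * j4" unfolding W2 by simp
    finally have "(1 - k) * (j2 * j3 ^ 2) = j1 * j4 * D" using j by simp
    thus ?thesis using j by (simp add: eq_divide_eq)
  qed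
  have kn: "1 - k \<noteq> 0" "1 + k \<noteq> 0" unfolding k1 k2 using j by simp_all
  define h where "h = (1 - k ^ 2) / k"
  have "h = (1 - k) * (1 + k) / k" by (simp add: h_def power2_eq_square algebra_simps)
  also have "\<dots> = D ^ 2 / (q * (j1 * j3))"
    unfolding k1 k2 unfolding k_def using j q by (simp add: divide_simps; algebra)
  finally have hj: "h = D ^ 2 / (q * (j1 * j3))" .
  have hx: "h = x2 * x5 ^ 5 / (q * x1 * x10 ^ 5)"
    unfolding hj j13 Deq using x q by (simp add: divide_simps; algebra)
  have h0: "h \<noteq> 0" unfolding hj using j q by simp
  have m: "h + 1 = \<psi> ^ 2 / (q * C ^ 2)"
  proof -
    have "\<psi> ^ 2 = A * B + q * C ^ 2"
      unfolding \<psi>_def A_def B_def C_def qr by (rule psi_square[OF r])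
    moreover have "A * B = q * C ^ 2 * h" unfolding Aeq Beq hj using j q by (simp add: divide_simps; algebra)
    ultimately show ?thesis using C0 q by (simp add: field_simps)
  qed
  have n: "1 - 4 / h = \<phi> ^ 2 / D ^ 2"
  proof -
    have "\<phi> ^ 2 = D ^ 2 - 4 * q * j1 * j3"
      unfolding \<phi>_def D_def j1_def j3_def qr by (rule theta4_square[OF r])
    thus ?thesis unfolding hj using j q by (simp add: divide_simps; algebra)
  qed
  have mx: "h + 1 = x2 ^ 4 * x5 ^ 2 / (q * x1 ^ 2 * x10 ^ 4)"
    unfolding m psieq Ceq using x q by (simp add: divide_simps; algebra)
  have nx: "1 - 4 / h = x1 ^ 4 * x10 ^ 2 / (x2 ^ 2 * x5 ^ 4)"
    unfolding n phieq Deq using x q by (simp add: divide_simps; algebra)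
  have m0: "h + 1 \<noteq> 0" and n0: "1 - 4 / h \<noteq> 0" unfolding mx nx using x q by simp_all
  define W where "W = 5 * (46 * h ^ 2 / (h + 1) + 460 * h / ((1 - 4 / h) * (h + 1)) + 1125 / ((1 - 4 / h) ^ 2 * (h + 1))
         + 1875 / (1 - 4 / h) ^ 4 + 15625 / ((1 - 4 / h) ^ 6 * (h + 1)))"
  obtain V1 V2 V3 V4 where V:
    "\<And>f g. f * g = - 4 * k / ((1 - k) * (1 + k)) \<Longrightarrow> f ^ 3 = - 2 / (k * (1 - k)) * g ^ 2 \<Longrightarrow>
        g ^ 3 = 2 * k ^ 2 / (1 + k) * f ^ 2 \<Longrightarrow> 1 + f + g \<noteq> 0 \<Longrightarrow>
      (1 + (1 + k) * (1 - k) ^ 2 / (4 * k) * f ^ 2 + (1 - k) * (1 + k) ^ 2 / (4 * k ^ 2) * g ^ 2) ^ 3 / (1 + f + g) ^ 2 =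
      weight_vec f g W V1 V2 V3 V4"
    using weight_component[OF k0 kn m0[unfolded h_def] n0[unfolded h_def]] unfolding W_def h_def by blast
  define f where "f = - 2 * t * j3 / D"
  define g where "g = 2 * t ^ 4 * j1 / D"
  have fg: "f * g = - 4 * k / ((1 - k) * (1 + k))"
    unfolding k1 k2 unfolding f_def g_def k_def t(2)[symmetric] using j t by (simp add: divide_simps; algebra)
  have f3: "f ^ 3 = - 2 / (k * (1 - k)) * g ^ 2"
    unfolding k2 unfolding f_def g_def k_def t(2)[symmetric] using j t by (simp add: divide_simps; algebra)
  have g3: "g ^ 3 = 2 * k ^ 2 / (1 + k) * f ^ 2"
    unfolding k1 unfolding f_def g_def k_def t(2)[symmetric] using j t by (simp add: divide_simps; algebra)
  have al: "(1 + k) * (1 - k) ^ 2 / (4 * k) * f ^ 2 = A / (t ^ 3 * C)"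
    unfolding k1 k2 unfolding f_def k_def t(2)[symmetric] Aeq using j t C0 by (simp add: divide_simps; algebra)
  have be: "(1 - k) * (1 + k) ^ 2 / (4 * k ^ 2) * g ^ 2 = B / (t ^ 2 * C)"
    unfolding k1 k2 unfolding g_def k_def t(2)[symmetric] Beq using j t C0 by (simp add: divide_simps; algebra)
  have w8: "t ^ 9 * (C ^ 3 / D ^ 2) * W = w ^ 8 * rhs"
  proof -
    \<comment> \<open>The power t^9 is the cube of the t^3 extracted from \<psi>(t). The part w^8 =
      t^4 belongs to the first selected exponent n = 4.\<close>
    have "t ^ 9 = w ^ 8 * q" by (simp add: t_def q_def power_mult[symmetric] power_add[symmetric])
    moreover have "C ^ 3 / D ^ 2 = x10 ^ 8 / x5 ^ 7"
      unfolding Ceq Deq using x by (simp add: divide_simps; algebra)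
    moreover have "q * (x10 ^ 8 / x5 ^ 7) * W = rhs"
      unfolding W_def rhs_def x1_def[symmetric] x2_def[symmetric] x5_def[symmetric] x10_def[symmetric]
      by (rule eta_identity[OF q(2) x hx mx nx])
    ultimately show ?thesis by (simp only: mult.assoc)
  qed
  define c where "c = t ^ 9 * (C ^ 3 / D ^ 2)"
  show ?thesis
  proof (rule that[of "c * V1 * f" "c * V2 * f ^ 2" "c * V3 * g ^ 2" "c * V4 * g"])
    fix \<eta> :: complex
    assume e: "\<eta> ^ 5 = 1"
    have e0: "\<eta> \<noteq> 0" using e by auto
    define \<zeta> where "\<zeta> = \<eta> ^ 2"
    have z5: "\<zeta> ^ 5 = 1"
    proof -
      have "\<zeta> ^ 5 = (\<eta> ^ 5) ^ 2" unfolding \<zeta>_def power_mult[symmetric] by (simp only: mult.commute)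
      thus ?thesis unfolding e by simp
    qed
    define F where "F = \<zeta> * f"
    define G where "G = \<zeta> ^ 4 * g"
    have "norm \<eta> = 1"
      using e by (metis norm_ge_zero norm_one norm_power power_eq_1_iff zero_neq_numeral)
    hence ew: "norm (\<eta> * w) < 1" "\<eta> * w \<noteq> 0" using w e0 by (auto simp: norm_mult)
    have ew5: "(\<eta> * w) ^ 5 = r" unfolding power_mult_distrib e r_def by simp
    have ewz: "(\<eta> * w) ^ 2 = \<zeta> * t" "(\<eta> * w) ^ 6 = \<zeta> ^ 3 * t ^ 3" "(\<eta> * w) ^ 8 = \<zeta> ^ 4 * t ^ 4"
      unfolding \<zeta>_def t_def power_mult_distrib power_mult[symmetric] by simp_all
    have P: "theta 1 4 2 (\<eta> * w) = A + \<zeta> * t * B + \<zeta> ^ 3 * t ^ 3 * C"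
      using psi_dissect5[OF ew] unfolding ew5 ewz A_def B_def C_def .
    have T: "theta (-1) 2 0 (\<eta> * w) = D - 2 * (\<zeta> * t) * j3 + 2 * (\<zeta> ^ 4 * t ^ 4) * j1"
      using theta4_dissect5[OF ew] unfolding ew5 ewz D_def j3_def j1_def .
    have T': "theta (-1) 2 0 (\<eta> * w) = D * (1 + F + G)"
      unfolding T F_def G_def f_def g_def using j by (simp add: field_simps)
    have T0: "theta (-1) 2 0 (\<eta> * w) \<noteq> 0"
    proof -
      have "norm ((\<eta> * w) ^ 2) < 1" "(\<eta> * w) ^ 2 \<noteq> 0" using ew by (auto intro!: norm_power_less_1)
      from theta_nonzero[OF this] show ?thesis using theta_power[of "-1" 1 0 "\<eta> * w" 2] by simp
    qed
    have FG: "F * G = - 4 * k / ((1 - k) * (1 + k))"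
    proof -
      have "F * G = \<zeta> ^ 5 * (f * g)" unfolding F_def G_def by algebra
      thus ?thesis unfolding z5 fg by simp
    qed
    have F3: "F ^ 3 = - 2 / (k * (1 - k)) * G ^ 2"
    proof -
      have "F ^ 3 = \<zeta> ^ 3 * f ^ 3" "G ^ 2 = \<zeta> ^ 5 * (\<zeta> ^ 3 * g ^ 2)" unfolding F_def G_def by algebra+
      thus ?thesis unfolding z5 f3 by simp
    qed
    have G3: "G ^ 3 = 2 * k ^ 2 / (1 + k) * F ^ 2"
    proof -
      have "F ^ 2 = \<zeta> ^ 2 * f ^ 2" "G ^ 3 = \<zeta> ^ 5 * \<zeta> ^ 5 * (\<zeta> ^ 2 * g ^ 3)" unfolding F_def G_def by algebra+
      thus ?thesis unfolding z5 g3 by simp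
    qed
    have P': "theta 1 4 2 (\<eta> * w) = \<zeta> ^ 3 * t ^ 3 * C * (1 + (1 + k) * (1 - k) ^ 2 / (4 * k) * F ^ 2 + (1 - k) * (1 + k) ^ 2 / (4 * k ^ 2) * G ^ 2)"
    proof -
      have a: "(1 + k) * (1 - k) ^ 2 / (4 * k) * F ^ 2 = \<zeta> ^ 2 * (A / (t ^ 3 * C))"
        unfolding al[symmetric] F_def by (simp add: power_mult_distrib)
      have "G ^ 2 = \<zeta> ^ 5 * \<zeta> ^ 3 * g ^ 2" unfolding G_def by algebra
      hence b: "(1 - k) * (1 + k) ^ 2 / (4 * k ^ 2) * G ^ 2 = \<zeta> ^ 3 * (B / (t ^ 2 * C))"
        unfolding be[symmetric] z5 by simp
      have "\<zeta> ^ 3 * t ^ 3 * C * (1 + \<zeta> ^ 2 * (A / (t ^ 3 * C)) + \<zeta> ^ 3 * (B / (t ^ 2 * C))) =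
          \<zeta> ^ 3 * t ^ 3 * C + \<zeta> ^ 5 * A + \<zeta> ^ 5 * \<zeta> * t * B"
        using C0 t by (simp add: divide_simps; algebra)
      thus ?thesis unfolding P a b z5 by simp
    qed
    \<comment> \<open>The factor \<zeta>^3 taken out of \<psi> contributes \<zeta>^9, and \<eta>^2 =
      \<zeta> completes it to \<zeta>^10 = 1. Thus exactly the component of weight zero is free of
      \<eta>.\<close>
    have "\<eta> ^ 2 * (theta 1 4 2 (\<eta> * w) ^ 3 / theta (-1) 2 0 (\<eta> * w) ^ 2) =
       (\<zeta> ^ 5) ^ 2 * c * ((1 + (1 + k) * (1 - k) ^ 2 / (4 * k) * F ^ 2 + (1 - k) * (1 + k) ^ 2 / (4 * k ^ 2) * G ^ 2) ^ 3 / (1 + F + G) ^ 2)"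
      unfolding P' T' c_def \<zeta>_def[symmetric] power_mult_distrib by (simp add: power_mult[symmetric] power_add[symmetric] power_Suc[symmetric] del: power_Suc)
    also have "\<dots> = c * weight_vec F G W V1 V2 V3 V4"
      using V[OF FG F3 G3] T0 unfolding T' z5 by simp
    also have "\<dots> = c * W + c * V1 * f * \<eta> ^ 2 + c * V2 * f ^ 2 * \<eta> ^ 4 + c * V3 * g ^ 2 * \<eta> ^ 16 + c * V4 * g * \<eta> ^ 8"
      unfolding weight_vec_def F_def G_def \<zeta>_def by algebra
    finally show "\<eta> ^ 2 * (theta 1 4 2 (\<eta> * w) ^ 3 / theta (-1) 2 0 (\<eta> * w) ^ 2) =
       w ^ 8 * rhs + c * V1 * f * \<eta> ^ 2 + c * V2 * f ^ 2 * \<eta> ^ 4 + c * V3 * g ^ 2 * \<eta> ^ 16 + c * V4 * g * \<eta> ^ 8"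
      unfolding c_def w8 .
  qed
qed

lemma regroup_power: "5 * (x * (v * y)) = 5 * v * (x * y)" for v x y :: complex
  by algebra

lemma coeff_sums_nonzero:
  fixes a :: "nat \<Rightarrow> int" and z :: complex
  assumes a: "\<And>z :: complex. norm z < 1 \<Longrightarrow> (\<lambda>n. of_int (a (Suc n)) * z ^ Suc n) sums mock_phi z"
    and z: "norm z < 1" "z \<noteq> 0"
  shows "(\<lambda>n. of_int (a (10 * n + 9)) * z ^ n) sums
    (5 * (46 * (euler_E 5 z * euler_E 10 z ^ 2 / euler_E 2 z ^ 2)
        + 460 * z * (euler_E 10 z ^ 5 / (euler_E 1 z ^ 3 * euler_E 2 z))
        + 1125 * z ^ 2 * (euler_E 10 z ^ 8 / (euler_E 1 z ^ 6 * euler_E 5 z))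
        + 1875 * z * (euler_E 2 z ^ 8 * euler_E 5 z ^ 9 / euler_E 1 z ^ 16)
        + 15625 * z ^ 2 * (euler_E 2 z ^ 8 * euler_E 5 z ^ 15 / euler_E 1 z ^ 22)))" (is "_ sums ?rhs")
proof -
  define R where "R = ?rhs"
  define w where "w = exp (Ln z / of_nat 10)"
  have w10: "z = w ^ 10"
    unfolding w_def exp_of_nat_mult[symmetric] using z by (simp add: exp_Ln)
  have w: "norm w < 1" "w \<noteq> 0"
  proof -
    show "norm w < 1"
    proof (rule ccontr)
      assume "\<not> norm w < 1"
      hence "norm w ^ 10 \<ge> 1" by (intro one_le_power) simp
      thus False using z by (simp add: w10 norm_power)
    qed
  qed (simp add: w_def)
  obtain X1 X2 X3 X4 where X: "\<And>\<eta>. \<eta> ^ 5 = 1 \<Longrightarrow> \<eta> ^ 2 * (theta 1 4 2 (\<eta> * w) ^ 3 / theta (-1) 2 0 (\<eta> * w) ^ 2) =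
       w ^ 8 * R + X1 * \<eta> ^ 2 + X2 * \<eta> ^ 4 + X3 * \<eta> ^ 16 + X4 * \<eta> ^ 8"
    using theta_dissection_component[OF w w10] unfolding R_def by blast
  obtain \<omega> :: complex where \<omega>: "\<omega> ^ 5 = 1" "1 + \<omega> + \<omega> ^ 2 + \<omega> ^ 3 + \<omega> ^ 4 = 0"
    by (rule fifth_root_of_unity)
  have root: "(\<omega> ^ i) ^ 5 = 1" for i
    by (simp only: power_mult[symmetric] mult.commute[of i]) (simp add: power_mult \<omega>)
  define c where "c = (\<lambda>n. of_int (a (2 * n + 1)) :: complex)"
  have s: "(\<lambda>n. \<eta> ^ 2 * (c n * (\<eta> * w) ^ (2 * n))) sums
      (w ^ 8 * R + X1 * \<eta> ^ 2 + X2 * \<eta> ^ 4 + X3 * \<eta> ^ 16 + X4 * \<eta> ^ 8)" if \<eta>: "\<eta> ^ 5 = 1" for \<eta>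
  proof -
    have "norm \<eta> = 1"
      using \<eta> by (metis norm_ge_zero norm_one norm_power power_eq_1_iff zero_neq_numeral)
    moreover have "\<eta> \<noteq> 0" using \<eta> by auto
    ultimately have "norm (\<eta> * w) < 1" "\<eta> * w \<noteq> 0" using w by (auto simp: norm_mult)
    from sums_mult[OF mock_phi_odd_series[OF a this], of "\<eta> ^ 2"]
    show ?thesis unfolding X[OF \<eta>] c_def .
  qed
  \<comment> \<open>On the left \<eta>^2 turns the exponent of \<eta> into 2n + 2, so the sum over
    the roots of unity selects n = 5m + 4, that is, the coefficients a(10m + 9).\<close>
  have "(\<lambda>n. \<Sum>i<5. (\<omega> ^ i) ^ 2 * (c n * (\<omega> ^ i * w) ^ (2 * n))) sums
      (\<Sum>i<5. w ^ 8 * R + X1 * (\<omega> ^ i) ^ 2 + X2 * (\<omega> ^ i) ^ 4 + X3 * (\<omega> ^ i) ^ 16 + X4 * (\<omega> ^ i) ^ 8)"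
    by (intro sums_sum s root)
  also have "(\<Sum>i<5. w ^ 8 * R + X1 * (\<omega> ^ i) ^ 2 + X2 * (\<omega> ^ i) ^ 4 + X3 * (\<omega> ^ i) ^ 16 + X4 * (\<omega> ^ i) ^ 8) =
      5 * (w ^ 8 * R)"
    unfolding sum.distrib sum_distrib_left[symmetric] sum_fifth_roots[OF \<omega>] by (simp add: sum_constant)
  also have "(\<lambda>n. \<Sum>i<5. (\<omega> ^ i) ^ 2 * (c n * (\<omega> ^ i * w) ^ (2 * n))) =
      (\<lambda>n. if 5 dvd 2 * n + 2 then 5 * (c n * w ^ (2 * n)) else 0)"
  proof
    fix n
    have "(\<Sum>i<5. (\<omega> ^ i) ^ 2 * (c n * (\<omega> ^ i * w) ^ (2 * n))) = (\<Sum>i<5. (\<omega> ^ i) ^ (2 * n + 2) * (c n * w ^ (2 * n)))"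
      by (intro sum.cong refl) (simp only: power_mult_distrib power_add mult_ac)
    also have "\<dots> = (if 5 dvd 2 * n + 2 then 5 else 0) * (c n * w ^ (2 * n))"
      unfolding sum_distrib_right[symmetric] sum_fifth_roots[OF \<omega>] ..
    finally show "(\<Sum>i<5. (\<omega> ^ i) ^ 2 * (c n * (\<omega> ^ i * w) ^ (2 * n))) = (if 5 dvd 2 * n + 2 then 5 * (c n * w ^ (2 * n)) else 0)"
      by simp
  qed
  finally have "(\<lambda>m. if 5 dvd 2 * (5 * m + 4) + 2 then 5 * (c (5 * m + 4) * w ^ (2 * (5 * m + 4))) else 0) sums (5 * (w ^ 8 * R))"
  proof (subst sums_mono_reindex[where g = "\<lambda>m. 5 * m + 4"])
    fix n :: nat
    assume n: "n \<notin> range (\<lambda>m. 5 * m + 4)"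
    have "\<not> 5 dvd 2 * n + 2"
    proof
      assume "5 dvd 2 * n + 2"
      hence "\<exists>m. n = 5 * m + 4" by presburger
      thus False using n by auto
    qed
    thus "(if 5 dvd 2 * n + 2 then 5 * (c n * w ^ (2 * n)) else 0) = 0" by simp
  qed (auto simp: strict_mono_def)
  moreover have "(if 5 dvd 2 * (5 * m + 4) + 2 then 5 * (c (5 * m + 4) * w ^ (2 * (5 * m + 4))) else 0) =
      5 * w ^ 8 * (of_int (a (10 * m + 9)) * z ^ m)" for m
  proof -
    have "2 * (5 * m + 4) + 2 = 5 * (2 * m + 2)" by simp
    hence d: "5 dvd 2 * (5 * m + 4) + 2" by (rule dvdI)
    have e: "w ^ (2 * (5 * m + 4)) = w ^ 8 * z ^ m"
      unfolding w10 power_mult[symmetric] power_add[symmetric] by (simp add: add.commute)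
    have f: "2 * (5 * m + 4) + 1 = 10 * m + 9" by simp
    have "5 * (x * (w ^ 8 * y)) = 5 * w ^ 8 * (x * y)" for x y :: complex by (rule regroup_power)
    thus ?thesis unfolding if_P[OF d] e c_def f .
  qed
  ultimately have s8: "(\<lambda>m. 5 * w ^ 8 * (of_int (a (10 * m + 9)) * z ^ m)) sums (5 * w ^ 8 * R)"
    by (simp only: mult.assoc)
  hence "(\<lambda>m. of_int (a (10 * m + 9)) * z ^ m) sums R"
    using w by (subst (asm) sums_mult_iff) simp_all
  thus ?thesis unfolding R_def .
qed

theorem theorem3p1:
  fixes a :: "nat \<Rightarrow> int" and q :: complex
  assumes a_def: "\<And>z :: complex. norm z < 1 \<Longrightarrow>
      (\<lambda>n. of_int (a (Suc n)) * z ^ Suc n) sums mock_phi z"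
    and q: "norm q < 1"
  shows "(\<lambda>n. of_int (a (10 * n + 9)) * q ^ n) sums
    (5 * (46 * (euler_E 5 q * euler_E 10 q ^ 2 / euler_E 2 q ^ 2)
        + 460 * q * (euler_E 10 q ^ 5 / (euler_E 1 q ^ 3 * euler_E 2 q))
        + 1125 * q ^ 2 * (euler_E 10 q ^ 8 / (euler_E 1 q ^ 6 * euler_E 5 q))
        + 1875 * q * (euler_E 2 q ^ 8 * euler_E 5 q ^ 9 / euler_E 1 q ^ 16)
        + 15625 * q ^ 2 * (euler_E 2 q ^ 8 * euler_E 5 q ^ 15 / euler_E 1 q ^ 22)))"
proof (cases "q = 0")
  case False
  show ?thesis by (rule coeff_sums_nonzero[OF a_def q False])
next
  case True
  \<comment> \<open>At the origin the identity is read off from its neighbourhood: the power series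
    and \<open>R\<close> are continuous there and agree on the punctured disc, so the constant
    coefficient is \<open>R 0\<close>.\<close>
  define R where "R = (\<lambda>q :: complex. 5 * (46 * (euler_E 5 q * euler_E 10 q ^ 2 / euler_E 2 q ^ 2)
        + 460 * q * (euler_E 10 q ^ 5 / (euler_E 1 q ^ 3 * euler_E 2 q))
        + 1125 * q ^ 2 * (euler_E 10 q ^ 8 / (euler_E 1 q ^ 6 * euler_E 5 q))
        + 1875 * q * (euler_E 2 q ^ 8 * euler_E 5 q ^ 9 / euler_E 1 q ^ 16)
        + 15625 * q ^ 2 * (euler_E 2 q ^ 8 * euler_E 5 q ^ 15 / euler_E 1 q ^ 22)))"
  define c where "c = (\<lambda>n. of_int (a (10 * n + 9)) :: complex)"
  have sums: "(\<lambda>n. c n * z ^ n) sums R z" if "norm z < 1" "z \<noteq> 0" for z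
    unfolding c_def R_def by (rule coeff_sums_nonzero[OF a_def that])
  have "isCont R 0"
    unfolding R_def by (intro continuous_intros isCont_euler_E(2)) (simp_all add: isCont_euler_E(1))
  hence R: "R \<midarrow>0\<rightarrow> R 0" by (simp only: isCont_def)
  \<comment> \<open>The point 1/2 is an arbitrary nonzero point of the disc; convergence there
    yields continuity of the power series at 0.\<close>
  have "summable (\<lambda>n. c n * (1 / 2) ^ n)"
    by (rule sums_summable[OF sums]) (simp_all add: norm_divide)
  hence "isCont (\<lambda>z. \<Sum>n. c n * z ^ n) 0"
    by (rule isCont_powser) (simp add: norm_divide)
  hence lim: "(\<lambda>z. \<Sum>n. c n * z ^ n) \<midarrow>0\<rightarrow> c 0"
    by (simp add: isCont_def)
  have ev: "\<forall>\<^sub>F z in at 0. (\<Sum>n. c n * z ^ n) = R z"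
  proof -
    have "\<forall>\<^sub>F z in at 0. z \<in> ball (0 :: complex) 1 \<and> z \<noteq> 0 \<and> z \<in> UNIV"
      by (intro eventually_at_ball') simp
    thus ?thesis
      by (rule eventually_mono) (use sums in \<open>auto simp: sums_iff\<close>)
  qed
  have "R \<midarrow>0\<rightarrow> c 0"
    by (rule Lim_transform_eventually[OF lim ev])
  hence c0: "c 0 = R 0" using R by (rule LIM_unique)
  have "(\<lambda>n. c n * q ^ n) sums R q"
    unfolding True c0[symmetric] by (rule powser_sums_zero)
  thus ?thesis unfolding c_def R_def .
qed

end
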